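(* Let $m\ge 1$ be an integer and write $\Gamma:=\Gamma(1/4)$. Then there exist rational numbers $c_{1,m},c_{2,m},d_{1,m},d_{2,m}\in\mathbb{Q}$ such that $$\int_0^{\infty}\frac{x^{4m}(\sinh x-\sin x)}{(\sinh^2x+\sin^2x)(\cosh x+\cos x)}\,dx=c_{1,m}\frac{\Gamma^{8m}}{\pi^{2m}}+c_{2,m}\frac{\Gamma^{8m+4}}{\pi^{2m+2}}$$ and $$\int_0^{\infty}\frac{x^{4m-2}(\sinh x+\sin x)}{(\sinh^2x+\sin^2x)(\cosh x+\cos x)}\,dx=d_{1,m}\frac{\Gamma^{8m-4}}{\pi^{2m-1}}+d_{2,m}\frac{\Gamma^{8m}}{\pi^{2m+1}}.$$
   Context: Here $\Gamma(1/4)$ is the value of the Euler Gamma function at $1/4$, and $\Gamma^{n}$ means $(\Gamma(1/4))^n$. *)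

theory Defs
  imports "HOL-Analysis.Analysis"
begin

end

theory Submission
  imports Defs "HOL-Complex_Analysis.Complex_Analysis"
begin

text \<open>
  With p = exp ((i - 1) x) and q = cnj p, the integrands are x^(2k) times four times the real part of
  (1 -+ i) p q / ((1 + p)^2 (1 - q^2)), for k = 2m and k = 2m - 1. Expanding in powers of p and q and
  integrating termwise turns each integral into a rational multiple of the sum of
  (-1)^n n / (n + i j)^(2k+1) over integers n and odd integers j, that is, of the derivative of order
  2k - 1 at the point i of U(z) = sum of (-1)^n n (d/dz) (pi / 2) coth (pi (z - n) / 2).

  The function U is quasi-elliptic for the lattice 2Z[i]: it is a combination of shifts of
  zeta zeta' and wp'. Since multiplication by i preserves the lattice, wp'' = 6 wp^2 - 2 e^2 with
  e = wp(1), and wp takes the values -e and 0 at the half periods i and 1 + i. So all Taylor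
  coefficients there are rational multiples of powers of e, and the derivative in question is a
  rational combination of e^k and e^(k+1) / pi. Finally e = Gamma(1/4)^4 / (32 pi), by inverting the
  elliptic integral.
\<close>

section \<open>Series of holomorphic functions on vertical strips\<close>

text \<open>The expansion produces the factor (1 -+ i) / (1 - i)^(2k+1), and the argument by real
  parts works only if this factor is real. With the sign - that happens exactly for even k, with +
  exactly for odd k; so sinh x - sin x belongs to x^(4m) and sinh x + sin x to x^(4m-2).

  The weight n is what forces quasi-elliptic functions: splitting n by parity leaves series with
  weight 2n, which change by a multiple of zeta' under the period 2. The quasi-period brings pi / 4
  into the Taylor series at i and i - 1, and zeta zeta' / pi could then leave terms in pi itself. In
  U the contributions of the two half periods cancel there, so only two shapes survive.

  For k = 1 the double series over n and j does not converge absolutely; the order, j inside and n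
  outside, is therefore kept throughout.\<close>

lemma summable_on_inverse_square_int: "(\<lambda>n::int. 1 / (of_int n)\<^sup>2 :: real) summable_on UNIV"
proof -
  have nat: "(\<lambda>n::nat. 1 / (real n)\<^sup>2) summable_on UNIV"
    using inverse_power_summable[of 2, where 'a = real]
    by (intro norm_summable_imp_summable_on) (auto simp: divide_inverse)
  have "(\<lambda>n::int. 1 / (of_int n)\<^sup>2 :: real) summable_on range int"
    using nat by (subst summable_on_reindex) (auto simp: o_def)
  moreover have "(\<lambda>n::int. 1 / (of_int n)\<^sup>2 :: real) summable_on range (\<lambda>n. - int n)"
    using nat by (subst summable_on_reindex) (auto simp: o_def inj_on_def)
  ultimately have "(\<lambda>n::int. 1 / (of_int n)\<^sup>2 :: real) summable_on range int \<union> range (\<lambda>n. - int n)"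
    by (intro summable_on_union)
  moreover have "range int \<union> range (\<lambda>n. - int n) = UNIV"
  proof -
    have "x \<in> range int \<union> range (\<lambda>n. - int n)" for x
      by (cases x rule: int_cases2) auto
    then show ?thesis by auto
  qed
  ultimately show ?thesis by simp
qed

lemma higher_deriv_sum:
  assumes "finite A" "open S" "z \<in> S" "\<And>n. n \<in> A \<Longrightarrow> f n holomorphic_on S"
  shows "(deriv ^^ m) (\<lambda>w. \<Sum>n\<in>A. f n w) z = (\<Sum>n\<in>A. (deriv ^^ m) (f n) z :: complex)"
  using assms(1,4)
proof (induction A rule: finite_induct)
  case (insert x F)
  have "(deriv ^^ m) (\<lambda>w. f x w + (\<Sum>n\<in>F. f n w)) z
      = (deriv ^^ m) (f x) z + (deriv ^^ m) (\<lambda>w. \<Sum>n\<in>F. f n w) z"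
    using assms insert by (intro higher_deriv_add[of _ S] holomorphic_intros) auto
  then show ?case using insert by simp
qed simp

text \<open>On a closed disc inside \<open>S\<close> only finitely many indices escape the bound,
  and their terms are bounded by compactness. So the M-test gives locally uniform convergence, which
  passes to all derivatives. A bound in terms of \<open>Re z\<close> alone is available because the
  terms used later are periodic in the imaginary direction.\<close>

lemma
  fixes f :: "int \<Rightarrow> complex \<Rightarrow> complex"
  assumes S: "open S" and holo: "\<And>n. f n holomorphic_on S"
    and bound: "\<And>R n z. of_int \<bar>n\<bar> > R \<Longrightarrow> z \<in> S \<Longrightarrow> \<bar>Re z\<bar> \<le> R \<Longrightarrow> norm (f n z) \<le> K / (of_int n)\<^sup>2"
  shows strip_series_has_sum: "z \<in> S \<Longrightarrow> ((\<lambda>n. f n z) has_sum (\<Sum>\<^sub>\<infinity>n. f n z)) UNIV"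
    and strip_series_holomorphic: "(\<lambda>z. \<Sum>\<^sub>\<infinity>n. f n z) holomorphic_on S"
    and strip_series_higher_deriv: "z \<in> S \<Longrightarrow>
      ((\<lambda>n. (deriv ^^ m) (f n) z) has_sum (deriv ^^ m) (\<lambda>z. \<Sum>\<^sub>\<infinity>n. f n z) z) UNIV"
proof -
  define F where "F = (\<lambda>z. \<Sum>\<^sub>\<infinity>n. f n z)"
  have main: "\<exists>r>0. cball z r \<subseteq> S \<and>
     uniform_limit (cball z r) (\<lambda>X y. \<Sum>n\<in>X. f n y) F (finite_subsets_at_top UNIV)"
    if z: "z \<in> S" for z
  proof -
    obtain r where r: "r > 0" "cball z r \<subseteq> S"
      using S z by (meson open_contains_cball)
    define R where "R = \<bar>Re z\<bar> + r"
    have Re: "\<bar>Re y\<bar> \<le> R" if "y \<in> cball z r" for y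
    proof -
      have "\<bar>Re y - Re z\<bar> \<le> r"
        using that abs_Re_le_cmod[of "y - z"] by (auto simp: dist_norm norm_minus_commute)
      then show ?thesis by (auto simp: R_def)
    qed
    have "\<exists>b. \<forall>y\<in>cball z r. norm (f n y) \<le> b" for n
    proof -
      have "continuous_on (cball z r) (f n)"
        using holo r by (meson holomorphic_on_imp_continuous_on holomorphic_on_subset)
      then have "bounded (f n ` cball z r)"
        by (intro compact_imp_bounded compact_continuous_image) auto
      then show ?thesis by (auto simp: bounded_iff)
    qed
    then obtain b where b: "\<And>n y. y \<in> cball z r \<Longrightarrow> norm (f n y) \<le> b n" by metis
    define A where "A = {n::int. of_int \<bar>n\<bar> \<le> R}"
    have "A \<subseteq> {-\<lceil>R\<rceil>..\<lceil>R\<rceil>}" by (auto simp: A_def) linarith+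
    then have "finite A" using finite_subset by blast
    define M where "M = (\<lambda>n. if n \<in> A then b n else K / (of_int n)\<^sup>2)"
    have "M summable_on (-A)"
    proof -
      have "(\<lambda>n::int. K * (1 / (of_int n)\<^sup>2)) summable_on (-A)"
        by (intro summable_on_cmult_right summable_on_subset_banach[OF summable_on_inverse_square_int]) auto
      then show ?thesis by (rule summable_on_cong[THEN iffD1, rotated]) (auto simp: M_def)
    qed
    then have "M summable_on A \<union> - A"
      using \<open>finite A\<close> by (intro summable_on_Un_disjoint) auto
    then have M: "M summable_on UNIV" by simp
    have "norm (f n y) \<le> M n" if "y \<in> cball z r" for n y
      using b[OF that] bound[of R n y] r Re[OF that] that by (auto simp: M_def A_def)
    then have "uniform_limit (cball z r) (\<lambda>X y. \<Sum>n\<in>X. f n y) F (finite_subsets_at_top UNIV)"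
      unfolding F_def by (intro Weierstrass_m_test_general[OF _ M]) auto
    then show ?thesis using r by blast
  qed
  have holF: "F holomorphic_on S"
    unfolding holomorphic_on_open[OF S]
  proof
    fix z assume "z \<in> S"
    then obtain r where r: "r > 0" "cball z r \<subseteq> S"
       and u: "uniform_limit (cball z r) (\<lambda>X y. \<Sum>n\<in>X. f n y) F (finite_subsets_at_top UNIV)"
      using main by blast
    have fh: "(\<lambda>y. \<Sum>n\<in>X. f n y) holomorphic_on cball z r" for X
      using holo r by (intro holomorphic_intros) (meson holomorphic_on_subset)
    have "F holomorphic_on ball z r"
      by (rule holomorphic_uniform_limit[OF _ u])
         (auto intro!: always_eventually holomorphic_on_imp_continuous_on[OF fh] holomorphic_on_subset[OF fh])
    then show "\<exists>f'. (F has_field_derivative f') (at z)"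
      using r by (subst (asm) holomorphic_on_open) auto
  qed
  have der: "((\<lambda>n. (deriv ^^ m) (f n) z) has_sum (deriv ^^ m) F z) UNIV" if z: "z \<in> S" for z m
  proof -
    obtain r where r: "r > 0" "cball z r \<subseteq> S"
       and u: "uniform_limit (cball z r) (\<lambda>X y. \<Sum>n\<in>X. f n y) F (finite_subsets_at_top UNIV)"
      using main z by blast
    have fh: "f n holomorphic_on ball z r" for n
      using holo[of n] r by (meson ball_subset_cball holomorphic_on_subset)
    have "((\<lambda>X. (deriv ^^ m) (\<lambda>y. \<Sum>n\<in>X. f n y) z) \<longlongrightarrow> (deriv ^^ m) F z) (finite_subsets_at_top UNIV)"
      using r by (intro higher_deriv_complex_uniform_limit[where A = "ball z r"]
          uniform_limit_on_subset[OF u] always_eventually) (auto intro!: holomorphic_intros fh)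
    moreover have "eventually (\<lambda>X. (deriv ^^ m) (\<lambda>y. \<Sum>n\<in>X. f n y) z = (\<Sum>n\<in>X. (deriv ^^ m) (f n) z))
        (finite_subsets_at_top (UNIV :: int set))"
      unfolding eventually_finite_subsets_at_top
      using r fh by (intro exI[of _ "{}"]) (auto intro!: higher_deriv_sum[of _ "ball z r"])
    ultimately show ?thesis
      unfolding has_sum_def by (rule Lim_transform_eventually)
  qed
  show "((\<lambda>n. f n z) has_sum (\<Sum>\<^sub>\<infinity>n. f n z)) UNIV" if "z \<in> S"
    using der[OF that, of 0] by (simp add: F_def)
  show "(\<lambda>z. \<Sum>\<^sub>\<infinity>n. f n z) holomorphic_on S" using holF by (simp add: F_def)
  show "((\<lambda>n. (deriv ^^ m) (f n) z) has_sum (deriv ^^ m) (\<lambda>z. \<Sum>\<^sub>\<infinity>n. f n z) z) UNIV" if "z \<in> S"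
    using der[OF that, of m] by (simp add: F_def)
qed

section \<open>Elliptic functions for the square lattice 2Z[i]\<close>

text \<open>With doubled Gaussian integers the half periods are 1, i and 1 + i, so the integer
  shifts in U are periods for even n and half periods for odd n.\<close>

definition sq_lattice :: "complex set" where
  "sq_lattice = {z. Re z / 2 \<in> \<int> \<and> Im z / 2 \<in> \<int>}"

lemma sq_lattice_iff: "z \<in> sq_lattice \<longleftrightarrow> (\<exists>a b::int. z = Complex (2 * of_int a) (2 * of_int b))"
proof
  assume "z \<in> sq_lattice"
  then obtain a b :: int where "Re z / 2 = of_int a" "Im z / 2 = of_int b"
    by (auto simp: sq_lattice_def elim!: Ints_cases)
  then show "\<exists>a b::int. z = Complex (2 * of_int a) (2 * of_int b)"
    by (intro exI[of _ a] exI[of _ b]) (auto simp: complex_eq_iff)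
qed (auto simp: sq_lattice_def)

lemma closed_sq_lattice: "closed sq_lattice"
proof -
  have "sq_lattice = (\<lambda>z. Re z / 2) -` \<int> \<inter> (\<lambda>z. Im z / 2) -` \<int>"
    by (auto simp: sq_lattice_def)
  moreover have "continuous_on UNIV (\<lambda>z::complex. Re z / 2)" "continuous_on UNIV (\<lambda>z::complex. Im z / 2)"
    by (intro continuous_intros; simp)+
  ultimately show ?thesis
    by (metis closed_Int closed_vimage closed_Ints)
qed

lemma open_compl_sq_lattice: "open (- sq_lattice)"
  using closed_sq_lattice by (simp add: open_Compl)

lemma sq_lattice_0 [simp]: "0 \<in> sq_lattice" by (auto simp: sq_lattice_def)

lemma sq_lattice_add_iff:
  assumes "w \<in> sq_lattice"
  shows "z + w \<in> sq_lattice \<longleftrightarrow> z \<in> sq_lattice"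
proof -
  have "Re w / 2 \<in> \<int>" "Im w / 2 \<in> \<int>" using assms by (auto simp: sq_lattice_def)
  then show ?thesis by (simp add: sq_lattice_def add_divide_distrib)
qed

lemma sq_lattice_diff_iff: "w \<in> sq_lattice \<Longrightarrow> z - w \<in> sq_lattice \<longleftrightarrow> z \<in> sq_lattice"
  using sq_lattice_add_iff[of w "z - w"] by simp

lemma sq_lattice_generators [simp]: "2 \<in> sq_lattice" "2 * \<i> \<in> sq_lattice"
  by (auto simp: sq_lattice_def)

lemma sq_lattice_uminus_iff [simp]: "- z \<in> sq_lattice \<longleftrightarrow> z \<in> sq_lattice"
  by (auto simp: sq_lattice_def)

lemma sq_lattice_times_i_iff [simp]: "\<i> * z \<in> sq_lattice \<longleftrightarrow> z \<in> sq_lattice"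
  by (auto simp: sq_lattice_def)

lemma norm_sq_lattice: 
  assumes "z \<in> sq_lattice" "norm z < 2"
  shows "z = 0"
proof -
  obtain a b :: int where z: "z = Complex (2 * of_int a) (2 * of_int b)"
    using assms sq_lattice_iff by blast
  have "\<bar>2 * of_int a\<bar> < (2::real)" "\<bar>2 * of_int b\<bar> < (2::real)"
    using assms(2) abs_Re_le_cmod[of z] abs_Im_le_cmod[of z] by (auto simp: z)
  then have "a = 0" "b = 0" by linarith+
  then show ?thesis by (simp add: z complex_eq_iff)
qed

text \<open>By periodicity it suffices to continue f holomorphically at the origin.\<close>

lemma sq_lattice_periodic_constant:
  assumes holo: "f holomorphic_on (- sq_lattice)"
    and per: "\<And>z. z \<notin> sq_lattice \<Longrightarrow> f (z + 2) = f z" "\<And>z. z \<notin> sq_lattice \<Longrightarrow> f (z + 2 * \<i>) = f z"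
    and g: "g holomorphic_on ball 0 1" and eq: "\<And>z. z \<in> ball 0 1 - {0} \<Longrightarrow> f z = g z"
  shows "\<exists>C. \<forall>z. z \<notin> sq_lattice \<longrightarrow> f z = C"
proof -
  define F where "F = (\<lambda>z. if z \<in> sq_lattice then g 0 else f z)"
  have F1: "F (z + 2) = F z" and F2: "F (z + 2 * \<i>) = F z" for z
    by (auto simp: F_def per sq_lattice_add_iff)
  have F1': "F (z + 2 * of_nat n) = F z" and F2': "F (z + 2 * of_nat n * \<i>) = F z" for z n
  proof (induction n)
    case (Suc n)
    { case 1 then show ?case using F1[of "z + 2 * of_nat n"] Suc by (simp add: algebra_simps) }
    { case 2 then show ?case using F2[of "z + 2 * of_nat n * \<i>"] Suc by (simp add: algebra_simps) }
  qed auto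
  have F1'': "F (z + 2 * of_int n) = F z" for z n
    using F1'[of z "nat n"] F1'[of "z + 2 * of_int n" "nat (-n)"] by (cases "n \<ge> 0") auto
  have F2'': "F (z + 2 * of_int n * \<i>) = F z" for z n
    using F2'[of z "nat n"] F2'[of "z + 2 * of_int n * \<i>" "nat (-n)"] by (cases "n \<ge> 0") auto
  have per': "F (z + w) = F z" if "w \<in> sq_lattice" for z w
  proof -
    obtain a b :: int where w: "w = Complex (2 * of_int a) (2 * of_int b)"
      using \<open>w \<in> sq_lattice\<close> sq_lattice_iff by blast
    have "w = 2 * of_int a + 2 * of_int b * \<i>" by (simp add: w complex_eq_iff)
    then show ?thesis using F1''[of z a] F2''[of "z + 2 * of_int a" b] by (simp add: add_ac)
  qed
  have F_eq_g: "F z = g z" if "z \<in> ball 0 1" for z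
    using that eq[of z] norm_sq_lattice[of z] by (cases "z = 0") (auto simp: F_def)
  have "F field_differentiable at z" for z
  proof (cases "z \<in> sq_lattice")
    case True
    have "((\<lambda>w. g (w - z)) has_field_derivative deriv g 0) (at z)"
      using holomorphic_derivI[OF g, of 0] DERIV_shift[of g "deriv g 0" z "-z"] by simp
    moreover have "eventually (\<lambda>w. g (w - z) = F w) (nhds z)"
    proof -
      have "eventually (\<lambda>w. w \<in> ball z 1) (nhds z)"
        by (intro eventually_nhds_in_open) auto
      then show ?thesis
      proof eventually_elim
        case (elim w)
        then show ?case using per'[OF True, of "w - z"] F_eq_g[of "w - z"]
          by (auto simp: dist_norm norm_minus_commute)
      qed
    qed
    ultimately have "(F has_field_derivative deriv g 0) (at z)"
      by (subst (asm) DERIV_cong_ev[OF refl _ refl]) auto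
    then show ?thesis by (auto simp: field_differentiable_def)
  next
    case False
    have "(f has_field_derivative deriv f z) (at z)"
      using holo False open_compl_sq_lattice by (auto intro!: holomorphic_derivI)
    moreover have "eventually (\<lambda>w. f w = F w) (nhds z)"
      using eventually_nhds_in_open[OF open_compl_sq_lattice, of z] False
      by (auto elim!: eventually_mono simp: F_def)
    ultimately have "(F has_field_derivative deriv f z) (at z)"
      by (subst (asm) DERIV_cong_ev[OF refl _ refl]) auto
    then show ?thesis by (auto simp: field_differentiable_def)
  qed
  then have FU: "F holomorphic_on UNIV" by (simp add: holomorphic_on_def)
  \<comment> \<open>A closed fundamental square already carries all values of the entire function
    \<open>F\<close>, so \<open>F\<close> is bounded and Liouville's theorem applies.\<close>
  define B where "B = cbox (Complex 0 0) (Complex 2 2)"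
  have "range F \<subseteq> F ` B"
  proof
    fix y assume "y \<in> range F"
    then obtain z where z: "y = F z" by auto
    define a b where "a = \<lfloor>Re z / 2\<rfloor>" and "b = \<lfloor>Im z / 2\<rfloor>"
    have "Complex (2 * of_int a) (2 * of_int b) \<in> sq_lattice" by (auto simp: sq_lattice_def)
    moreover have "z - Complex (2 * of_int a) (2 * of_int b) \<in> B"
      unfolding B_def a_def b_def by (auto simp: in_cbox_complex_iff) linarith+
    ultimately show "y \<in> F ` B"
      using per'[of "Complex (2 * of_int a) (2 * of_int b)" "z - Complex (2 * of_int a) (2 * of_int b)"] z
      by (auto intro!: image_eqI)
  qed
  moreover have "bounded (F ` B)"
    by (intro compact_imp_bounded compact_continuous_image)
       (auto simp: B_def intro: holomorphic_on_imp_continuous_on holomorphic_on_subset[OF FU])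
  ultimately have "bounded (range F)" using bounded_subset by blast
  then obtain C where "\<And>z. F z = C"
    using Liouville_theorem[OF FU] by (auto simp: constant_on_def)
  then show ?thesis by (metis F_def)
qed

section \<open>Hyperbolic series\<close>

text \<open>The scaling puts the poles at the even multiples of i and makes every residue 1.\<close>

definition cth :: "complex \<Rightarrow> complex" where
  "cth z = of_real (pi / 2) * (cosh (of_real (pi / 2) * z) / sinh (of_real (pi / 2) * z))"

definition dcth :: "complex \<Rightarrow> complex" where
  "dcth z = - (of_real (pi / 2) / sinh (of_real (pi / 2) * z))\<^sup>2"

section \<open>Lower bounds for sinh and decay of \<open>cth\<close> and \<open>dcth\<close>\<close>

lemma sinh_half_pi_eq_0_iff: "sinh (of_real (pi / 2) * z) = (0 :: complex) \<longleftrightarrow> Re z = 0 \<and> Im z / 2 \<in> \<int>"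
proof -
  have "sinh (of_real (pi / 2) * z) = 0 \<longleftrightarrow> exp (of_real (pi / 2) * z) ^ 2 = 1"
    by (simp add: sinh_zero_iff power2_eq_1_iff)
  also have "exp (of_real (pi / 2) * z) ^ 2 = exp (of_real pi * z)"
    by (simp flip: exp_double)
  also have "exp (of_real pi * z) = 1 \<longleftrightarrow> Re z = 0 \<and> (\<exists>n::int. pi * Im z = of_int (2 * n) * pi)"
    by (simp add: exp_eq_1)
  also have "(\<exists>n::int. pi * Im z = of_int (2 * n) * pi) \<longleftrightarrow> (\<exists>n::int. Im z / 2 = of_int n)"
    by (intro ex_cong1) auto
  also have "\<dots> \<longleftrightarrow> Im z / 2 \<in> \<int>" by (auto elim!: Ints_cases)
  finally show ?thesis .
qed

lemma norm_sinh_ge: "\<bar>sinh (Re w)\<bar> \<le> norm (sinh (w :: complex))"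
proof -
  have "\<bar>norm (exp w) - norm (exp (-w))\<bar> \<le> norm (exp w - exp (-w))"
    by (rule norm_triangle_ineq3)
  then show ?thesis by (simp add: sinh_field_def abs_divide norm_divide)
qed

text \<open>Quadratic growth is enough: squared in \<open>dcth\<close> it gives decay of order 4,
  hence order 3 after the weight in \<open>V_term\<close>.\<close>

lemma sinh_ge_square:
  fixes y :: real
  assumes "y \<ge> 0"
  shows "sinh y \<ge> y\<^sup>2 / 4"
proof -
  have "exp y \<ge> 1 + y + y\<^sup>2 / 2" using exp_lower_Taylor_quadratic[OF assms] .
  moreover have "exp (-y) \<le> 1" using assms by simp
  ultimately have "exp y - exp (-y) \<ge> y\<^sup>2 / 2" using assms by linarith
  then show ?thesis by (simp add: sinh_field_def)
qed

lemma norm_sinh_half_pi_ge: "norm (sinh (of_real (pi / 2) * z :: complex)) \<ge> (pi / 2 * Re z)\<^sup>2 / 4"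
proof -
  have "(pi / 2 * Re z)\<^sup>2 / 4 = \<bar>pi / 2 * Re z\<bar>\<^sup>2 / 4" by (simp only: power2_abs)
  also have "\<dots> \<le> sinh \<bar>pi / 2 * Re z\<bar>" by (rule sinh_ge_square) simp
  also have "\<dots> = \<bar>sinh (Re (of_real (pi / 2) * z))\<bar>"
    using sinh_real_abs[of "pi / 2 * Re z"] by (simp del: sinh_real_abs)
  also have "\<dots> \<le> norm (sinh (of_real (pi / 2) * z))" by (rule norm_sinh_ge)
  finally show ?thesis .
qed

lemma norm_dcth_le:
  assumes "Re z \<noteq> 0"
  shows "norm (dcth z) \<le> 16 / Re z ^ 4"
proof -
  have "norm (dcth z) = (pi / 2)\<^sup>2 / (norm (sinh (of_real (pi / 2) * z)))\<^sup>2"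
    by (simp add: dcth_def norm_power norm_divide norm_mult power_divide)
  also have "\<dots> \<le> (pi / 2)\<^sup>2 / ((pi / 2 * Re z)\<^sup>2 / 4)\<^sup>2"
    using assms norm_sinh_half_pi_ge[of z] by (intro divide_left_mono power_mono mult_pos_pos) auto
  also have "\<dots> = (16 / Re z ^ 4) * (2 / pi)\<^sup>2"
    using assms by (simp add: field_simps power2_eq_square power4_eq_xxxx)
  also have "\<dots> \<le> (16 / Re z ^ 4) * 1"
    using pi_gt3 by (intro mult_left_mono power_le_one) auto
  finally show ?thesis by simp
qed

lemma cth_uminus [simp]: "cth (- z) = - cth z"
  by (simp add: cth_def)

lemma dcth_uminus [simp]: "dcth (- z) = dcth z"
  by (simp add: dcth_def)

lemma norm_cth_diff_le_aux:
  assumes "Re z > 0"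
  shows "norm (cth z - of_real (pi / 2)) \<le> 8 / (Re z)\<^sup>2"
proof -
  define y where "y = of_real (pi / 2) * z"
  have "sinh y \<noteq> 0" using assms sinh_half_pi_eq_0_iff[of z] by (simp add: y_def)
  then have "cosh y / sinh y - 1 = exp (-y) / sinh y"
    by (simp add: field_simps flip: cosh_minus_sinh)
  then have "cth z - of_real (pi / 2) = of_real (pi / 2) * (exp (-y) / sinh y)"
    unfolding cth_def y_def[symmetric] by (metis mult.right_neutral right_diff_distrib)
  then have "norm (cth z - of_real (pi / 2)) = pi / 2 * (exp (- Re y) / norm (sinh y))"
    by (simp add: norm_mult norm_divide)
  also have "\<dots> \<le> pi / 2 * (1 / ((pi / 2 * Re z)\<^sup>2 / 4))"
    using assms norm_sinh_half_pi_ge[of z]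
    by (intro mult_left_mono frac_le) (auto simp: y_def)
  also have "\<dots> = (8 / (Re z)\<^sup>2) * (1 / pi)"
    using assms by (simp add: field_simps power2_eq_square)
  also have "\<dots> \<le> (8 / (Re z)\<^sup>2) * 1"
    using pi_gt3 by (intro mult_left_mono) auto
  finally show ?thesis by simp
qed

text \<open>The limits pi / 2 and -pi / 2 at the two ends are what the sign in
  \<open>zeta_term\<close> is made to cancel.\<close>

lemma norm_cth_diff_le:
  assumes "Re z \<noteq> 0"
  shows "norm (cth z - of_real (pi / 2 * sgn (Re z))) \<le> 8 / (Re z)\<^sup>2"
proof (cases "Re z > 0")
  case False
  have "norm (cth (-z) - of_real (pi / 2)) \<le> 8 / (Re z)\<^sup>2"
    using norm_cth_diff_le_aux[of "-z"] False assms by simp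
  also have "norm (cth (-z) - of_real (pi / 2)) = norm (cth z + of_real (pi / 2))"
    unfolding cth_uminus by (metis minus_add_distrib norm_minus_cancel uminus_add_conv_diff add.commute)
  finally show ?thesis using False assms by simp
qed (use norm_cth_diff_le_aux in auto)

lemma cth_periodic: "cth (z + 2 * \<i>) = cth z" and dcth_periodic: "dcth (z + 2 * \<i>) = dcth z"
proof -
  have *: "of_real (pi / 2) * (z + 2 * \<i>) = of_real (pi / 2) * z + of_real pi * \<i>"
    by (simp add: algebra_simps)
  have "\<i> * (of_real pi * \<i>) = - of_real pi" by (simp add: algebra_simps)
  then have "sinh (of_real pi * \<i>) = 0" "cosh (of_real pi * \<i>) = -1"
    unfolding sinh_conv_sin cosh_conv_cos by (simp_all flip: sin_of_real cos_of_real)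
  then show "cth (z + 2 * \<i>) = cth z" "dcth (z + 2 * \<i>) = dcth z"
    unfolding cth_def dcth_def * by (simp_all add: sinh_add cosh_add)
qed

lemma has_field_derivative_cth:
  assumes "\<not> (Re z = 0 \<and> Im z / 2 \<in> \<int>)"
  shows "(cth has_field_derivative dcth z) (at z)"
proof -
  have nz: "sinh (of_real (pi / 2) * z) \<noteq> 0" using assms sinh_half_pi_eq_0_iff by blast
  define c where "c = (of_real (pi / 2) :: complex)"
  have "((\<lambda>z. c * (cosh (c * z) / sinh (c * z))) has_field_derivative c *
     ((sinh (c * z) * c * sinh (c * z) - cosh (c * z) * (cosh (c * z) * c)) / (sinh (c * z) * sinh (c * z)))) (at z)"
    using nz unfolding c_def[symmetric] by (auto intro!: derivative_eq_intros simp: algebra_simps)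
  also have "c * ((sinh (c * z) * c * sinh (c * z) - cosh (c * z) * (cosh (c * z) * c)) / (sinh (c * z) * sinh (c * z))) =
     c\<^sup>2 * ((sinh (c * z))\<^sup>2 - (cosh (c * z))\<^sup>2) / (sinh (c * z))\<^sup>2"
    by (simp add: power2_eq_square algebra_simps)
  also have "\<dots> = dcth z"
    by (simp add: dcth_def cosh_square_eq power_divide c_def)
  finally show ?thesis by (simp only: cth_def [abs_def] c_def)
qed

lemma cth_holomorphic: "cth holomorphic_on - {z. Re z = 0 \<and> Im z / 2 \<in> \<int>}"
proof -
  have "cth field_differentiable at z within - {z. Re z = 0 \<and> Im z / 2 \<in> \<int>}"
    if "z \<in> - {z. Re z = 0 \<and> Im z / 2 \<in> \<int>}" for z
    using has_field_derivative_at_within[OF has_field_derivative_cth[of z]] that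
    unfolding field_differentiable_def by blast
  then show ?thesis by (simp add: holomorphic_on_def)
qed

lemma dcth_holomorphic: "dcth holomorphic_on - {z. Re z = 0 \<and> Im z / 2 \<in> \<int>}"
proof -
  have "(\<lambda>z. - (of_real (pi / 2) / (- \<i> * sin (\<i> * (of_real (pi / 2) * z))))\<^sup>2)
      holomorphic_on - {z. Re z = 0 \<and> Im z / 2 \<in> \<int>}"
    using sinh_half_pi_eq_0_iff[unfolded sinh_conv_sin]
    by (intro holomorphic_intros) (simp del: of_real_divide)
  then show ?thesis by (simp add: dcth_def [abs_def] sinh_conv_sin)
qed

lemma cth_pole:
  obtains h where "h holomorphic_on ball 0 1" "\<And>z. z \<in> ball 0 1 - {0} \<Longrightarrow> cth z = 1 / z + h z"
proof -
  \<comment> \<open>\<open>\<sigma>\<close> is sinh (pi z / 2) / z with its singularity removed, and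
    it has no zero in the disc. So \<open>\<phi>\<close> below continues z times
    \<open>cth z\<close>, its value 1 at the origin is the residue, and the difference quotient of
    \<open>\<phi>\<close> is the regular part \<open>h\<close>.\<close>
  define \<sigma> where "\<sigma> = (\<lambda>z::complex. if z = 0 then deriv (\<lambda>z. sinh (of_real (pi / 2) * z)) 0
      else (sinh (of_real (pi / 2) * z) - sinh (of_real (pi / 2) * 0)) / (z - 0))"
  have d: "deriv (\<lambda>z::complex. sinh (of_real (pi / 2) * z)) 0 = of_real (pi / 2)"
    by (rule DERIV_imp_deriv) (auto intro!: derivative_eq_intros)
  have \<sigma>: "\<sigma> holomorphic_on UNIV"
    unfolding \<sigma>_def
    by (rule pole_lemma_open) (auto simp: sinh_conv_sin [abs_def] intro!: holomorphic_intros)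
  have \<sigma>0: "\<sigma> 0 = of_real (pi / 2)" using d by (simp add: \<sigma>_def)
  have nz: "\<sigma> z \<noteq> 0" if "z \<in> ball 0 1" for z
  proof (cases "z = 0")
    case False
    then have "z \<notin> sq_lattice" using norm_sq_lattice[of z] that by auto
    then have "sinh (of_real (pi / 2) * z) \<noteq> 0"
      using sinh_half_pi_eq_0_iff[of z] by (auto simp: sq_lattice_def)
    then show ?thesis using False by (simp add: \<sigma>_def)
  qed (simp add: \<sigma>0)
  define \<phi> where "\<phi> = (\<lambda>z. of_real (pi / 2) * cosh (of_real (pi / 2) * z) / \<sigma> z)"
  have \<phi>: "\<phi> holomorphic_on ball 0 1"
    unfolding \<phi>_def cosh_conv_cos
    using nz by (auto intro!: holomorphic_intros holomorphic_on_subset[OF \<sigma>])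
  define h where "h = (\<lambda>z. if z = 0 then deriv \<phi> 0 else (\<phi> z - \<phi> 0) / (z - 0))"
  show ?thesis
  proof
    show "h holomorphic_on ball 0 1" unfolding h_def using \<phi> by (rule pole_lemma_open) simp
    show "cth z = 1 / z + h z" if "z \<in> ball 0 1 - {0}" for z
    proof -
      have "\<phi> 0 = 1" by (simp add: \<phi>_def \<sigma>0)
      moreover have "cth z = \<phi> z / z" using that by (auto simp: cth_def \<phi>_def \<sigma>_def)
      ultimately show ?thesis using that by (simp add: h_def field_simps)
    qed
  qed
qed

text \<open>The sign term makes the series of shifted hyperbolic cotangents converge absolutely. The resulting function
  has period 2i and quasi-period 2; it is the Weierstrass zeta function of the lattice 2Z[i] plus
  pi z / 4, which is where the pi / 4 in the Weierstrass function wp comes from.\<close>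

definition zeta_term :: "int \<Rightarrow> complex \<Rightarrow> complex" where
  "zeta_term n z = cth (z - 2 * of_int n) + of_real (pi / 2 * sgn (of_int n))"

definition zeta_sq :: "complex \<Rightarrow> complex" where
  "zeta_sq z = (\<Sum>\<^sub>\<infinity>n. zeta_term n z)"

definition wp_sq :: "complex \<Rightarrow> complex" where
  "wp_sq z = of_real (pi / 4) - deriv zeta_sq z"

text \<open>The weight is the shift itself, so the series is no longer periodic in the real
  direction. The term n = 0 vanishes identically, which removes the pole at the origin but not those
  at 2, -2 and so on.\<close>

definition V_term :: "int \<Rightarrow> complex \<Rightarrow> complex" where
  "V_term n z = 2 * of_int n * dcth (z - 2 * of_int n)"

definition V_sq :: "complex \<Rightarrow> complex" where
  "V_sq z = (\<Sum>\<^sub>\<infinity>n. V_term n z)"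

section \<open>Convergence, parity and quasi-periods of the shifted series\<close>

lemma not_pole_shifted:
  assumes "z \<in> - (sq_lattice - {0})" "z \<noteq> 0 \<or> n \<noteq> 0"
  shows "\<not> (Re (z - 2 * of_int n) = 0 \<and> Im (z - 2 * of_int n) / 2 \<in> \<int>)"
proof
  assume *: "Re (z - 2 * of_int n) = 0 \<and> Im (z - 2 * of_int n) / 2 \<in> \<int>"
  then have "z \<in> sq_lattice" by (auto simp: sq_lattice_def)
  with assms have "z = 0" "n \<noteq> 0" by auto
  with * show False by simp
qed

lemma shifted_real_part:
  assumes "of_int \<bar>n\<bar> > R" "\<bar>Re z\<bar> \<le> R"
  shows "sgn (Re (z - 2 * of_int n)) = - sgn (of_int n)" "Re (z - 2 * of_int n) \<noteq> 0"
    "\<bar>of_int n\<bar> \<le> \<bar>Re (z - 2 * of_int n)\<bar>" "n \<noteq> 0"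
proof -
  have n: "n \<noteq> 0" using assms by auto
  consider "n > 0" "Re z - 2 * of_int n \<le> - of_int n" | "n < 0" "Re z - 2 * of_int n \<ge> - of_int n"
    using assms n by linarith
  then have *: "sgn (Re (z - 2 * of_int n)) = - sgn (of_int n) \<and> Re (z - 2 * of_int n) \<noteq> 0 \<and>
      \<bar>of_int n\<bar> \<le> \<bar>Re (z - 2 * of_int n)\<bar>"
  proof cases
    case 1
    then have "Re z - 2 * of_int n < 0" "real_of_int n > 0" by auto
    then show ?thesis using 1 by simp
  next
    case 2
    then have "Re z - 2 * of_int n > 0" "real_of_int n < 0" by auto
    then show ?thesis using 2 by simp
  qed
  then show "sgn (Re (z - 2 * of_int n)) = - sgn (of_int n)" "Re (z - 2 * of_int n) \<noteq> 0"
    "\<bar>of_int n\<bar> \<le> \<bar>Re (z - 2 * of_int n)\<bar>" "n \<noteq> 0" using n by blast+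
qed

lemma zeta_term_bound:
  assumes "of_int \<bar>n\<bar> > R" "\<bar>Re z\<bar> \<le> R"
  shows "norm (zeta_term n z) \<le> 8 / (of_int n)\<^sup>2"
proof -
  note s = shifted_real_part[OF assms]
  have "norm (zeta_term n z) \<le> 8 / (Re (z - 2 * of_int n))\<^sup>2"
    using norm_cth_diff_le[OF s(2)] unfolding s(1) zeta_term_def by simp
  also have "\<dots> \<le> 8 / (of_int n)\<^sup>2"
    using s(2-4) by (intro divide_left_mono) (auto simp: abs_le_square_iff)
  finally show ?thesis .
qed

lemma V_term_bound:
  assumes "of_int \<bar>n\<bar> > R" "\<bar>Re z\<bar> \<le> R"
  shows "norm (V_term n z) \<le> 32 / (of_int n)\<^sup>2"
proof -
  note s = shifted_real_part[OF assms]
  have n: "\<bar>of_int n\<bar> \<ge> (1::real)" using s(4) by linarith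
  have "norm (dcth (z - 2 * of_int n)) \<le> 16 / (Re (z - 2 * of_int n)) ^ 4"
    by (rule norm_dcth_le[OF s(2)])
  also have "(Re (z - 2 * of_int n)) ^ 4 = \<bar>Re (z - 2 * of_int n)\<bar> ^ 4"
    by (rule power_even_abs[symmetric]) simp
  also have "16 / \<bar>Re (z - 2 * of_int n)\<bar> ^ 4 \<le> 16 / \<bar>of_int n\<bar> ^ 4"
    using s n by (intro divide_left_mono power_mono mult_pos_pos zero_less_power) auto
  finally have "norm (dcth (z - 2 * of_int n)) \<le> 16 / \<bar>of_int n\<bar> ^ 4" .
  then have "(2 * \<bar>of_int n\<bar>) * norm (dcth (z - 2 * of_int n)) \<le> (2 * \<bar>of_int n\<bar>) * (16 / \<bar>of_int n\<bar> ^ 4)"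
    by (rule mult_left_mono) simp
  then have "norm (V_term n z) \<le> (2 * \<bar>of_int n\<bar>) * (16 / \<bar>of_int n\<bar> ^ 4)"
    by (simp only: V_term_def norm_mult norm_of_int norm_numeral)
  also have "\<dots> = 32 / \<bar>of_int n\<bar> ^ 3"
    using n by (simp add: field_simps power3_eq_cube power4_eq_xxxx)
  also have "\<dots> \<le> 32 / \<bar>of_int n\<bar> ^ 2"
    using n by (intro divide_left_mono power_increasing mult_pos_pos zero_less_power) auto
  finally show ?thesis by simp
qed

lemma open_compl_punctured_sq_lattice: "open (- (sq_lattice - {0}))"
proof -
  have "- (sq_lattice - {0}) = - sq_lattice \<union> ball 0 1"
    using norm_sq_lattice by auto
  then show ?thesis using open_compl_sq_lattice by auto
qed

lemma zeta_term_holomorphic: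
  assumes "S \<subseteq> - (sq_lattice - {0})" "0 \<notin> S \<or> n \<noteq> 0"
  shows "zeta_term n holomorphic_on S"
proof -
  have "(cth \<circ> (\<lambda>z. z - 2 * of_int n)) holomorphic_on S"
  proof (rule holomorphic_on_compose_gen[OF _ cth_holomorphic])
    show "(\<lambda>z. z - 2 * of_int n) ` S \<subseteq> - {z. Re z = 0 \<and> Im z / 2 \<in> \<int>}"
    proof clarify
      fix z assume "z \<in> S" "Re (z - 2 * of_int n) = 0" "Im (z - 2 * of_int n) / 2 \<in> \<int>"
      moreover have "z \<in> - (sq_lattice - {0})" "z \<noteq> 0 \<or> n \<noteq> 0" using assms \<open>z \<in> S\<close> by auto
      ultimately show False using not_pole_shifted by blast
    qed
  qed (intro holomorphic_intros)
  then show ?thesis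
    unfolding zeta_term_def o_def by (auto intro!: holomorphic_intros)
qed

lemma V_term_holomorphic:
  assumes "S \<subseteq> - (sq_lattice - {0})"
  shows "V_term n holomorphic_on S"
proof (cases "n = 0")
  case False
  have "(dcth \<circ> (\<lambda>z. z - 2 * of_int n)) holomorphic_on S"
    by (rule holomorphic_on_compose_gen[OF _ dcth_holomorphic])
       (use assms False not_pole_shifted[of _ n] in \<open>auto intro!: holomorphic_intros\<close>)
  then show ?thesis
    unfolding V_term_def o_def by (auto intro!: holomorphic_intros)
qed (simp add: V_term_def [abs_def])

lemma
  shows zeta_sq_has_sum: "z \<notin> sq_lattice \<Longrightarrow> ((\<lambda>n. zeta_term n z) has_sum zeta_sq z) UNIV"
    and zeta_sq_holomorphic: "zeta_sq holomorphic_on - sq_lattice"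
    and zeta_sq_higher_deriv: "z \<notin> sq_lattice \<Longrightarrow>
       ((\<lambda>n. (deriv ^^ m) (zeta_term n) z) has_sum (deriv ^^ m) zeta_sq z) UNIV"
proof -
  have 1: "zeta_term n holomorphic_on - sq_lattice" for n
    by (rule zeta_term_holomorphic) auto
  note * = open_compl_sq_lattice 1 zeta_term_bound
  show "((\<lambda>n. zeta_term n z) has_sum zeta_sq z) UNIV" if "z \<notin> sq_lattice"
    unfolding zeta_sq_def by (rule strip_series_has_sum[OF *]) (use that in auto)
  show "zeta_sq holomorphic_on - sq_lattice"
    unfolding zeta_sq_def by (rule strip_series_holomorphic[OF *])
  show "((\<lambda>n. (deriv ^^ m) (zeta_term n) z) has_sum (deriv ^^ m) zeta_sq z) UNIV" if "z \<notin> sq_lattice"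
    unfolding zeta_sq_def [abs_def] by (rule strip_series_higher_deriv[OF *]) (use that in auto)
qed

lemma
  shows V_sq_has_sum: "z \<in> - (sq_lattice - {0}) \<Longrightarrow> ((\<lambda>n. V_term n z) has_sum V_sq z) UNIV"
    and V_sq_holomorphic: "V_sq holomorphic_on - (sq_lattice - {0})"
    and V_sq_higher_deriv: "z \<in> - (sq_lattice - {0}) \<Longrightarrow>
       ((\<lambda>n. (deriv ^^ m) (V_term n) z) has_sum (deriv ^^ m) V_sq z) UNIV"
proof -
  have 1: "V_term n holomorphic_on - (sq_lattice - {0})" for n
    by (rule V_term_holomorphic) auto
  note * = open_compl_punctured_sq_lattice 1 V_term_bound
  show "((\<lambda>n. V_term n z) has_sum V_sq z) UNIV" if "z \<in> - (sq_lattice - {0})"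
    unfolding V_sq_def by (rule strip_series_has_sum[OF *]) (use that in auto)
  show "V_sq holomorphic_on - (sq_lattice - {0})"
    unfolding V_sq_def by (rule strip_series_holomorphic[OF *])
  show "((\<lambda>n. (deriv ^^ m) (V_term n) z) has_sum (deriv ^^ m) V_sq z) UNIV" if "z \<in> - (sq_lattice - {0})"
    unfolding V_sq_def [abs_def] by (rule strip_series_higher_deriv[OF *]) (use that in auto)
qed

lemma zeta_sq_uminus:
  assumes "z \<notin> sq_lattice"
  shows "zeta_sq (- z) = - zeta_sq z"
proof -
  have "((\<lambda>n. zeta_term (- n) (- z)) has_sum zeta_sq (- z)) UNIV"
    using zeta_sq_has_sum[of "-z"] assms
    by (subst has_sum_reindex_bij_betw[of uminus UNIV UNIV]) (auto simp: bij_uminus)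
  moreover have "zeta_term (- n) (- z) = - zeta_term n z" for n
    using cth_uminus[of "z - 2 * of_int n"] by (simp add: zeta_term_def sgn_minus)
  moreover have "((\<lambda>n. - zeta_term n z) has_sum - zeta_sq z) UNIV"
    using zeta_sq_has_sum[OF assms] by (intro has_sum_uminusI)
  ultimately show ?thesis by (auto intro: has_sum_unique)
qed

lemma V_sq_uminus:
  assumes "z \<notin> sq_lattice"
  shows "V_sq (- z) = - V_sq z"
proof -
  have "((\<lambda>n. V_term (- n) (- z)) has_sum V_sq (- z)) UNIV"
    using V_sq_has_sum[of "-z"] assms
    by (subst has_sum_reindex_bij_betw[of uminus UNIV UNIV]) (auto simp: bij_uminus)
  moreover have "V_term (- n) (- z) = - V_term n z" for n
    using dcth_uminus[of "z - 2 * of_int n"] by (simp add: V_term_def)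
  moreover have "((\<lambda>n. - V_term n z) has_sum - V_sq z) UNIV"
    using V_sq_has_sum[of z] assms by (intro has_sum_uminusI) auto
  ultimately show ?thesis by (auto intro: has_sum_unique)
qed

lemma zeta_sq_shift_imaginary: "zeta_sq (z + 2 * \<i>) = zeta_sq z"
proof -
  have "zeta_term n (z + 2 * \<i>) = zeta_term n z" for n
    using cth_periodic[of "z - 2 * of_int n"] by (simp add: zeta_term_def algebra_simps)
  then show ?thesis by (simp add: zeta_sq_def)
qed

lemma V_sq_shift_imaginary: "V_sq (z + 2 * \<i>) = V_sq z"
proof -
  have "V_term n (z + 2 * \<i>) = V_term n z" for n
    using dcth_periodic[of "z - 2 * of_int n"] by (simp add: V_term_def algebra_simps)
  then show ?thesis by (simp add: V_sq_def)
qed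

lemma bij_add_int: "bij (\<lambda>n::int. n + 1)"
  by (rule bij_betw_byWitness[of _ "\<lambda>n. n - 1"]) auto

lemma zeta_sq_shift_real:
  assumes "z \<notin> sq_lattice"
  shows "zeta_sq (z + 2) = zeta_sq z + of_real pi"
proof -
  have "z + 2 \<notin> sq_lattice" using assms by (simp add: sq_lattice_add_iff)
  then have "((\<lambda>n. zeta_term (n + 1) (z + 2)) has_sum zeta_sq (z + 2)) UNIV"
    using zeta_sq_has_sum[of "z + 2"]
    by (subst has_sum_reindex_bij_betw[of "\<lambda>n. n + 1" UNIV UNIV]) (auto simp: bij_add_int)
  \<comment> \<open>Reindexing shifts the hyperbolic terms but not the signs. Only n = -1 and n = 0
    notice this, each contributing pi / 2.\<close>
  moreover have "((\<lambda>n::int. of_real (pi / 2 * (sgn (of_int (n + 1)) - sgn (of_int n)))) has_sum (of_real pi :: complex)) UNIV"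
    by (rule has_sum_finite_neutralI[of "{-1, 0}"]) (auto simp: sgn_if)
  then have "((\<lambda>n. zeta_term n z + of_real (pi / 2 * (sgn (of_int (n + 1)) - sgn (of_int n)))) has_sum (zeta_sq z + of_real pi)) UNIV"
    by (intro has_sum_add zeta_sq_has_sum assms)
  moreover have "zeta_term (n + 1) (z + 2) = zeta_term n z + of_real (pi / 2 * (sgn (of_int (n + 1)) - sgn (of_int n)))" for n
    by (simp add: zeta_term_def algebra_simps)
  ultimately show ?thesis by (auto intro: has_sum_unique)
qed

lemma has_field_derivative_zeta_term:
  assumes "z \<notin> sq_lattice"
  shows "(zeta_term n has_field_derivative dcth (z - 2 * of_int n)) (at z)"
proof -
  have "z - 2 * of_int n \<notin> {z. Re z = 0 \<and> Im z / 2 \<in> \<int>}"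
  proof -
    have "z \<in> - (sq_lattice - {0})" "z \<noteq> 0" using assms by auto
    then show ?thesis using not_pole_shifted[of z n] by blast
  qed
  then have "((\<lambda>z. cth (z - 2 * of_int n)) has_field_derivative dcth (z - 2 * of_int n)) (at z)"
    using DERIV_shift[of cth "dcth (z - 2 * of_int n)" z "- 2 * of_int n"] has_field_derivative_cth[of "z - 2 * of_int n"] by simp
  then show ?thesis
    unfolding zeta_term_def [abs_def] by (auto intro!: derivative_eq_intros)
qed

lemma deriv_zeta_sq_has_sum:
  assumes "z \<notin> sq_lattice"
  shows "((\<lambda>n. dcth (z - 2 * of_int n)) has_sum deriv zeta_sq z) UNIV"
  using zeta_sq_higher_deriv[OF assms, of 1] DERIV_imp_deriv[OF has_field_derivative_zeta_term[OF assms]]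
  by simp

text \<open>After reindexing the weight is 2n + 2 instead of 2n; the excess 2 sums to twice the
  series of \<open>deriv zeta_sq\<close>.\<close>

lemma V_sq_shift_real:
  assumes "z \<notin> sq_lattice"
  shows "V_sq (z + 2) = V_sq z + 2 * deriv zeta_sq z"
proof -
  have "z + 2 \<notin> sq_lattice" using assms by (simp add: sq_lattice_add_iff)
  then have "((\<lambda>n. V_term (n + 1) (z + 2)) has_sum V_sq (z + 2)) UNIV"
    using V_sq_has_sum[of "z + 2"]
    by (subst has_sum_reindex_bij_betw[of "\<lambda>n. n + 1" UNIV UNIV]) (auto simp: bij_add_int)
  moreover have "((\<lambda>n. V_term n z + 2 * dcth (z - 2 * of_int n)) has_sum (V_sq z + 2 * deriv zeta_sq z)) UNIV"
    using assms by (intro has_sum_add V_sq_has_sum has_sum_cmult_right deriv_zeta_sq_has_sum) auto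
  moreover have "V_term (n + 1) (z + 2) = V_term n z + 2 * dcth (z - 2 * of_int n)" for n
    by (simp add: V_term_def algebra_simps)
  ultimately show ?thesis by (auto intro: has_sum_unique)
qed

text \<open>Only the term n = 0 has a pole at the origin, and the other terms form a series
  holomorphic there. Oddness makes the regular part vanish at 0, which the cancellation of poles in
  \<open>V_sq_eq\<close> depends on.\<close>

lemma zeta_sq_pole:
  obtains h where "h holomorphic_on ball 0 1" "h 0 = 0"
    "\<And>z. z \<in> ball 0 1 - {0} \<Longrightarrow> zeta_sq z = 1 / z + h z"
proof -
  obtain h0 where h0: "h0 holomorphic_on ball 0 1" "\<And>z. z \<in> ball 0 1 - {0} \<Longrightarrow> cth z = 1 / z + h0 z"
    using cth_pole by blast
  define r where "r = (\<lambda>z. \<Sum>\<^sub>\<infinity>n. (if n = 0 then 0 else zeta_term n z))"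
  have 1: "(\<lambda>z. if n = 0 then 0 else zeta_term n z) holomorphic_on - (sq_lattice - {0})" for n
    using zeta_term_holomorphic[of "- (sq_lattice - {0})" n] by (cases "n = 0") auto
  have 2: "norm (if n = 0 then 0 else zeta_term n z) \<le> 8 / (of_int n)\<^sup>2"
    if "of_int \<bar>n\<bar> > R" "\<bar>Re z\<bar> \<le> R" for n R z
    using zeta_term_bound[OF that] by auto
  have r: "r holomorphic_on - (sq_lattice - {0})"
    unfolding r_def by (rule strip_series_holomorphic[OF open_compl_punctured_sq_lattice 1 2])
  have r_sum: "((\<lambda>n. if n = 0 then 0 else zeta_term n z) has_sum r z) UNIV" if "z \<in> - (sq_lattice - {0})" for z
    unfolding r_def using that by (rule strip_series_has_sum[OF open_compl_punctured_sq_lattice 1 2, rotated 2])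
  have zeta: "zeta_sq z = cth z + r z" if "z \<notin> sq_lattice" for z
  proof -
    have "((\<lambda>n. (if n = 0 then zeta_term 0 z else 0) + (if n = 0 then 0 else zeta_term n z)) has_sum (cth z + r z)) UNIV"
      using that by (intro has_sum_add r_sum has_sum_finite_neutralI[of "{0}"]) (auto simp: zeta_term_def)
    then have "((\<lambda>n. zeta_term n z) has_sum (cth z + r z)) UNIV"
      by (rule has_sum_cong[THEN iffD1, rotated]) auto
    then show ?thesis using zeta_sq_has_sum[OF that] has_sum_unique by blast
  qed
  define h where "h = (\<lambda>z. h0 z + r z)"
  have hol: "h holomorphic_on ball 0 1"
    unfolding h_def using h0 norm_sq_lattice
    by (intro holomorphic_intros holomorphic_on_subset[OF r]) auto
  have eq: "zeta_sq z = 1 / z + h z" if "z \<in> ball 0 1 - {0}" for z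
  proof -
    have "z \<notin> sq_lattice" using norm_sq_lattice[of z] that by auto
    then show ?thesis using zeta[of z] h0(2)[OF that] by (simp add: h_def)
  qed
  have odd: "h (- z) = - h z" if "z \<in> ball 0 1 - {0}" for z
  proof -
    have "z \<notin> sq_lattice" using norm_sq_lattice[of z] that by auto
    then have "1 / (- z) + h (- z) = - (1 / z + h z)"
      using eq[of z] eq[of "-z"] zeta_sq_uminus[of z] that by simp
    then show ?thesis by simp
  qed
  have "h 0 = 0"
  proof -
    have c: "isCont h 0" using hol by (auto intro: continuous_on_interior holomorphic_on_imp_continuous_on)
    then have "(h \<longlongrightarrow> h 0) (at 0)" by (simp add: isCont_def)
    moreover have "((\<lambda>z. - h (- z)) \<longlongrightarrow> - h 0) (at 0)"
      using c by (auto intro!: tendsto_eq_intros isCont_tendsto_compose[of _ h])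
    moreover have "eventually (\<lambda>z. - h (- z) = h z) (at 0)"
      using eventually_at_in_open[of "ball 0 1" "0::complex"] by (auto elim!: eventually_mono simp: odd)
    ultimately have "h 0 = - h 0"
      using tendsto_unique[OF at_neq_bot] Lim_transform_eventually by blast
    then show ?thesis by simp
  qed
  then show ?thesis using that hol eq by blast
qed

section \<open>Differential equation and quasi-periods\<close>

text \<open>One chain-rule statement for all symmetries: a = 1 serves the periods and quasi-periods,
  a = -1 the parity.\<close>

lemma deriv_functional_eq_sq:
  assumes f: "f holomorphic_on - sq_lattice" and z: "z \<notin> sq_lattice" "a * z + w \<notin> sq_lattice"
    and eq: "\<And>u. u \<notin> sq_lattice \<Longrightarrow> f (a * u + w) = b * f u + c"
  shows "a * deriv f (a * z + w) = b * deriv f z"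
proof -
  have d: "(f has_field_derivative deriv f u) (at u)" if "u \<notin> sq_lattice" for u
    using f that open_compl_sq_lattice by (auto intro!: holomorphic_derivI)
  have "((\<lambda>u. f (a * u + w)) has_field_derivative deriv f (a * z + w) * a) (at z)"
    by (rule DERIV_chain2[where f = f]) (auto intro!: derivative_eq_intros d z)
  then have "((\<lambda>u. b * f u + c) has_field_derivative deriv f (a * z + w) * a) (at z)"
    by (rule has_field_derivative_transform_within_open[where S = "- sq_lattice"])
       (use open_compl_sq_lattice z eq in auto)
  moreover have "((\<lambda>u. b * f u + c) has_field_derivative b * deriv f z) (at z)"
    by (auto intro!: derivative_eq_intros d z)
  ultimately show ?thesis using DERIV_unique by (metis mult.commute)
qed

lemma deriv_zeta_sq_holomorphic: "deriv zeta_sq holomorphic_on - sq_lattice"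
  using zeta_sq_holomorphic open_compl_sq_lattice by (rule holomorphic_deriv)

lemma wp_sq_holomorphic: "wp_sq holomorphic_on - sq_lattice"
  unfolding wp_sq_def by (intro holomorphic_intros deriv_zeta_sq_holomorphic)

lemma deriv_wp_sq_holomorphic: "deriv wp_sq holomorphic_on - sq_lattice"
  using wp_sq_holomorphic open_compl_sq_lattice by (rule holomorphic_deriv)

lemma deriv_zeta_sq_shift:
  assumes "z \<notin> sq_lattice"
  shows "deriv zeta_sq (z + 2) = deriv zeta_sq z" "deriv zeta_sq (z + 2 * \<i>) = deriv zeta_sq z"
    "deriv zeta_sq (- z) = deriv zeta_sq z"
  using deriv_functional_eq_sq[OF zeta_sq_holomorphic assms, of 1 2 1 "of_real pi"]
    deriv_functional_eq_sq[OF zeta_sq_holomorphic assms, of 1 "2 * \<i>" 1 0]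
    deriv_functional_eq_sq[OF zeta_sq_holomorphic assms, of "-1" 0 "-1" 0] assms
  by (simp_all add: sq_lattice_add_iff zeta_sq_shift_real zeta_sq_shift_imaginary zeta_sq_uminus)

lemma wp_sq_shift:
  assumes "z \<notin> sq_lattice"
  shows "wp_sq (z + 2) = wp_sq z" "wp_sq (z + 2 * \<i>) = wp_sq z" "wp_sq (- z) = wp_sq z"
  using deriv_zeta_sq_shift[OF assms] by (simp_all add: wp_sq_def)

lemma deriv_wp_sq_shift:
  assumes "z \<notin> sq_lattice"
  shows "deriv wp_sq (z + 2) = deriv wp_sq z" "deriv wp_sq (z + 2 * \<i>) = deriv wp_sq z"
    "deriv wp_sq (- z) = - deriv wp_sq z"
  using deriv_functional_eq_sq[OF wp_sq_holomorphic assms, of 1 2 1 0]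
    deriv_functional_eq_sq[OF wp_sq_holomorphic assms, of 1 "2 * \<i>" 1 0]
    deriv_functional_eq_sq[OF wp_sq_holomorphic assms, of "-1" 0 "1" 0] assms
  by (simp_all add: sq_lattice_add_iff wp_sq_shift minus_equation_iff)

lemma deriv_deriv_wp_sq_shift:
  assumes "z \<notin> sq_lattice"
  shows "deriv (deriv wp_sq) (z + 2) = deriv (deriv wp_sq) z"
    "deriv (deriv wp_sq) (z + 2 * \<i>) = deriv (deriv wp_sq) z"
  using deriv_functional_eq_sq[OF deriv_wp_sq_holomorphic assms, of 1 2 1 0]
    deriv_functional_eq_sq[OF deriv_wp_sq_holomorphic assms, of 1 "2 * \<i>" 1 0] assms
  by (simp_all add: sq_lattice_add_iff deriv_wp_sq_shift)

text \<open>Expressing all principal parts through a single \<open>h\<close> turns the cancellation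
  of poles in the later Liouville arguments into identities in \<open>h\<close> and its
  derivatives.\<close>

lemma zeta_sq_expansion:
  obtains h where "h holomorphic_on ball 0 1" "h 0 = 0"
    "\<And>z. z \<in> ball 0 1 - {0} \<Longrightarrow> zeta_sq z = 1 / z + h z"
    "\<And>z. z \<in> ball 0 1 - {0} \<Longrightarrow> deriv zeta_sq z = - 1 / z\<^sup>2 + deriv h z"
    "\<And>z. z \<in> ball 0 1 - {0} \<Longrightarrow> deriv wp_sq z = - 2 / z ^ 3 - deriv (deriv h) z"
    "\<And>z. z \<in> ball 0 1 - {0} \<Longrightarrow> deriv (deriv wp_sq) z = 6 / z ^ 4 - deriv (deriv (deriv h)) z"
proof -
  obtain h where h: "h holomorphic_on ball 0 1" "h 0 = 0"
    "\<And>z. z \<in> ball 0 1 - {0} \<Longrightarrow> zeta_sq z = 1 / z + h z"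
    using zeta_sq_pole by blast
  have h1: "deriv h holomorphic_on ball 0 1" by (rule holomorphic_deriv[OF h(1)]) simp
  then have h2: "deriv (deriv h) holomorphic_on ball 0 1" by (rule holomorphic_deriv) simp
  have tr: "deriv f z = g'"
    if "z \<in> ball 0 1 - {0}" "(g has_field_derivative g') (at z)" "\<And>u. u \<in> ball 0 1 - {0} \<Longrightarrow> f u = g u"
    for f g :: "complex \<Rightarrow> complex" and g' z
    by (rule DERIV_imp_deriv, rule has_field_derivative_transform_within_open[OF that(2), of "ball 0 1 - {0}"])
       (use that in auto)
  have 1: "deriv zeta_sq z = - 1 / z\<^sup>2 + deriv h z" if z: "z \<in> ball 0 1 - {0}" for z
    by (rule tr[OF z, where g = "\<lambda>z. 1 / z + h z"])
       (use z h in \<open>auto intro!: derivative_eq_intros holomorphic_derivI simp: power2_eq_square divide_inverse\<close>)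
  have 2: "wp_sq z = of_real (pi / 4) + 1 / z\<^sup>2 - deriv h z" if z: "z \<in> ball 0 1 - {0}" for z
    using 1[OF z] by (simp add: wp_sq_def)
  have 3: "deriv wp_sq z = - 2 / z ^ 3 - deriv (deriv h) z" if z: "z \<in> ball 0 1 - {0}" for z
    by (rule tr[OF z, where g = "\<lambda>z. of_real (pi / 4) + 1 / z\<^sup>2 - deriv h z"])
       (use z h1 2 in \<open>auto intro!: derivative_eq_intros holomorphic_derivI simp: power2_eq_square power3_eq_cube field_simps\<close>)
  have 4: "deriv (deriv wp_sq) z = 6 / z ^ 4 - deriv (deriv (deriv h)) z" if z: "z \<in> ball 0 1 - {0}" for z
    by (rule tr[OF z, where g = "\<lambda>z. - 2 / z ^ 3 - deriv (deriv h) z"])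
       (use z h2 3 in \<open>auto intro!: derivative_eq_intros holomorphic_derivI simp: power4_eq_xxxx power3_eq_cube field_simps\<close>)
  show ?thesis using that[OF h 1 3 4] by blast
qed

lemma double_zero_factor:
  assumes "f holomorphic_on ball 0 1" "f 0 = 0" "deriv f 0 = 0"
  obtains g where "g holomorphic_on ball 0 1" "\<And>z. z \<in> ball 0 1 - {0} \<Longrightarrow> f z = z\<^sup>2 * g z"
proof -
  define g1 where "g1 = (\<lambda>z. if z = 0 then deriv f 0 else (f z - f 0) / (z - 0))"
  have g1: "g1 holomorphic_on ball 0 1"
    unfolding g1_def using assms(1) by (rule pole_lemma_open) simp
  define g2 where "g2 = (\<lambda>z. if z = 0 then deriv g1 0 else (g1 z - g1 0) / (z - 0))"
  have g2: "g2 holomorphic_on ball 0 1"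
    unfolding g2_def using g1 by (rule pole_lemma_open) simp
  show ?thesis
    by (rule that[OF g2]) (use assms in \<open>auto simp: g1_def g2_def power2_eq_square\<close>)
qed

text \<open>Rotation by i negates the principal part 1 / z^2, so
  \<open>wp_sq z + wp_sq (\<i> * z)\<close> is doubly periodic without poles and hence constant.
  What remains is to show that the constant is 0.\<close>

lemma wp_sq_rotate:
  assumes "z \<notin> sq_lattice"
  shows "wp_sq (\<i> * z) = - wp_sq z"
proof -
  obtain h where h: "h holomorphic_on ball 0 1"
    "\<And>z. z \<in> ball 0 1 - {0} \<Longrightarrow> deriv zeta_sq z = - 1 / z\<^sup>2 + deriv h z"
    using zeta_sq_expansion by metis
  have h1: "deriv h holomorphic_on ball 0 1" by (rule holomorphic_deriv[OF h(1)]) simp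
  define f where "f = (\<lambda>z. wp_sq z + wp_sq (\<i> * z))"
  define g where "g = (\<lambda>z. of_real (pi / 2) - deriv h z - deriv h (\<i> * z))"
  have h1i: "(\<lambda>z. deriv h (\<i> * z)) holomorphic_on ball 0 1"
    by (rule holomorphic_on_compose_gen[OF _ h1, unfolded o_def]) (auto intro!: holomorphic_intros simp: norm_mult)
  have wpi: "(\<lambda>z. wp_sq (\<i> * z)) holomorphic_on - sq_lattice"
    by (rule holomorphic_on_compose_gen[OF _ wp_sq_holomorphic, unfolded o_def]) (auto intro!: holomorphic_intros)
  have "\<exists>C. \<forall>z. z \<notin> sq_lattice \<longrightarrow> f z = C"
  proof (rule sq_lattice_periodic_constant)
    show "f holomorphic_on - sq_lattice"
      unfolding f_def by (intro holomorphic_intros wp_sq_holomorphic wpi)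
    show "g holomorphic_on ball 0 1"
      unfolding g_def by (intro holomorphic_intros h1 h1i)
    show "f z = g z" if "z \<in> ball 0 1 - {0}" for z
    proof -
      have "\<i> * z \<in> ball 0 1 - {0}" using that by (auto simp: norm_mult)
      from h(2)[OF this] h(2)[OF that] show ?thesis
        by (simp add: f_def g_def wp_sq_def power_mult_distrib)
    qed
    fix z assume z: "z \<notin> sq_lattice"
    have iz: "\<i> * z \<notin> sq_lattice" "\<i> * z - 2 \<notin> sq_lattice"
      using z by (auto simp: sq_lattice_diff_iff)
    show "f (z + 2) = f z"
      using wp_sq_shift(1)[OF z] wp_sq_shift(2)[OF iz(1)] by (simp add: f_def algebra_simps)
    show "f (z + 2 * \<i>) = f z"
      using wp_sq_shift(2)[OF z] wp_sq_shift(1)[OF iz(2)] by (simp add: f_def algebra_simps)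
  qed
  then obtain C where C: "\<And>z. z \<notin> sq_lattice \<Longrightarrow> f z = C" by blast
  text \<open>The quasi-periods of the zeta function force the constant to vanish; this is
    Legendre's relation in disguise.\<close>
  define S where "S = {z. 0 < Im z \<and> Im z < 2}"
  have S: "z \<notin> sq_lattice" if "z \<in> S" for z
  proof
    assume "z \<in> sq_lattice"
    then obtain b :: int where "Im z = 2 * of_int b" by (auto simp: sq_lattice_iff)
    with that have "0 < b" "b < 1" by (auto simp: S_def)
    then show False by simp
  qed
  define D where "D = (\<lambda>z. zeta_sq z - \<i> * zeta_sq (\<i> * z) - (of_real (pi / 2) - C) * z)"
  have dz: "(zeta_sq has_field_derivative deriv zeta_sq z) (at z)" if "z \<notin> sq_lattice" for z
    using zeta_sq_holomorphic open_compl_sq_lattice that by (auto intro!: holomorphic_derivI)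
  have "(D has_field_derivative 0) (at z within S)" if "z \<in> S" for z
  proof -
    have "\<i> * z \<notin> sq_lattice" using S[OF that] by simp
    then have "((\<lambda>z. zeta_sq (\<i> * z)) has_field_derivative deriv zeta_sq (\<i> * z) * \<i>) (at z)"
      by (intro DERIV_chain2[OF dz]) (auto intro!: derivative_eq_intros)
    then have "(D has_field_derivative deriv zeta_sq z + deriv zeta_sq (\<i> * z) - (of_real (pi / 2) - C)) (at z)"
      unfolding D_def by (auto intro!: derivative_eq_intros dz S that simp: algebra_simps)
    moreover have "deriv zeta_sq z + deriv zeta_sq (\<i> * z) = of_real (pi / 2) - C"
      using C[OF S[OF that]] by (simp add: f_def wp_sq_def algebra_simps)
    ultimately show ?thesis using has_field_derivative_at_within by fastforce
  qed
  moreover have "convex S"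
    unfolding S_def using convex_halfspace_Im_gt[of 0] convex_halfspace_Im_lt[of 2]
    by (auto simp: Collect_conj_eq intro!: convex_Int)
  ultimately obtain K where K: "\<And>z. z \<in> S \<Longrightarrow> D z = K"
    using has_field_derivative_zero_constant by metis
  \<comment> \<open>From i to i + 2 the first summand of \<open>D\<close> gains pi. The second does
    not change, since i (i + 2) = i i + 2 i differs by the true period. Hence pi = 2 (pi / 2 -
    C).\<close>
  have "D (\<i> + 2) = D \<i>" using K[of "\<i> + 2"] K[of \<i>] by (simp add: S_def)
  moreover have "zeta_sq (\<i> + 2) = zeta_sq \<i> + of_real pi"
    by (rule zeta_sq_shift_real) (auto intro!: S simp: S_def)
  moreover have "zeta_sq (\<i> * (\<i> + 2)) = zeta_sq (\<i> * \<i>)"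
    using zeta_sq_shift_imaginary[of "-1"] by (simp add: algebra_simps)
  ultimately have "C = 0" by (simp add: D_def algebra_simps)
  then show ?thesis using C[OF assms] by (simp add: f_def add_eq_0_iff2)
qed

text \<open>Both sides gain \<open>2 * deriv zeta_sq z\<close> under the shift by 2: on the right
  the quasi-period pi of \<open>zeta_sq\<close> is divided out again. Subtracting
  \<open>deriv wp_sq\<close> removes the pole -2 / z^3. The difference of the sides is then
  constant, and it is odd, so it is 0.\<close>

lemma V_sq_eq:
  assumes "z \<notin> sq_lattice"
  shows "V_sq z = (2 * zeta_sq z * deriv zeta_sq z - deriv wp_sq z) / of_real pi"
proof -
  obtain h where h: "h holomorphic_on ball 0 1" "h 0 = 0"
    "\<And>z. z \<in> ball 0 1 - {0} \<Longrightarrow> zeta_sq z = 1 / z + h z"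
    "\<And>z. z \<in> ball 0 1 - {0} \<Longrightarrow> deriv zeta_sq z = - 1 / z\<^sup>2 + deriv h z"
    "\<And>z. z \<in> ball 0 1 - {0} \<Longrightarrow> deriv wp_sq z = - 2 / z ^ 3 - deriv (deriv h) z"
    using zeta_sq_expansion by metis
  have h1: "deriv h holomorphic_on ball 0 1" by (rule holomorphic_deriv[OF h(1)]) simp
  then have h2: "deriv (deriv h) holomorphic_on ball 0 1" by (rule holomorphic_deriv) simp
  \<comment> \<open>In the expansion of 2 zeta zeta' - wp' the remaining singular part is 2 d(z) /
    z^2. It is regular because d has a double zero: d(0) = 0 by \<open>h 0 = 0\<close>, and d' = z
    h''.\<close>
  define d where "d = (\<lambda>z. z * deriv h z - h z)"
  have d: "d holomorphic_on ball 0 1" unfolding d_def by (intro holomorphic_intros h h1)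
  have "(d has_field_derivative 0) (at 0)"
    unfolding d_def using h(1) h1 by (auto intro!: derivative_eq_intros holomorphic_derivI)
  then obtain m where m: "m holomorphic_on ball 0 1" "\<And>z. z \<in> ball 0 1 - {0} \<Longrightarrow> d z = z\<^sup>2 * m z"
    using double_zero_factor[OF d] h(2) by (auto simp: d_def DERIV_imp_deriv)
  define f where "f = (\<lambda>z. V_sq z - (2 * zeta_sq z * deriv zeta_sq z - deriv wp_sq z) / of_real pi)"
  define g where "g = (\<lambda>z. V_sq z - (2 * m z + 2 * h z * deriv h z + deriv (deriv h) z) / of_real pi)"
  have V: "V_sq holomorphic_on - sq_lattice" "V_sq holomorphic_on ball 0 1"
  proof -
    have "ball 0 1 \<subseteq> - (sq_lattice - {0})" using norm_sq_lattice by auto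
    then show "V_sq holomorphic_on - sq_lattice" "V_sq holomorphic_on ball 0 1"
      using holomorphic_on_subset[OF V_sq_holomorphic] by auto
  qed
  have "\<exists>C. \<forall>z. z \<notin> sq_lattice \<longrightarrow> f z = C"
  proof (rule sq_lattice_periodic_constant)
    show "f holomorphic_on - sq_lattice"
      unfolding f_def by (intro holomorphic_intros V zeta_sq_holomorphic deriv_zeta_sq_holomorphic deriv_wp_sq_holomorphic) simp
    show "g holomorphic_on ball 0 1"
      unfolding g_def by (intro holomorphic_intros V m h h1 h2) simp
    show "f z = g z" if z: "z \<in> ball 0 1 - {0}" for z
    proof -
      have hz: "h z = z * deriv h z - z\<^sup>2 * m z" using m(2)[OF z] unfolding d_def by (metis diff_diff_eq2 add_diff_cancel_left')
      have "2 * zeta_sq z * deriv zeta_sq z - deriv wp_sq z =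
          2 * m z + 2 * h z * deriv h z + deriv (deriv h) z"
        using z unfolding h(3-5)[OF z] by (simp add: hz field_simps power2_eq_square power3_eq_cube)
      then show ?thesis by (simp add: f_def g_def)
    qed
    fix z assume z: "z \<notin> sq_lattice"
    show "f (z + 2) = f z"
      using z by (simp add: f_def V_sq_shift_real zeta_sq_shift_real deriv_zeta_sq_shift deriv_wp_sq_shift field_simps)
    show "f (z + 2 * \<i>) = f z"
      using z by (simp add: f_def V_sq_shift_imaginary zeta_sq_shift_imaginary deriv_zeta_sq_shift deriv_wp_sq_shift)
  qed
  then obtain C where C: "\<And>z. z \<notin> sq_lattice \<Longrightarrow> f z = C" by blast
  have "f (- z) = - f z"
    using assms by (simp add: f_def V_sq_uminus zeta_sq_uminus deriv_zeta_sq_shift deriv_wp_sq_shift diff_divide_distrib)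
  then have "C = - C" using C[of z] C[of "-z"] assms by simp
  then have "f z = 0" using C[OF assms] by simp
  then show ?thesis by (simp add: f_def)
qed

section \<open>Values at the half periods\<close>

definition e_sq :: complex where "e_sq = wp_sq 1"

text \<open>On the real axis every term of -zeta' is a square of a real number. This yields reality
  at once, and positivity and a lower bound from single terms of the series.\<close>

lemma wp_sq_real_has_sum:
  assumes "of_real x \<notin> sq_lattice"
  shows "((\<lambda>n. (pi / 2 / sinh (pi / 2 * (x - 2 * of_int n)))\<^sup>2) has_sum (Re (wp_sq (of_real x)) - pi / 4)) UNIV"
    and "Im (wp_sq (of_real x)) = 0"
proof -
  have *: "dcth (of_real x - 2 * of_int n) = of_real (- (pi / 2 / sinh (pi / 2 * (x - 2 * of_int n)))\<^sup>2)" for n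
  proof -
    have "of_real (pi / 2) * (of_real x - 2 * of_int n) = (of_real (pi / 2 * (x - 2 * of_int n)) :: complex)"
      by simp
    moreover have "sinh (of_real y :: complex) = of_real (sinh y)" for y :: real
      by (simp add: sinh_field_def exp_of_real flip: of_real_minus)
    ultimately show ?thesis
      unfolding dcth_def by (simp only: flip: of_real_divide of_real_power of_real_minus)
  qed
  have s: "((\<lambda>n. dcth (of_real x - 2 * of_int n)) has_sum deriv zeta_sq (of_real x)) UNIV"
    by (rule deriv_zeta_sq_has_sum[OF assms])
  have "((\<lambda>n. Re (dcth (of_real x - 2 * of_int n))) has_sum Re (deriv zeta_sq (of_real x))) UNIV"
    using s by (rule has_sum_Re)
  then have "((\<lambda>n. - Re (dcth (of_real x - 2 * of_int n))) has_sum - Re (deriv zeta_sq (of_real x))) UNIV"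
    by (rule has_sum_uminusI)
  then show "((\<lambda>n. (pi / 2 / sinh (pi / 2 * (x - 2 * of_int n)))\<^sup>2) has_sum (Re (wp_sq (of_real x)) - pi / 4)) UNIV"
    unfolding * by (simp add: wp_sq_def)
  have "((\<lambda>n. Im (dcth (of_real x - 2 * of_int n))) has_sum Im (deriv zeta_sq (of_real x))) UNIV"
    using s by (rule has_sum_Im)
  then have "Im (deriv zeta_sq (of_real x)) = 0"
    unfolding * using has_sum_unique[OF _ has_sum_0] by fastforce
  then show "Im (wp_sq (of_real x)) = 0" by (simp add: wp_sq_def)
qed

lemma wp_sq_real_ge:
  assumes "of_real x \<notin> sq_lattice"
  shows "Re (wp_sq (of_real x)) \<ge> pi / 4 + (pi / 2 / sinh (pi / 2 * x))\<^sup>2"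
proof -
  have "(\<Sum>n\<in>{0::int}. (pi / 2 / sinh (pi / 2 * (x - 2 * of_int n)))\<^sup>2) \<le> Re (wp_sq (of_real x)) - pi / 4"
    by (rule has_sum_mono_neutral[OF has_sum_finite wp_sq_real_has_sum(1)[OF assms]]) auto
  then show ?thesis by simp
qed

lemma half_periods_notin_sq_lattice [simp]:
  "1 \<notin> sq_lattice" "\<i> \<notin> sq_lattice" "1 + \<i> \<notin> sq_lattice" "\<i> - 1 \<notin> sq_lattice" "\<i> + 1 \<notin> sq_lattice"
proof -
  have "(1 / 2 :: real) \<notin> \<int>"
  proof
    assume "(1 / 2 :: real) \<in> \<int>"
    then obtain n :: int where "1 / 2 = real_of_int n" by (elim Ints_cases)
    then have "1 = 2 * n" by linarith
    then show False by presburger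
  qed
  then show "1 \<notin> sq_lattice" "\<i> \<notin> sq_lattice" "1 + \<i> \<notin> sq_lattice" "\<i> - 1 \<notin> sq_lattice" "\<i> + 1 \<notin> sq_lattice"
    by (auto simp: sq_lattice_def)
qed

lemma e_sq_pos: "Im e_sq = 0" "Re e_sq > 0"
proof -
  have "(of_real 1 :: complex) \<notin> sq_lattice" by simp
  from wp_sq_real_has_sum(2)[OF this] wp_sq_real_ge[OF this]
  show "Im e_sq = 0" "Re e_sq > 0"
    using pi_gt_zero zero_le_power2[of "pi / 2 / sinh (pi / 2 * 1)"] unfolding e_sq_def of_real_1 by linarith+
qed

text \<open>Rotation by i negates \<open>wp_sq\<close>; it carries 1 to i and fixes 1 + i modulo the
  lattice, as i (1 + i) = (1 + i) - 2.\<close>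

lemma wp_sq_half_periods: "wp_sq \<i> = - e_sq" "wp_sq (1 + \<i>) = 0"
proof -
  show "wp_sq \<i> = - e_sq" using wp_sq_rotate[of 1] by (simp add: e_sq_def)
  have "wp_sq (\<i> * (1 + \<i>)) = wp_sq (1 + \<i>)"
    using wp_sq_shift(1)[of "\<i> - 1"] by (simp add: algebra_simps)
  then show "wp_sq (1 + \<i>) = 0" using wp_sq_rotate[of "1 + \<i>"] by simp
qed

text \<open>A half period is congruent to its negative, and the derivative is odd.\<close>

lemma deriv_wp_sq_half_periods: "deriv wp_sq 1 = 0" "deriv wp_sq \<i> = 0" "deriv wp_sq (1 + \<i>) = 0"
proof -
  show "deriv wp_sq 1 = 0"
    using deriv_wp_sq_shift(1)[of "-1"] deriv_wp_sq_shift(3)[of 1] by simp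
  show "deriv wp_sq \<i> = 0"
    using deriv_wp_sq_shift(2)[of "-\<i>"] deriv_wp_sq_shift(3)[of \<i>] by simp
  have n: "- (1 + \<i>) \<notin> sq_lattice" by (simp del: minus_add_distrib)
  then have "- (1 + \<i>) + 2 \<notin> sq_lattice" by (subst sq_lattice_add_iff) simp_all
  from deriv_wp_sq_shift(2)[OF this] deriv_wp_sq_shift(1)[OF n] deriv_wp_sq_shift(3)[of "1 + \<i>"]
  have "deriv wp_sq (- (1 + \<i>) + 2 + 2 * \<i>) = - deriv wp_sq (1 + \<i>)" by simp
  then show "deriv wp_sq (1 + \<i>) = 0" by (simp add: algebra_simps)
qed

lemma strip_notin_sq_lattice:
  assumes "0 < Re z" "Re z < 2"
  shows "z \<notin> sq_lattice"
proof
  assume "z \<in> sq_lattice"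
  then obtain a :: int where "Re z = 2 * of_int a" by (auto simp: sq_lattice_iff)
  with assms have "0 < a" "a < 1" by auto
  then show False by simp
qed

text \<open>The rotation symmetry replaces explicit lattice sums. In wp = 1 / z^2 + k it gives k(i
  z) = -k(z), so k has a double zero at 0 and wp'' - 6 wp^2 has no pole: it is a constant C. The
  first integral \<open>E\<close> vanishes at 1 + i, where wp and wp' both vanish, and its value at
  1 then gives C = -2 e^2. The first-order equation is restricted to a strip, a convex set without
  lattice points that contains 1 and 1 + i.\<close>

lemma
  shows wp_sq_ode2: "z \<notin> sq_lattice \<Longrightarrow> deriv (deriv wp_sq) z = 6 * (wp_sq z)\<^sup>2 - 2 * e_sq\<^sup>2"
    and wp_sq_ode: "0 < Re z \<Longrightarrow> Re z < 2 \<Longrightarrow> (deriv wp_sq z)\<^sup>2 = 4 * (wp_sq z) ^ 3 - 4 * e_sq\<^sup>2 * wp_sq z"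
proof -
  obtain h where h: "h holomorphic_on ball 0 1"
    "\<And>z. z \<in> ball 0 1 - {0} \<Longrightarrow> deriv zeta_sq z = - 1 / z\<^sup>2 + deriv h z"
    "\<And>z. z \<in> ball 0 1 - {0} \<Longrightarrow> deriv (deriv wp_sq) z = 6 / z ^ 4 - deriv (deriv (deriv h)) z"
    using zeta_sq_expansion by metis
  have h1: "deriv h holomorphic_on ball 0 1" by (rule holomorphic_deriv[OF h(1)]) simp
  then have h2: "deriv (deriv h) holomorphic_on ball 0 1" by (rule holomorphic_deriv) simp
  then have h3: "deriv (deriv (deriv h)) holomorphic_on ball 0 1" by (rule holomorphic_deriv) simp
  define k where "k = (\<lambda>z. of_real (pi / 4) - deriv h z)"
  have k: "k holomorphic_on ball 0 1" unfolding k_def by (intro holomorphic_intros h1)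
  have wp: "wp_sq z = 1 / z\<^sup>2 + k z" if "z \<in> ball 0 1 - {0}" for z
    using h(2)[OF that] by (simp add: wp_sq_def k_def)
  have krot: "k (\<i> * z) = - k z" if "z \<in> ball 0 1 - {0}" for z
  proof -
    have "\<i> * z \<in> ball 0 1 - {0}" "z \<notin> sq_lattice" using that norm_sq_lattice[of z] by (auto simp: norm_mult)
    then show ?thesis using wp[of "\<i> * z"] wp[OF that] wp_sq_rotate[of z] that
      by (simp add: power_mult_distrib)
  qed
  have ck: "isCont k 0" using k by (auto intro: continuous_on_interior holomorphic_on_imp_continuous_on)
  have k0: "k 0 = 0"
  proof -
    have "(k \<longlongrightarrow> k 0) (at 0)" using ck by (simp add: isCont_def)
    moreover have "((\<lambda>z. - k (\<i> * z)) \<longlongrightarrow> - k 0) (at 0)"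
      using ck by (auto intro!: tendsto_eq_intros isCont_tendsto_compose[of _ k])
    moreover have "eventually (\<lambda>z. - k (\<i> * z) = k z) (at 0)"
      using eventually_at_in_open[of "ball 0 1" "0::complex"] by (auto elim!: eventually_mono simp: krot)
    ultimately have "k 0 = - k 0"
      using tendsto_unique[OF at_neq_bot] Lim_transform_eventually by blast
    then show ?thesis by simp
  qed
  have "deriv k 0 = 0"
  proof -
    have d: "(k has_field_derivative deriv k 0) (at 0)" using k by (auto intro!: holomorphic_derivI)
    have "((\<lambda>z. k (\<i> * z)) has_field_derivative deriv k 0 * \<i>) (at 0)"
      by (rule DERIV_chain2[where f = k]) (use d in \<open>auto intro!: derivative_eq_intros\<close>)
    then have "((\<lambda>z. - k z) has_field_derivative deriv k 0 * \<i>) (at 0)"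
      by (rule has_field_derivative_transform_within_open[where S = "ball 0 1"])
         (use krot k0 in \<open>auto, metis mult_zero_right minus_zero\<close>)
    moreover have "((\<lambda>z. - k z) has_field_derivative - deriv k 0) (at 0)"
      using d by (auto intro!: derivative_eq_intros)
    ultimately have "deriv k 0 * \<i> = - deriv k 0" by (rule DERIV_unique)
    then have "deriv k 0 * (\<i> + 1) = 0" by (simp add: algebra_simps)
    moreover have "\<i> + 1 \<noteq> 0" by (simp add: complex_eq_iff)
    ultimately show ?thesis by simp
  qed
  then obtain m where m: "m holomorphic_on ball 0 1" "\<And>z. z \<in> ball 0 1 - {0} \<Longrightarrow> k z = z\<^sup>2 * m z"
    using double_zero_factor[OF k k0] by blast
  define f where "f = (\<lambda>z. deriv (deriv wp_sq) z - 6 * (wp_sq z)\<^sup>2)"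
  define g where "g = (\<lambda>z. - deriv (deriv (deriv h)) z - 12 * m z - 6 * (k z)\<^sup>2)"
  have "\<exists>C. \<forall>z. z \<notin> sq_lattice \<longrightarrow> f z = C"
  proof (rule sq_lattice_periodic_constant)
    show "f holomorphic_on - sq_lattice"
      unfolding f_def
      by (intro holomorphic_intros wp_sq_holomorphic holomorphic_deriv[OF deriv_wp_sq_holomorphic open_compl_sq_lattice])
    show "g holomorphic_on ball 0 1"
      unfolding g_def by (intro holomorphic_intros h3 m k)
    show "f z = g z" if z: "z \<in> ball 0 1 - {0}" for z
    proof -
      have "m z = k z / z\<^sup>2" using m(2)[OF z] z by simp
      then show ?thesis using z
        by (simp add: f_def g_def h(3)[OF z] wp[OF z] field_simps power2_eq_square power4_eq_xxxx)
    qed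
    fix z assume z: "z \<notin> sq_lattice"
    show "f (z + 2) = f z" "f (z + 2 * \<i>) = f z"
      using z by (simp_all add: f_def deriv_deriv_wp_sq_shift wp_sq_shift)
  qed
  then obtain C where "\<And>z. z \<notin> sq_lattice \<Longrightarrow> f z = C" by blast
  then have C: "deriv (deriv wp_sq) z = 6 * (wp_sq z)\<^sup>2 + C" if "z \<notin> sq_lattice" for z
    using that by (metis f_def diff_eq_eq add.commute)
  define S where "S = {z. 0 < Re z \<and> Re z < 2}"
  have S: "z \<notin> sq_lattice" if "z \<in> S" for z using that strip_notin_sq_lattice by (auto simp: S_def)
  define E where "E = (\<lambda>z. (deriv wp_sq z)\<^sup>2 - 4 * (wp_sq z) ^ 3 - 2 * C * wp_sq z)"
  have "(E has_field_derivative 0) (at z within S)" if "z \<in> S" for z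
  proof -
    have 1: "(wp_sq has_field_derivative deriv wp_sq z) (at z)"
      using wp_sq_holomorphic open_compl_sq_lattice S[OF that] by (auto intro!: holomorphic_derivI)
    have 2: "(deriv wp_sq has_field_derivative 6 * (wp_sq z)\<^sup>2 + C) (at z)"
      using holomorphic_derivI[OF deriv_wp_sq_holomorphic open_compl_sq_lattice, of z] S[OF that] C by simp
    have "(E has_field_derivative 0) (at z)"
      unfolding E_def by (rule derivative_eq_intros 1 2 refl)+ (simp add: algebra_simps power2_eq_square)
    then show ?thesis by (rule has_field_derivative_at_within)
  qed
  moreover have "convex S"
    unfolding S_def using convex_halfspace_Re_gt[of 0] convex_halfspace_Re_lt[of 2]
    by (auto simp: Collect_conj_eq intro!: convex_Int)
  ultimately obtain K where K: "\<And>z. z \<in> S \<Longrightarrow> E z = K"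
    using has_field_derivative_zero_constant by metis
  have "K = 0" using K[of "1 + \<i>"] by (simp add: S_def E_def deriv_wp_sq_half_periods wp_sq_half_periods)
  then have E: "E z = 0" if "z \<in> S" for z using K that by simp
  have "e_sq \<noteq> 0" using e_sq_pos by auto
  moreover have "4 * e_sq ^ 3 + 2 * C * e_sq = 0"
  proof -
    have "0 - 4 * e_sq ^ 3 - 2 * C * e_sq = 0"
      using E[of 1] by (simp add: S_def E_def deriv_wp_sq_half_periods e_sq_def)
    moreover have "4 * e_sq ^ 3 + 2 * C * e_sq = - (0 - 4 * e_sq ^ 3 - 2 * C * e_sq)" by simp
    ultimately show ?thesis by (simp only: minus_zero)
  qed
  then have "e_sq * (4 * e_sq\<^sup>2 + 2 * C) = 0" by (simp add: algebra_simps power2_eq_square power3_eq_cube)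
  ultimately have "4 * e_sq\<^sup>2 + 2 * C = 0" by simp
  moreover have "C = (4 * e_sq\<^sup>2 + 2 * C) / 2 - 2 * e_sq\<^sup>2" by (simp add: add_divide_distrib)
  ultimately have "C = - 2 * e_sq\<^sup>2" by simp
  then show "z \<notin> sq_lattice \<Longrightarrow> deriv (deriv wp_sq) z = 6 * (wp_sq z)\<^sup>2 - 2 * e_sq\<^sup>2"
    and "0 < Re z \<Longrightarrow> Re z < 2 \<Longrightarrow> (deriv wp_sq z)\<^sup>2 = 4 * (wp_sq z) ^ 3 - 4 * e_sq\<^sup>2 * wp_sq z"
    using C[of z] E[of z] by (simp_all add: S_def E_def diff_add_eq add_eq_0_iff2 diff_eq_eq eq_diff_eq)
qed

section \<open>The lemniscatic half-period value\<close>

text \<open>By the differential equation of wp, the substitution t = (e / wp(x))^2 of the interval (0,1)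
  turns the constant integrand into that of the Beta integral.\<close>

lemma Beta_quarter_half_eq: "Beta (1 / 4) (1 / 2) = 4 * sqrt (Re e_sq)"
proof -
  define e where "e = Re e_sq"
  have e: "e > 0" "e_sq = of_real e" using e_sq_pos by (simp_all add: e_def complex_eq_iff)
  define p where "p = (\<lambda>x. Re (wp_sq (of_real x)))"
  define p' where "p' = (\<lambda>x. Re (deriv wp_sq (of_real x)))"
  have nl: "(of_real x :: complex) \<notin> sq_lattice" if "0 < x" "x < 2" for x
    using that strip_notin_sq_lattice[of "of_real x"] by simp
  have wp: "wp_sq (of_real x) = of_real (p x)" if "0 < x" "x < 2" for x
    using wp_sq_real_has_sum(2)[OF nl[OF that]] by (simp add: p_def complex_eq_iff)
  have dwp: "((\<lambda>x. wp_sq (of_real x)) has_vector_derivative deriv wp_sq (of_real x)) (at x)" if "0 < x" "x < 2" for x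
    by (rule has_vector_derivative_real_field)
       (use nl[OF that] wp_sq_holomorphic open_compl_sq_lattice in \<open>auto intro!: holomorphic_derivI\<close>)
  have ddwp: "((\<lambda>x. deriv wp_sq (of_real x)) has_vector_derivative deriv (deriv wp_sq) (of_real x)) (at x)" if "0 < x" "x < 2" for x
    by (rule has_vector_derivative_real_field)
       (use nl[OF that] deriv_wp_sq_holomorphic open_compl_sq_lattice in \<open>auto intro!: holomorphic_derivI\<close>)
  have dp: "(p has_real_derivative p' x) (at x)" if "0 < x" "x < 2" for x
    using bounded_linear.has_vector_derivative[OF bounded_linear_Re dwp[OF that]]
    by (simp add: has_real_derivative_iff_has_vector_derivative p_def [abs_def] p'_def)
  have dwp_real: "deriv wp_sq (of_real x) = of_real (p' x)" if "0 < x" "x < 2" for x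
  proof -
    have "((\<lambda>x. Im (wp_sq (of_real x))) has_real_derivative Im (deriv wp_sq (of_real x))) (at x)"
      using bounded_linear.has_vector_derivative[OF bounded_linear_Im dwp[OF that]]
      by (simp add: has_real_derivative_iff_has_vector_derivative)
    moreover have "((\<lambda>x. Im (wp_sq (of_real x))) has_real_derivative 0) (at x)"
      by (rule has_field_derivative_transform_within_open[of "\<lambda>_. 0" _ _ "{0<..<2}"])
         (use that wp_sq_real_has_sum(2) nl in auto)
    ultimately have "Im (deriv wp_sq (of_real x)) = 0" by (rule DERIV_unique)
    then show ?thesis by (simp add: p'_def complex_eq_iff)
  qed
  have ode: "(p' x)\<^sup>2 = 4 * p x * ((p x)\<^sup>2 - e\<^sup>2)" if "0 < x" "x < 2" for x
  proof -
    have "complex_of_real ((p' x)\<^sup>2) = of_real (4 * p x * ((p x)\<^sup>2 - e\<^sup>2))"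
      using wp_sq_ode[of "of_real x"] that
      by (simp add: wp dwp_real e power2_eq_square power3_eq_cube algebra_simps)
    then show ?thesis by (simp only: of_real_eq_iff)
  qed
  have p_pos: "p x > 0" if "0 < x" "x < 2" for x
    using wp_sq_real_ge[OF nl[OF that]] zero_le_power2[of "pi / 2 / sinh (pi / 2 * x)"] pi_gt_zero
    unfolding p_def by linarith
  \<comment> \<open>The right side 4 p (p^2 - e^2) of the equation is a square and p is positive, so
    p cannot drop below e.\<close>
  have p_ge: "p x \<ge> e" if "0 < x" "x < 2" for x
  proof -
    have "(p x)\<^sup>2 - e\<^sup>2 \<ge> 0"
      using ode[OF that] p_pos[OF that] zero_le_power2[of "p' x"] by (metis zero_le_mult_iff mult_pos_pos not_less zero_less_numeral)
    then show ?thesis using p_pos[OF that] e(1) power2_le_imp_le[of e "p x"] by simp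
  qed
  have dp': "(p' has_real_derivative 6 * (p x)\<^sup>2 - 2 * e\<^sup>2) (at x)" if "0 < x" "x < 2" for x
  proof -
    have "deriv (deriv wp_sq) (of_real x) = of_real (6 * (p x)\<^sup>2 - 2 * e\<^sup>2)"
      using wp_sq_ode2[OF nl[OF that]] by (simp add: wp that e)
    then show ?thesis
      using bounded_linear.has_vector_derivative[OF bounded_linear_Re ddwp[OF that]]
      by (simp add: has_real_derivative_iff_has_vector_derivative p'_def [abs_def])
  qed
  \<comment> \<open>From p >= e follows p'' = 6 p^2 - 2 e^2 > 0, so p' increases strictly to its
    zero at 1.\<close>
  have p'_neg: "p' x < 0" if "0 < x" "x < 1" for x
  proof -
    have "p' x < p' 1"
    proof (rule DERIV_pos_imp_increasing[OF that(2)])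
      fix y assume y: "x \<le> y" "y \<le> 1"
      have "e\<^sup>2 \<le> (p y)\<^sup>2" using p_ge[of y] that y e by (intro power_mono) auto
      then have "6 * (p y)\<^sup>2 - 2 * e\<^sup>2 > 0" using e(1) zero_less_power[of e 2] by linarith
      then show "\<exists>d. (p' has_real_derivative d) (at y) \<and> 0 < d"
        using dp'[of y] that y by auto
    qed
    then show ?thesis using deriv_wp_sq_half_periods(1) by (simp add: p'_def)
  qed
  define g where "g = (\<lambda>x. e\<^sup>2 / (p x)\<^sup>2)"
  define g' where "g' = (\<lambda>x. - 2 * e\<^sup>2 * p' x / (p x) ^ 3)"
  have dg: "(g has_real_derivative g' x) (at x)" if "0 < x" "x < 2" for x
    unfolding g_def g'_def using p_pos[OF that]
    by (auto intro!: derivative_eq_intros dp[OF that] simp: field_simps power2_eq_square power3_eq_cube)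
  have g'_pos: "g' x > 0" if "0 < x" "x < 1" for x
    using p'_neg[OF that] p_pos[of x] that e(1) unfolding g'_def
    by (intro divide_pos_pos zero_less_power) (auto intro: mult_neg_pos)
  have g_less: "g x < g y" if "0 < x" "x < y" "y \<le> 1" for x y
  proof (rule DERIV_pos_imp_increasing_open[OF that(2)])
    show "\<exists>d. (g has_real_derivative d) (at z) \<and> 0 < d" if "x < z" "z < y" for z
      using dg[of z] g'_pos[of z] that \<open>0 < x\<close> \<open>y \<le> 1\<close> by auto
    show "continuous_on {x..y} g"
      using that by (auto intro!: DERIV_atLeastAtMost_imp_continuous_on dg exI)
  qed
  have "p 1 = e" by (simp add: p_def e_def e_sq_def)
  then have g1: "g 1 = 1" using e(1) by (simp add: g_def)
  have g_pos: "g x > 0" if "0 < x" "x < 2" for x using p_pos[OF that] e(1) by (simp add: g_def)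
  have inj: "inj_on g {0<..<1}"
    by (rule linorder_inj_onI') (use g_less in force)
  have img: "g ` {0<..<1} = {0<..<1}"
  proof (intro equalityI subsetI)
    fix y assume "y \<in> g ` {0<..<1}"
    then show "y \<in> {0<..<1}" using g_pos g_less[of _ 1] g1 by force
  next
    fix y :: real assume y: "y \<in> {0<..<1}"
    \<comment> \<open>Small values of \<open>g\<close> come from the pole of wp at 0: the term n = 0
      of the series alone bounds p from below, hence \<open>g\<close> from above by a multiple of
      sinh (pi x / 2)^4. The intermediate value theorem on \<open>{x..1}\<close> does the
      rest.\<close>
    have "((\<lambda>x. e\<^sup>2 * (sinh (pi / 2 * x) / (pi / 2)) ^ 4) \<longlongrightarrow> e\<^sup>2 * (sinh (pi / 2 * 0) / (pi / 2)) ^ 4) (at_right 0)"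
      by (intro tendsto_intros) auto
    then have "eventually (\<lambda>x. e\<^sup>2 * (sinh (pi / 2 * x) / (pi / 2)) ^ 4 < y) (at_right 0)"
      by (rule order_tendstoD(2)) (use y in auto)
    moreover have "eventually (\<lambda>x::real. x \<in> {0<..<1}) (at_right 0)"
      by (rule eventually_at_right_real) simp
    ultimately have "eventually (\<lambda>x. e\<^sup>2 * (sinh (pi / 2 * x) / (pi / 2)) ^ 4 < y \<and> x \<in> {0<..<1}) (at_right 0)"
      by (rule eventually_conj)
    then obtain x where x: "e\<^sup>2 * (sinh (pi / 2 * x) / (pi / 2)) ^ 4 < y" "0 < x" "x < 1"
      using eventually_happens'[OF trivial_limit_at_right_real] by force
    define q where "q = (pi / 2 / sinh (pi / 2 * x))\<^sup>2"
    have q: "q > 0" "q \<le> p x"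
      using x wp_sq_real_ge[OF nl[of x]] pi_gt_zero unfolding q_def p_def by (simp, linarith)
    have "g x \<le> e\<^sup>2 / q\<^sup>2"
      unfolding g_def using q e(1) by (intro divide_left_mono power_mono mult_pos_pos zero_less_power) auto
    also have "\<dots> = e\<^sup>2 * (sinh (pi / 2 * x) / (pi / 2)) ^ 4"
      by (simp add: q_def power_divide power_mult_distrib flip: power_mult)
    also have "\<dots> < y" by (rule x)
    finally have "g x < y" .
    moreover have "continuous_on {x..1} g"
      using x by (auto intro!: DERIV_atLeastAtMost_imp_continuous_on dg exI)
    ultimately obtain z where z: "x \<le> z" "z \<le> 1" "g z = y"
      using IVT'[of g x y 1] y g1 x by auto
    then have "z < 1" using y g1 by (cases "z = 1") auto
    then show "y \<in> g ` {0<..<1}" using z x by auto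
  qed
  define f where "f = (\<lambda>t::real. t powr (1 / 4 - 1) * (1 - t) powr (1 / 2 - 1))"
  have key: "\<bar>g' x\<bar> * f (g x) = 4 * sqrt e" if x: "x \<in> {0<..<1}" for x
  proof -
    \<comment> \<open>With e = a^2 and p = b^2, and s = sqrt (p^2 - e^2) below, the fractional
      powers become rational expressions: g^(-3/4) = (b / a)^3 and (1 - g)^(-1/2) = b^2 / s. As -p'
      = 2 b s, everything but 4 a cancels.\<close>
    define a b where "a = sqrt e" and "b = sqrt (p x)"
    have ab: "a > 0" "b > 0" "e = a\<^sup>2" "p x = b\<^sup>2" using e p_pos[of x] x by (auto simp: a_def b_def)
    have "g x < 1" using g_less[of x 1] g1 x by auto
    then have s: "(p x)\<^sup>2 - e\<^sup>2 > 0" using p_pos[of x] x by (simp add: g_def field_simps)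
    define s where "s = sqrt ((p x)\<^sup>2 - e\<^sup>2)"
    have "s > 0" "s\<^sup>2 = (p x)\<^sup>2 - e\<^sup>2" using s by (auto simp: s_def)
    have "(- p' x)\<^sup>2 = (2 * b * s)\<^sup>2"
      using ode[of x] x \<open>s\<^sup>2 = _\<close> by (simp add: power_mult_distrib ab)
    then have p': "- p' x = 2 * b * s"
      using p'_neg[of x] x ab \<open>s > 0\<close> by (subst (asm) power2_eq_iff_nonneg) auto
    have gx: "g x = (a / b) powr 4"
      using ab by (simp add: g_def power_divide powr_numeral flip: power_mult)
    have 1: "g x powr (1 / 4 - 1) = (b / a) ^ 3"
      unfolding gx powr_powr using ab by (simp add: powr_minus_divide power_divide)
    have "1 - g x = (s / b\<^sup>2) powr 2"
      using ab \<open>s > 0\<close> \<open>s\<^sup>2 = _\<close> by (simp add: g_def powr_numeral power_divide field_simps)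
    then have 2: "(1 - g x) powr (1 / 2 - 1) = b\<^sup>2 / s"
      using ab \<open>s > 0\<close> by (simp add: powr_powr powr_minus_divide)
    have "\<bar>g' x\<bar> = 2 * e\<^sup>2 * (- p' x) / (p x) ^ 3"
    proof -
      have "\<bar>g' x\<bar> = g' x" using g'_pos[of x] x by (intro abs_of_pos) auto
      then show ?thesis by (simp add: g'_def)
    qed
    also have "\<dots> = 2 * a ^ 4 * (2 * b * s) / b ^ 6"
      unfolding p' by (simp add: ab flip: power_mult)
    finally have "\<bar>g' x\<bar> = 2 * a ^ 4 * (2 * b * s) / b ^ 6" .
    then show ?thesis
      unfolding f_def 1 2 using ab \<open>s > 0\<close>
      by (simp add: field_simps power2_eq_square power3_eq_cube numeral_eq_Suc)
  qed
  have "(\<lambda>x. \<bar>g' x\<bar> * f (g x)) absolutely_integrable_on {0<..<1} \<and>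
      integral {0<..<1} (\<lambda>x. \<bar>g' x\<bar> * f (g x)) = 4 * sqrt e"
  proof
    have "(\<lambda>x::real. 4 * sqrt e) absolutely_integrable_on {0<..<1}"
      by (simp add: absolutely_integrable_on_const)
    then show "(\<lambda>x. \<bar>g' x\<bar> * f (g x)) absolutely_integrable_on {0<..<1}"
      by (rule absolutely_integrable_spike[OF _ negligible_empty]) (use key in auto)
    have "integral {0<..<1} (\<lambda>x. \<bar>g' x\<bar> * f (g x)) = integral {0<..<1} (\<lambda>x::real. 4 * sqrt e)"
      by (intro integral_cong key)
    then show "integral {0<..<1} (\<lambda>x. \<bar>g' x\<bar> * f (g x)) = 4 * sqrt e"
      using integral_const_real[of "4 * sqrt e" 0 1] integral_open_interval_real[of 0 1 "\<lambda>_. 4 * sqrt e"] by simp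
  qed
  then have "integral {0<..<1} f = 4 * sqrt e"
    by (subst (asm) has_absolute_integral_change_of_variables_1')
       (use inj img in \<open>auto intro: has_field_derivative_at_within[OF dg]\<close>)
  moreover have "(f has_integral Beta (1 / 4) (1 / 2)) {0..1}"
    unfolding f_def by (rule has_integral_Beta_real) auto
  then have "(f has_integral Beta (1 / 4) (1 / 2)) {0<..<1}"
    by (simp add: has_integral_Icc_iff_Ioo)
  ultimately show ?thesis by (simp add: integral_unique e_def)
qed

lemma Gamma_three_quarters_real: "Gamma (3 / 4 :: real) = pi * sqrt 2 / Gamma (1 / 4)"
proof -
  have "Gamma (1 / 4 :: complex) * Gamma (1 - 1 / 4) = of_real pi / sin (of_real pi * (1 / 4))"
    by (rule Gamma_reflection_complex)
  moreover have "sin (of_real pi * (1 / 4) :: complex) = of_real (sqrt 2 / 2)"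
    using sin_of_real[of "pi / 4", where 'a = complex] by (simp add: sin_45)
  moreover have "Gamma (1 / 4 :: complex) = of_real (Gamma (1 / 4))" "Gamma (1 - 1 / 4 :: complex) = of_real (Gamma (3 / 4))"
    by (simp_all flip: Gamma_complex_of_real)
  ultimately have "complex_of_real (Gamma (1 / 4)) * of_real (Gamma (3 / 4)) = of_real pi / of_real (sqrt 2 / 2)"
    by (simp only:)
  then have "complex_of_real (Gamma (1 / 4) * Gamma (3 / 4)) = of_real (pi / (sqrt 2 / 2))"
    by (simp only: of_real_mult of_real_divide)
  then have "Gamma (1 / 4 :: real) * Gamma (3 / 4) = pi / (sqrt 2 / 2)" by (simp only: of_real_eq_iff)
  moreover have "Gamma (1 / 4 :: real) > 0" by (rule Gamma_real_pos) simp
  moreover have "pi / (sqrt 2 / 2) = pi * sqrt 2" by (simp add: field_simps)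
  ultimately have "Gamma (1 / 4 :: real) > 0 \<and> Gamma (1 / 4 :: real) * Gamma (3 / 4) = pi * sqrt 2" by argo
  then show ?thesis by (auto simp: eq_divide_eq mult.commute)
qed

text \<open>Eliminating Gamma(3/4) by reflection gives Beta(1/4, 1/2) = Gamma(1/4)^2 / sqrt (2 pi).
  Equating with 4 sqrt e and squaring, 16 e = Gamma(1/4)^4 / (2 pi), whence the 32.\<close>

lemma e_sq_eq_Gamma: "e_sq = of_real (Gamma (1 / 4) ^ 4 / (32 * pi))"
proof -
  have "Beta (1 / 4) (1 / 2 :: real) = Gamma (1 / 4) ^ 2 / (sqrt pi * sqrt 2)"
    using Gamma_real_pos[of "1 / 4"]
    by (simp add: Beta_def Gamma_one_half_real Gamma_three_quarters_real field_simps power2_eq_square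
        real_sqrt_mult_self flip: real_sqrt_mult)
       (simp add: real_sqrt_mult)
  then have "(4 * sqrt (Re e_sq))\<^sup>2 = (Gamma (1 / 4) ^ 2 / (sqrt pi * sqrt 2))\<^sup>2"
    by (simp add: Beta_quarter_half_eq)
  then have "16 * Re e_sq = Gamma (1 / 4) ^ 4 / (pi * 2)"
    using e_sq_pos by (simp add: power_mult_distrib power_divide flip: power_mult)
  then show ?thesis using e_sq_pos(1) by (simp add: complex_eq_iff)
qed

section \<open>Rationality of Taylor coefficients\<close>

text \<open>With s^2 = wp(1), the coefficients of wp at the half periods i and 1 + i are graded of weight 2.\<close>

definition graded_fps :: "complex \<Rightarrow> nat \<Rightarrow> complex fps \<Rightarrow> bool" where
  "graded_fps s w F \<longleftrightarrow> (\<forall>n. \<exists>q::rat. fps_nth F n = of_rat q * s ^ (n + w))"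

lemma graded_fpsD: "graded_fps s w F \<Longrightarrow> \<exists>q::rat. fps_nth F n = of_rat q * s ^ (n + w)"
  by (auto simp: graded_fps_def)

lemma graded_coeff_sum:
  assumes "\<And>i. i \<in> A \<Longrightarrow> \<exists>q::rat. f i = (of_rat q * x :: complex)"
  shows "\<exists>q::rat. (\<Sum>i\<in>A. f i) = of_rat q * x"
proof -
  from assms obtain q where "\<And>i. i \<in> A \<Longrightarrow> f i = of_rat (q i) * x" by metis
  then have "(\<Sum>i\<in>A. f i) = of_rat (\<Sum>i\<in>A. q i) * x"
    by (simp add: of_rat_sum sum_distrib_right)
  then show ?thesis by blast
qed

lemma graded_fps_add:
  assumes "graded_fps s w F" "graded_fps s w G"
  shows "graded_fps s w (F + G)"
  unfolding graded_fps_def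
proof
  fix n
  obtain p q :: rat where "fps_nth F n = of_rat p * s ^ (n + w)" "fps_nth G n = of_rat q * s ^ (n + w)"
    using assms graded_fpsD by metis
  then have "fps_nth (F + G) n = of_rat (p + q) * s ^ (n + w)" by (simp add: of_rat_add algebra_simps)
  then show "\<exists>q::rat. fps_nth (F + G) n = of_rat q * s ^ (n + w)" by blast
qed

lemma graded_fps_cmult:
  assumes "graded_fps s w F"
  shows "graded_fps s w (fps_const (of_rat q) * F)"
  unfolding graded_fps_def
proof
  fix n
  obtain p :: rat where "fps_nth F n = of_rat p * s ^ (n + w)"
    using assms graded_fpsD by metis
  then have "fps_nth (fps_const (of_rat q) * F) n = of_rat (q * p) * s ^ (n + w)" by (simp add: of_rat_mult)
  then show "\<exists>q'::rat. fps_nth (fps_const (of_rat q) * F) n = of_rat q' * s ^ (n + w)" by blast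
qed

lemma graded_fps_diff:
  assumes "graded_fps s w F" "graded_fps s w G"
  shows "graded_fps s w (F - G)"
proof -
  have "F + fps_const (of_rat (-1)) * G = F - G" by (simp add: fps_eq_iff)
  then show ?thesis using graded_fps_add[OF assms(1) graded_fps_cmult[OF assms(2), of "-1"]] by simp
qed

lemma graded_fps_mult:
  assumes "graded_fps s w F" "graded_fps s v G"
  shows "graded_fps s (w + v) (F * G)"
  unfolding graded_fps_def fps_mult_nth
proof (intro allI graded_coeff_sum)
  fix n i :: nat assume i: "i \<in> {0..n}"
  obtain p q :: rat where "fps_nth F i = of_rat p * s ^ (i + w)" "fps_nth G (n - i) = of_rat q * s ^ (n - i + v)"
    using assms graded_fpsD by metis
  then have "fps_nth F i * fps_nth G (n - i) = of_rat (p * q) * s ^ ((i + w) + (n - i + v))"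
    by (simp add: of_rat_mult power_add)
  also have "(i + w) + (n - i + v) = n + (w + v)" using i by simp
  finally show "\<exists>q::rat. fps_nth F i * fps_nth G (n - i) = of_rat q * s ^ (n + (w + v))" by blast
qed

lemma graded_fps_deriv:
  assumes "graded_fps s w F"
  shows "graded_fps s (Suc w) (fps_deriv F)"
  unfolding graded_fps_def
proof
  fix n
  obtain p :: rat where "fps_nth F (n + 1) = of_rat p * s ^ (n + 1 + w)"
    using assms graded_fpsD by metis
  then have "fps_nth (fps_deriv F) n = of_rat (of_nat (n + 1) * p) * s ^ (n + Suc w)"
    by (simp add: of_rat_mult of_rat_add)
  then show "\<exists>q::rat. fps_nth (fps_deriv F) n = of_rat q * s ^ (n + Suc w)" by blast
qed

lemma graded_fps_integral:
  assumes "graded_fps s (Suc w) F"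
  shows "graded_fps s w (fps_integral0 F)"
  unfolding graded_fps_def
proof
  fix n show "\<exists>q::rat. fps_nth (fps_integral0 F) n = of_rat q * s ^ (n + w)"
  proof (cases n)
    case 0
    then show ?thesis by (intro exI[of _ 0]) (simp add: fps_integral_def)
  next
    case (Suc m)
    obtain p :: rat where "fps_nth F m = of_rat p * s ^ (m + Suc w)"
      using assms graded_fpsD by metis
    then have "fps_nth (fps_integral0 F) n = of_rat (p / of_nat (Suc m)) * s ^ (n + w)"
      by (simp add: Suc fps_integral_def of_rat_mult of_rat_inverse of_rat_add divide_inverse mult_ac)
    then show ?thesis by blast
  qed
qed

lemma graded_fps_X_mult:
  assumes "graded_fps s (Suc w) F"
  shows "graded_fps s w (fps_X * F)"
  unfolding graded_fps_def
proof
  fix n show "\<exists>q::rat. fps_nth (fps_X * F) n = of_rat q * s ^ (n + w)"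
  proof (cases n)
    case 0
    then show ?thesis by (intro exI[of _ 0]) simp
  next
    case (Suc m)
    then show ?thesis using graded_fpsD[OF assms, of m] by simp
  qed
qed

text \<open>Comparing coefficients, (m + 1)(m + 2) times coefficient m + 2 is 6 times a convolution
  of earlier coefficients, and every product in it has weight (i + 2) + (m - i + 2) = m + 4. The
  constant 2 s^4 enters at m = 0 only, where it has the same weight.\<close>

lemma graded_fps_ode:
  assumes ode: "fps_deriv (fps_deriv F) = 6 * F ^ 2 - fps_const (2 * s ^ 4)"
    and 0: "fps_nth F 0 = of_rat r * s ^ 2" and 1: "fps_nth F 1 = 0"
  shows "graded_fps s 2 F"
  unfolding graded_fps_def
proof
  fix n show "\<exists>q::rat. fps_nth F n = of_rat q * s ^ (n + 2)"
  proof (induction n rule: less_induct)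
    case (less n)
    consider "n = 0" | "n = 1" | m where "n = Suc (Suc m)" by (metis One_nat_def not0_implies_Suc)
    then show ?case
    proof cases
      case 1 then show ?thesis using 0 by (auto simp: power2_eq_square)
    next
      case 2 then show ?thesis using 1 by (intro exI[of _ 0]) simp
    next
      case (3 m)
      have "\<exists>q::rat. fps_nth F i * fps_nth F (m - i) = of_rat q * s ^ (m + 4)" if "i \<in> {0..m}" for i
      proof -
        have "i < n" "m - i < n" using that 3 by auto
        obtain p :: rat where p: "fps_nth F i = of_rat p * s ^ (i + 2)"
          using less.IH[OF \<open>i < n\<close>] by blast
        obtain q :: rat where q: "fps_nth F (m - i) = of_rat q * s ^ (m - i + 2)"
          using less.IH[OF \<open>m - i < n\<close>] by blast
        have "fps_nth F i * fps_nth F (m - i) = of_rat (p * q) * s ^ ((i + 2) + (m - i + 2))"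
          unfolding p q power_add by (simp add: of_rat_mult)
        also have "(i + 2) + (m - i + 2) = m + 4" using that by simp
        finally show ?thesis by blast
      qed
      then obtain q :: rat where q: "(\<Sum>i=0..m. fps_nth F i * fps_nth F (m - i)) = of_rat q * s ^ (m + 4)"
        using graded_coeff_sum[of "{0..m}" "\<lambda>i. fps_nth F i * fps_nth F (m - i)"] by blast
      have "fps_nth (F ^ 2) m = of_rat q * s ^ (m + 4)"
        by (simp only: power2_eq_square fps_mult_nth q)
      then have "fps_nth (fps_deriv (fps_deriv F)) m = 6 * (of_rat q * s ^ (m + 4)) - (if m = 0 then 2 * s ^ 4 else 0)"
        unfolding ode by (simp add: fps_numeral_fps_const)
      also have "\<dots> = of_rat (6 * q - (if m = 0 then 2 else 0)) * s ^ (m + 4)"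
        by (simp add: of_rat_diff of_rat_mult algebra_simps)
      also have "fps_nth (fps_deriv (fps_deriv F)) m = of_nat ((m + 1) * (m + 2)) * fps_nth F n"
        by (simp add: 3 algebra_simps)
      finally have *: "of_nat ((m + 1) * (m + 2)) * fps_nth F n = of_rat (6 * q - (if m = 0 then 2 else 0)) * s ^ (m + 4)" .
      have "(of_nat ((m + 1) * (m + 2)) :: complex) \<noteq> 0"
        unfolding of_nat_eq_0_iff by simp
      then have "fps_nth F n = of_rat (6 * q - (if m = 0 then 2 else 0)) * s ^ (m + 4) / of_nat ((m + 1) * (m + 2))"
        using * by (metis nonzero_mult_div_cancel_left)
      also have "m + 4 = n + 2" by (simp add: 3)
      finally have "fps_nth F n = of_rat ((6 * q - (if m = 0 then 2 else 0)) / of_nat ((m + 1) * (m + 2))) * s ^ (n + 2)"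
        unfolding of_rat_divide of_rat_of_nat_eq by simp
      then show ?thesis by blast
    qed
  qed
qed

section \<open>Taylor expansions at the half periods\<close>

lemma deriv_shift: "deriv (\<lambda>t. f (t + a)) = (\<lambda>t. deriv f (t + a :: 'a :: real_normed_field))"
  by (rule ext) (simp add: deriv_def DERIV_shift)

lemma has_fps_expansion_sq_lattice:
  assumes "f holomorphic_on - sq_lattice" "a \<notin> sq_lattice"
  shows "(\<lambda>t. f (t + a)) has_fps_expansion fps_expansion (\<lambda>t. f (t + a)) 0"
proof (rule has_fps_expansion_fps_expansion)
  show "open ((\<lambda>t. t + a) -` (- sq_lattice))"
    by (intro open_vimage open_compl_sq_lattice continuous_intros)
  show "(\<lambda>t. f (t + a)) holomorphic_on (\<lambda>t. t + a) -` (- sq_lattice)"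
    by (rule holomorphic_on_compose_gen[OF _ assms(1), unfolded o_def]) (auto intro!: holomorphic_intros)
qed (use assms in auto)

lemma eventually_shift_notin_sq_lattice:
  assumes "a \<notin> sq_lattice"
  shows "eventually (\<lambda>t. t + a \<notin> sq_lattice) (nhds 0)"
proof -
  have "open ((\<lambda>t. t + a) -` (- sq_lattice))"
    by (intro open_vimage open_compl_sq_lattice continuous_intros)
  then have "eventually (\<lambda>t. t \<in> (\<lambda>t. t + a) -` (- sq_lattice)) (nhds 0)"
    by (rule eventually_nhds_in_open) (use assms in auto)
  then show ?thesis by simp
qed

text \<open>As a series, U_sq z is the sum over all integers n of (-1)^n n dcth (z - n).\<close>

definition U_sq :: "complex \<Rightarrow> complex" where
  "U_sq z = V_sq z - V_sq (z - 1) - deriv zeta_sq (z - 1)"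

text \<open>At a half period everything reduces to the series \<open>A\<close> of wp, which is
  graded by its differential equation. Then zeta' = pi / 4 - A, integration adds
  \<open>zeta_sq a\<close> as the only new constant, and \<open>V_sq_eq\<close> yields V. The ratio
  \<open>r\<close> is -1 at i and 0 at i - 1.\<close>

lemma V_sq_zeta_sq_fps:
  assumes a: "a \<notin> sq_lattice" and s: "s\<^sup>2 = e_sq"
    and wp0: "wp_sq a = of_rat r * e_sq" and wp1: "deriv wp_sq a = 0"
  obtains A where "graded_fps s 2 A"
    "(\<lambda>t. deriv zeta_sq (t + a)) has_fps_expansion fps_const (of_real (pi / 4)) - A"
    "(\<lambda>t. V_sq (t + a)) has_fps_expansion fps_const (inverse (of_real pi)) *
        (2 * (fps_const (zeta_sq a) + fps_const (of_real (pi / 4)) * fps_X - fps_integral0 A) *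
           (fps_const (of_real (pi / 4)) - A) - fps_deriv A)"
proof -
  define Z where "Z = fps_expansion (\<lambda>t. zeta_sq (t + a)) 0"
  have Z: "(\<lambda>t. zeta_sq (t + a)) has_fps_expansion Z"
    unfolding Z_def by (rule has_fps_expansion_sq_lattice[OF zeta_sq_holomorphic a])
  have Z': "(\<lambda>t. deriv zeta_sq (t + a)) has_fps_expansion fps_deriv Z"
    using has_fps_expansion_deriv[OF Z] by (simp add: deriv_shift)
  define A where "A = fps_const (of_real (pi / 4)) - fps_deriv Z"
  have A: "(\<lambda>t. wp_sq (t + a)) has_fps_expansion A"
    unfolding wp_sq_def A_def by (intro fps_expansion_intros Z')
  have A': "(\<lambda>t. deriv wp_sq (t + a)) has_fps_expansion fps_deriv A"
    using has_fps_expansion_deriv[OF A] by (simp add: deriv_shift)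
  have A'': "(\<lambda>t. deriv (deriv wp_sq) (t + a)) has_fps_expansion fps_deriv (fps_deriv A)"
    using has_fps_expansion_deriv[OF A'] by (simp add: deriv_shift)
  have s4: "s ^ 4 = e_sq\<^sup>2" by (simp add: s[symmetric] flip: power_mult)
  have "(\<lambda>t. 6 * wp_sq (t + a) ^ 2 - 2 * s ^ 4) has_fps_expansion 6 * A ^ 2 - fps_const (2 * s ^ 4)"
    unfolding power2_eq_square by (intro fps_expansion_intros A)
  also have "?this \<longleftrightarrow> (\<lambda>t. deriv (deriv wp_sq) (t + a)) has_fps_expansion 6 * A ^ 2 - fps_const (2 * s ^ 4)"
    using eventually_shift_notin_sq_lattice[OF a]
    by (intro has_fps_expansion_cong) (auto elim!: eventually_mono simp: wp_sq_ode2 s4)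
  finally have "fps_deriv (fps_deriv A) = 6 * A ^ 2 - fps_const (2 * s ^ 4)"
    using A'' fps_expansion_unique_complex by blast
  moreover have "fps_nth A 0 = of_rat r * s ^ 2" "fps_nth A 1 = 0"
    using fps_nth_fps_expansion[OF A, of 0] fps_nth_fps_expansion[OF A, of 1] wp0 wp1 s
    by (simp_all add: deriv_shift)
  ultimately have gA: "graded_fps s 2 A" by (rule graded_fps_ode)
  define W where "W = fps_const (zeta_sq a) + fps_const (of_real (pi / 4)) * fps_X - fps_integral0 A"
  have "fps_nth Z 0 = zeta_sq a" using fps_nth_fps_expansion[OF Z, of 0] by simp
  moreover have "fps_nth W 0 = zeta_sq a" by (simp add: W_def fps_integral_def)
  moreover have dZ: "fps_deriv Z = fps_const (of_real (pi / 4)) - A" by (simp add: A_def)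
  moreover have "fps_deriv W = fps_const (of_real (pi / 4)) - A"
    by (simp add: W_def fps_deriv_fps_integral)
  ultimately have Z_eq: "Z = W"
    using fps_deriv_eq_iff[of Z W] by simp
  have "(\<lambda>t. inverse (of_real pi) * (2 * zeta_sq (t + a) * deriv zeta_sq (t + a) - deriv wp_sq (t + a)))
     has_fps_expansion fps_const (inverse (of_real pi)) * (2 * Z * fps_deriv Z - fps_deriv A)"
    by (intro fps_expansion_intros Z Z' A')
  also have "?this \<longleftrightarrow> (\<lambda>t. V_sq (t + a)) has_fps_expansion fps_const (inverse (of_real pi)) * (2 * Z * fps_deriv Z - fps_deriv A)"
    using eventually_shift_notin_sq_lattice[OF a]
    by (intro has_fps_expansion_cong) (auto elim!: eventually_mono simp: V_sq_eq field_simps)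
  finally have V: "(\<lambda>t. V_sq (t + a)) has_fps_expansion fps_const (inverse (of_real pi)) * (2 * Z * fps_deriv Z - fps_deriv A)" .
  show ?thesis
    by (rule that[OF gA Z'[unfolded dZ] V[unfolded dZ, unfolded Z_eq W_def]])
qed

text \<open>Parity combined with the period 2i gives the first value; for i - 1 the quasi-period 2
  enters as well and leaves half of -pi.\<close>

lemma zeta_sq_half_periods: "zeta_sq \<i> = 0" "zeta_sq (\<i> - 1) = - of_real (pi / 2)"
proof -
  show "zeta_sq \<i> = 0"
    using zeta_sq_uminus[of \<i>] zeta_sq_shift_imaginary[of "-\<i>"] by simp
  have "zeta_sq (\<i> + 1) = zeta_sq (\<i> - 1) + of_real pi"
    using zeta_sq_shift_real[of "\<i> - 1"] by (simp add: algebra_simps)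
  moreover have "zeta_sq (\<i> + 1) = - zeta_sq (\<i> - 1)"
    using zeta_sq_uminus[of "\<i> - 1"] zeta_sq_shift_imaginary[of "1 - \<i>"] by (simp add: algebra_simps)
  ultimately have "2 * zeta_sq (\<i> - 1) = - of_real pi" by (simp add: eq_neg_iff_add_eq_0)
  then show "zeta_sq (\<i> - 1) = - of_real (pi / 2)" by (simp add: field_simps)
qed

text \<open>To be read with c = pi / 4, Q = 1 / pi and IA, DA, IB, DB the integrals and derivatives
  of A and B; the term -2 c is the value of zeta at i - 1. The point is what disappears: the
  products Q c^2, of size pi, cancel, and the derivative of zeta in \<open>U_sq\<close> absorbs the
  part caused by -2 c. Only the rational factor 2 Q c = 1 / 2 and the factor Q remain.\<close>

lemma zeta_fps_identity:
  fixes A B c X Q :: "'a :: comm_ring_1"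
  assumes "4 * (Q * c) = 1"
  shows "Q * (2 * (c * X - IA) * (c - A) - DA) - Q * (2 * (- 2 * c + c * X - IB) * (c - B) - DB) - (c - B)
      = 2 * (Q * c) * ((X * B + IB) - (X * A + IA)) + Q * (2 * (IA * A - IB * B) + (DB - DA))"
proof -
  have "Q * (2 * (c * X - IA) * (c - A) - DA) - Q * (2 * (- 2 * c + c * X - IB) * (c - B) - DB) - (c - B)
      = 2 * (Q * c) * ((X * B + IB) - (X * A + IA)) + Q * (2 * (IA * A - IB * B) + (DB - DA))
        + (4 * (Q * c) - 1) * (c - B)"
    by (simp add: algebra_simps)
  then show ?thesis by (simp add: assms)
qed

lemma higher_deriv_U_sq:
  assumes "k \<ge> 1"
  shows "\<exists>p q :: rat. (deriv ^^ (2 * k - 1)) U_sq \<i> = of_rat p * e_sq ^ k + of_rat q * e_sq ^ (k + 1) / of_real pi"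
proof -
  define s where "s = complex_of_real (sqrt (Re e_sq))"
  have s: "s\<^sup>2 = e_sq"
    using e_sq_pos by (simp add: s_def complex_eq_iff flip: of_real_power)
  have wp_i: "wp_sq \<i> = of_rat (-1) * e_sq" "deriv wp_sq \<i> = 0"
    by (simp_all add: wp_sq_half_periods deriv_wp_sq_half_periods)
  have wp_i1: "wp_sq (\<i> - 1) = of_rat 0 * e_sq" "deriv wp_sq (\<i> - 1) = 0"
    using wp_sq_shift(1)[of "\<i> - 1"] deriv_wp_sq_shift(1)[of "\<i> - 1"]
    by (simp_all add: wp_sq_half_periods deriv_wp_sq_half_periods add.commute[of \<i> 1])
  define c where "c = fps_const (complex_of_real (pi / 4))"
  define Q where "Q = fps_const (inverse (complex_of_real pi))"
  define H where "H = fps_const (of_rat (1 / 2) :: complex)"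
  obtain A where A: "graded_fps s 2 A"
    "(\<lambda>t. V_sq (t + \<i>)) has_fps_expansion Q * (2 * (c * fps_X - fps_integral0 A) * (c - A) - fps_deriv A)"
    using V_sq_zeta_sq_fps[OF _ s wp_i] unfolding c_def Q_def by (auto simp: zeta_sq_half_periods)
  obtain B where B: "graded_fps s 2 B"
    "(\<lambda>t. deriv zeta_sq (t + (\<i> - 1))) has_fps_expansion c - B"
    "(\<lambda>t. V_sq (t + (\<i> - 1))) has_fps_expansion Q * (2 * (- 2 * c + c * fps_X - fps_integral0 B) * (c - B) - fps_deriv B)"
  proof -
    have *: "fps_const (- complex_of_real (pi / 2)) = - 2 * c"
      by (simp add: c_def fps_numeral_fps_const flip: fps_const_neg)
    show ?thesis
      using V_sq_zeta_sq_fps[OF _ s wp_i1] that unfolding * zeta_sq_half_periods c_def[symmetric] Q_def[symmetric]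
      by auto
  qed
  have "(\<lambda>t. V_sq (t + \<i>) - V_sq (t + (\<i> - 1)) - deriv zeta_sq (t + (\<i> - 1))) has_fps_expansion
      Q * (2 * (c * fps_X - fps_integral0 A) * (c - A) - fps_deriv A)
      - Q * (2 * (- 2 * c + c * fps_X - fps_integral0 B) * (c - B) - fps_deriv B) - (c - B)"
    by (intro fps_expansion_intros A B)
  also have "(\<lambda>t. V_sq (t + \<i>) - V_sq (t + (\<i> - 1)) - deriv zeta_sq (t + (\<i> - 1))) = (\<lambda>t. U_sq (t + \<i>))"
    by (simp add: U_sq_def add_diff_eq)
  also have "Q * (2 * (c * fps_X - fps_integral0 A) * (c - A) - fps_deriv A)
      - Q * (2 * (- 2 * c + c * fps_X - fps_integral0 B) * (c - B) - fps_deriv B) - (c - B)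
      = H * ((fps_X * B + fps_integral0 B) - (fps_X * A + fps_integral0 A))
        + Q * (fps_const (of_rat 2) * (fps_integral0 A * A - fps_integral0 B * B) + (fps_deriv B - fps_deriv A))"
  proof -
    have H: "H = 2 * (Q * c)" by (simp add: Q_def c_def H_def fps_numeral_fps_const of_rat_divide)
    have 1: "4 * (Q * c) = 1" by (simp add: Q_def c_def fps_numeral_fps_const)
    have 2: "fps_const (of_rat 2) = (2 :: complex fps)" by (simp add: fps_numeral_fps_const)
    show ?thesis unfolding H 2 using 1 by (rule zeta_fps_identity)
  qed
  finally have U: "(\<lambda>t. U_sq (t + \<i>)) has_fps_expansion
     H * ((fps_X * B + fps_integral0 B) - (fps_X * A + fps_integral0 A))
        + Q * (fps_const (of_rat 2) * (fps_integral0 A * A - fps_integral0 B * B) + (fps_deriv B - fps_deriv A))"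
     (is "_ has_fps_expansion ?G1 + Q * ?G2") .
  have IA: "graded_fps s 1 (fps_integral0 A)" and IB: "graded_fps s 1 (fps_integral0 B)"
    using graded_fps_integral[of s 1] A(1) B(1) by (simp_all add: numeral_2_eq_2)
  have "graded_fps s 1 ?G1"
    unfolding H_def using IA IB A(1) B(1)
    by (intro graded_fps_cmult graded_fps_diff graded_fps_add graded_fps_X_mult) (simp_all add: numeral_2_eq_2)
  then obtain p :: rat where p: "fps_nth ?G1 (2 * k - 1) = of_rat p * s ^ (2 * k - 1 + 1)" using graded_fpsD by blast
  have "graded_fps s 3 (fps_integral0 A * A)" "graded_fps s 3 (fps_integral0 B * B)"
    using graded_fps_mult[OF IA A(1)] graded_fps_mult[OF IB B(1)] by (simp_all add: numeral_eq_Suc)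
  then have "graded_fps s 3 ?G2"
    using graded_fps_deriv[OF A(1)] graded_fps_deriv[OF B(1)]
    by (intro graded_fps_cmult graded_fps_diff graded_fps_add) simp_all
  then obtain q :: rat where q: "fps_nth ?G2 (2 * k - 1) = of_rat q * s ^ (2 * k - 1 + 3)" using graded_fpsD by blast
  \<comment> \<open>Odd index plus odd weight makes the exponents even, so the auxiliary square root
    \<open>s\<close> disappears.\<close>
  have pow: "s ^ (2 * k - 1 + 1) = e_sq ^ k"  "s ^ (2 * k - 1 + 3) = e_sq ^ (k + 1)"
  proof -
    have "2 * k - 1 + 1 = 2 * k" "2 * k - 1 + 3 = 2 * (k + 1)" using assms by auto
    then show "s ^ (2 * k - 1 + 1) = e_sq ^ k"  "s ^ (2 * k - 1 + 3) = e_sq ^ (k + 1)"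
      by (simp_all only: power_mult s)
  qed
  have "(deriv ^^ (2 * k - 1)) U_sq \<i> = (deriv ^^ (2 * k - 1)) (\<lambda>t. U_sq (t + \<i>)) 0"
    by (subst higher_deriv_shift_0) (simp add: o_def add.commute)
  also have "\<dots> = fact (2 * k - 1) * fps_nth (?G1 + Q * ?G2) (2 * k - 1)"
    using fps_nth_fps_expansion[OF U, of "2 * k - 1"] by simp
  also have "\<dots> = fact (2 * k - 1) * (of_rat p * e_sq ^ k + inverse (of_real pi) * (of_rat q * e_sq ^ (k + 1)))"
  proof -
    have "fps_nth (Q * ?G2) (2 * k - 1) = inverse (of_real pi) * fps_nth ?G2 (2 * k - 1)"
      unfolding Q_def by (rule fps_mult_left_const_nth)
    then show ?thesis unfolding fps_add_nth[of ?G1 "Q * ?G2"] p q pow by (simp only:)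
  qed
  also have "\<dots> = of_rat (fact (2 * k - 1) * p) * e_sq ^ k + of_rat (fact (2 * k - 1) * q) * e_sq ^ (k + 1) / of_real pi"
  proof -
    have "of_rat (fact n) = (fact n :: complex)" for n
      using of_rat_of_nat_eq[of "fact n", where 'a = complex] by simp
    then show ?thesis unfolding of_rat_mult by (simp add: distrib_left divide_inverse mult_ac)
  qed
  finally show ?thesis by blast
qed

section \<open>Partial fractions\<close>

lemma open_compl_dcth_poles: "open (- {z::complex. Re z = 0 \<and> Im z / 2 \<in> \<int>})"
proof -
  have "closed ({z. Re z = 0} \<inter> (\<lambda>z. Im z / 2) -` \<int>)"
    by (intro closed_Int closed_Collect_eq closed_vimage continuous_intros closed_Ints) simp
  moreover have "{z::complex. Re z = 0 \<and> Im z / 2 \<in> \<int>} = {z. Re z = 0} \<inter> (\<lambda>z. Im z / 2) -` \<int>" by auto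
  ultimately show ?thesis by (simp only: open_Compl)
qed

lemma higher_deriv_V_term:
  assumes "z \<notin> sq_lattice"
  shows "(deriv ^^ m) (V_term n) z = 2 * of_int n * (deriv ^^ m) dcth (z - 2 * of_int n)"
proof -
  let ?T = "- {z::complex. Re z = 0 \<and> Im z / 2 \<in> \<int>}"
  note T = open_compl_dcth_poles
  have in_T: "1 * w + (- 2 * of_int n) \<in> ?T" if "w \<in> - sq_lattice" for w
  proof -
    have "w \<in> - (sq_lattice - {0})" "w \<noteq> 0 \<or> n \<noteq> 0" using that by auto
    from not_pole_shifted[OF this] show ?thesis by simp
  qed
  have "(deriv ^^ m) (\<lambda>w. dcth (1 * w + (- 2 * of_int n))) z = 1 ^ m * (deriv ^^ m) dcth (1 * z + (- 2 * of_int n))"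
    by (rule higher_deriv_compose_linear'[OF dcth_holomorphic open_compl_sq_lattice T]) (use in_T assms in auto)
  moreover have "(deriv ^^ m) (\<lambda>w. (2 * of_int n) * dcth (1 * w + (- 2 * of_int n))) z
      = 2 * of_int n * (deriv ^^ m) (\<lambda>w. dcth (1 * w + (- 2 * of_int n))) z"
  proof (rule higher_deriv_cmult[OF _ _ open_compl_sq_lattice])
    show "(\<lambda>w. dcth (1 * w + (- 2 * of_int n))) holomorphic_on - sq_lattice"
      by (rule holomorphic_on_compose_gen[OF _ dcth_holomorphic, unfolded o_def])
         (use in_T in \<open>auto intro!: holomorphic_intros\<close>)
  qed (use assms in auto)
  ultimately show ?thesis by (simp add: V_term_def [abs_def])
qed

lemma higher_deriv_zeta_term:
  assumes "z \<notin> sq_lattice"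
  shows "(deriv ^^ Suc m) (zeta_term n) z = (deriv ^^ m) dcth (z - 2 * of_int n)"
proof -
  have "(deriv ^^ Suc m) (zeta_term n) z = (deriv ^^ m) (deriv (zeta_term n)) z"
    by (simp only: funpow_Suc_right o_def)
  also have "\<dots> = (deriv ^^ m) (\<lambda>w. dcth (w - 2 * of_int n)) z"
  proof (rule higher_deriv_cong_ev)
    have "eventually (\<lambda>w. w \<in> - sq_lattice) (nhds z)"
      using assms open_compl_sq_lattice by (intro eventually_nhds_in_open) auto
    then show "eventually (\<lambda>w. deriv (zeta_term n) w = dcth (w - 2 * of_int n)) (nhds z)"
      by eventually_elim (auto intro!: DERIV_imp_deriv has_field_derivative_zeta_term)
  qed simp
  also have "\<dots> = (deriv ^^ m) dcth (z - 2 * of_int n)"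
    by (subst higher_deriv_shift_0, subst (2) higher_deriv_shift_0) (simp add: o_def algebra_simps)
  finally show ?thesis .
qed

lemma higher_deriv_U_sq_eq:
  "(deriv ^^ m) U_sq \<i> = (deriv ^^ m) V_sq \<i> - (deriv ^^ m) V_sq (\<i> - 1) - (deriv ^^ Suc m) zeta_sq (\<i> - 1)"
proof -
  define S where "S = (\<lambda>z. z - 1) -` (- sq_lattice) \<inter> - sq_lattice"
  have S: "open S" unfolding S_def
    by (intro open_Int open_vimage open_compl_sq_lattice continuous_intros)
  have V: "V_sq holomorphic_on - sq_lattice"
    using V_sq_holomorphic by (rule holomorphic_on_subset) auto
  have sub: "(\<lambda>z. f (z - 1)) holomorphic_on S" if "f holomorphic_on - sq_lattice" for f
    by (rule holomorphic_on_compose_gen[OF _ that, unfolded o_def]) (auto intro!: holomorphic_intros simp: S_def)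
  have V': "V_sq holomorphic_on S" using V by (rule holomorphic_on_subset) (auto simp: S_def)
  have sh: "(deriv ^^ m) (\<lambda>z. f (z - 1)) \<i> = (deriv ^^ m) f (\<i> - 1)" for f :: "complex \<Rightarrow> complex"
    by (subst higher_deriv_shift_0, subst (2) higher_deriv_shift_0) (simp add: o_def algebra_simps)
  have iS: "\<i> \<in> S" by (simp add: S_def)
  have "(deriv ^^ m) U_sq \<i> = (deriv ^^ m) V_sq \<i> - (deriv ^^ m) (\<lambda>z. V_sq (z - 1)) \<i> - (deriv ^^ m) (\<lambda>z. deriv zeta_sq (z - 1)) \<i>"
    unfolding U_sq_def [abs_def]
    by (subst higher_deriv_diff[OF _ _ S iS] | intro holomorphic_intros V' sub V deriv_zeta_sq_holomorphic refl)+
  then show ?thesis by (simp only: sh funpow_Suc_right o_def)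
qed

text \<open>Being even with period 2i, \<open>dcth\<close> is invariant under w -> 2i - w; each
  derivative contributes a sign. This is what makes the terms n and -n of the series for U
  equal.\<close>

lemma higher_deriv_dcth_reflect:
  assumes "odd m"
  shows "(deriv ^^ m) dcth (\<i> - of_int n) = - (deriv ^^ m) dcth (\<i> + of_int n)"
proof -
  let ?T = "- {z::complex. Re z = 0 \<and> Im z / 2 \<in> \<int>}"
  note T = open_compl_dcth_poles
  have eq: "dcth (- 1 * w + 2 * \<i>) = dcth w" for w
    using dcth_periodic[of "-w"] by simp
  have "\<i> + of_int n \<in> ?T"
  proof -
    have "\<i> \<in> - (sq_lattice - {0})" by simp
    from not_pole_shifted[OF this, of 0] show ?thesis by (auto simp: sq_lattice_def)
  qed
  moreover have "- 1 * w + 2 * \<i> \<in> ?T" if "w \<in> ?T" for w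
  proof -
    have "Im w / 2 \<in> \<int>" if "(2 - Im w) / 2 \<in> \<int>"
    proof -
      have "Im w / 2 = 1 - (2 - Im w) / 2" by (simp add: field_simps)
      then show ?thesis using that by (metis Ints_1 Ints_diff)
    qed
    then show ?thesis using that by auto
  qed
  ultimately have "(deriv ^^ m) (\<lambda>w. dcth (- 1 * w + 2 * \<i>)) (\<i> + of_int n)
      = (- 1) ^ m * (deriv ^^ m) dcth (- 1 * (\<i> + of_int n) + 2 * \<i>)"
    by (intro higher_deriv_compose_linear'[OF dcth_holomorphic T T]) auto
  then have "(deriv ^^ m) dcth (\<i> + of_int n) = - (deriv ^^ m) dcth (- 1 * (\<i> + of_int n) + 2 * \<i>)"
    unfolding eq using assms by simp
  also have "- 1 * (\<i> + of_int n) + 2 * \<i> = \<i> - of_int n" by simp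
  finally show ?thesis by simp
qed

text \<open>V at i supplies the even j of the series over all integers. At i - 1 the shift 2n
  corresponds to j = 2n + 1 but carries only the weight 2n; the derivative of zeta in
  \<open>U_sq\<close> supplies the missing 1. Folding j and -j together gives the factor 1 /
  2.\<close>

lemma higher_deriv_U_sq_sums:
  assumes m: "odd m"
  shows "(\<lambda>n. (-1) ^ n * of_nat (n + 1) * (deriv ^^ m) dcth (\<i> + of_nat (n + 1))) sums ((deriv ^^ m) U_sq \<i> / 2)"
proof -
  define d where "d = (\<lambda>j::int. (deriv ^^ m) dcth (\<i> - of_int j))"
  define a where "a = (\<lambda>j::int. (if even j then 1 else -1) * of_int j * d j)"
  have "((\<lambda>n. 2 * of_int n * d (2 * n)) has_sum (deriv ^^ m) V_sq \<i>) UNIV"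
    using V_sq_higher_deriv[of \<i> m] by (simp add: higher_deriv_V_term d_def)
  then have "((\<lambda>n. a (2 * n)) has_sum (deriv ^^ m) V_sq \<i>) UNIV" by (simp add: a_def)
  then have even: "(a has_sum (deriv ^^ m) V_sq \<i>) (range (\<lambda>n. 2 * n))"
    by (subst has_sum_reindex) (auto simp: o_def inj_on_def)
  have d1: "(deriv ^^ m) dcth (\<i> - 1 - 2 * of_int n) = d (2 * n + 1)" for n
    by (simp add: d_def algebra_simps)
  have "((\<lambda>n. 2 * of_int n * d (2 * n + 1)) has_sum (deriv ^^ m) V_sq (\<i> - 1)) UNIV"
    using V_sq_higher_deriv[of "\<i> - 1" m] by (simp add: higher_deriv_V_term d1)
  moreover have "((\<lambda>n. d (2 * n + 1)) has_sum (deriv ^^ Suc m) zeta_sq (\<i> - 1)) UNIV"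
    using zeta_sq_higher_deriv[of "\<i> - 1" "Suc m"] by (simp only: higher_deriv_zeta_term half_periods_notin_sq_lattice d1 simp_thms)
  ultimately have "((\<lambda>n. - (2 * of_int n * d (2 * n + 1) + d (2 * n + 1))) has_sum
      - ((deriv ^^ m) V_sq (\<i> - 1) + (deriv ^^ Suc m) zeta_sq (\<i> - 1))) UNIV"
    by (intro has_sum_uminusI has_sum_add)
  then have "((\<lambda>n. a (2 * n + 1)) has_sum - ((deriv ^^ m) V_sq (\<i> - 1) + (deriv ^^ Suc m) zeta_sq (\<i> - 1))) UNIV"
    by (rule has_sum_cong[THEN iffD1, rotated]) (simp add: a_def algebra_simps)
  then have odd: "(a has_sum - ((deriv ^^ m) V_sq (\<i> - 1) + (deriv ^^ Suc m) zeta_sq (\<i> - 1))) (range (\<lambda>n. 2 * n + 1))"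
    by (subst has_sum_reindex) (auto simp: o_def inj_on_def)
  have "range (\<lambda>n::int. 2 * n) \<inter> range (\<lambda>n. 2 * n + 1) = {}"
    by (auto simp: image_iff) presburger
  moreover have "range (\<lambda>n::int. 2 * n) \<union> range (\<lambda>n. 2 * n + 1) = UNIV"
    by (auto simp: image_iff) presburger
  ultimately have total: "(a has_sum (deriv ^^ m) U_sq \<i>) UNIV"
    using has_sum_Un_disjoint[OF even odd] by (simp add: higher_deriv_U_sq_eq algebra_simps)
  have refl: "a (- j) = a j" for j
    using higher_deriv_dcth_reflect[OF m, of j] by (simp add: a_def d_def)
  have summ: "a summable_on A" for A
    using total summable_on_def summable_on_subset_banach by (metis subset_UNIV)
  define s where "s = infsum a {1..}"
  have pos: "(a has_sum s) {1..}" unfolding s_def using summ by (rule has_sum_infsum)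
  then have neg: "(a has_sum s) {..-1}"
  proof -
    have "((\<lambda>j. a (- j)) has_sum s) {1..}" using pos by (simp add: refl)
    moreover have "bij_betw uminus {1::int..} {..-1}"
      by (rule bij_betw_byWitness[of _ uminus]) auto
    ultimately show ?thesis using has_sum_reindex_bij_betw by blast
  qed
  have "(a has_sum (s + s + a 0)) (({1..} \<union> {..-1}) \<union> {0})"
    by (intro has_sum_Un_disjoint pos neg) (auto intro: has_sum_finiteI)
  moreover have "({1..} \<union> {..-1}) \<union> {0} = (UNIV :: int set)" by auto
  ultimately have "(deriv ^^ m) U_sq \<i> = s + s + a 0"
    using total has_sum_unique by metis
  then have s: "s = (deriv ^^ m) U_sq \<i> / 2" by (simp add: a_def)
  have "((\<lambda>n. a (int n + 1)) has_sum s) UNIV"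
  proof -
    have "bij_betw (\<lambda>n. int n + 1) UNIV {1..}"
      by (rule bij_betw_byWitness[of _ "\<lambda>j. nat (j - 1)"]) auto
    from has_sum_reindex_bij_betw[OF this] show ?thesis using pos by blast
  qed
  then have "(\<lambda>n. a (int n + 1)) sums s" by (rule has_sum_imp_sums)
  \<comment> \<open>\<open>d\<close> is taken at i - j, the claim at i + j; the sign of the
    reflection turns (-1)^(n+1) into (-1)^n.\<close>
  moreover have "a (int n + 1) = (-1) ^ n * of_nat (n + 1) * (deriv ^^ m) dcth (\<i> + of_nat (n + 1))" for n
  proof -
    have e: "(of_int (int n + 1) :: complex) = of_nat (n + 1)" by simp
    have "a (int n + 1) = (if even (int n + 1) then 1 else -1) * of_nat (n + 1) * - (deriv ^^ m) dcth (\<i> + of_nat (n + 1))"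
      using higher_deriv_dcth_reflect[OF m, of "int n + 1"] by (simp only: a_def d_def e)
    also have "(if even (int n + 1) then 1 else -1 :: complex) = - ((-1) ^ n)" by simp
    finally show ?thesis by simp
  qed
  ultimately show ?thesis by (simp add: s)
qed

section \<open>Polygamma functions as the source of the partial fractions\<close>

lemma Digamma_reflection:
  fixes z :: complex
  assumes "z \<notin> \<int>"
  shows "Digamma (1 - z) - Digamma z = of_real pi * cos (of_real pi * z) / sin (of_real pi * z)"
proof -
  have z: "z \<notin> \<int>\<^sub>\<le>\<^sub>0" "1 - z \<notin> \<int>\<^sub>\<le>\<^sub>0" using assms nonpos_Ints_subset_Ints by (auto simp: minus_in_Ints_iff dest: Ints_diff[of 1 "1 - z"])
  have s: "sin (of_real pi * z) \<noteq> 0"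
  proof
    assume "sin (of_real pi * z) = 0"
    then obtain n :: int where "of_real pi * z = of_real (of_int n * pi)" by (auto simp: sin_eq_0)
    then have "z = of_int n" by simp
    then show False using assms by simp
  qed
  have "((\<lambda>z. Gamma z * Gamma (1 - z)) has_field_derivative
      Gamma z * Digamma z * Gamma (1 - z) - Gamma z * (Gamma (1 - z) * Digamma (1 - z))) (at z)"
    using z by (auto intro!: derivative_eq_intros simp: algebra_simps)
  moreover have "((\<lambda>z. of_real pi / sin (of_real pi * z)) has_field_derivative
      - of_real pi * (cos (of_real pi * z) * of_real pi) / (sin (of_real pi * z))\<^sup>2) (at z)"
    using s by (auto intro!: derivative_eq_intros simp: power2_eq_square)
  ultimately have "Gamma z * Digamma z * Gamma (1 - z) - Gamma z * (Gamma (1 - z) * Digamma (1 - z))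
      = - of_real pi * (cos (of_real pi * z) * of_real pi) / (sin (of_real pi * z))\<^sup>2"
    unfolding Gamma_reflection_complex by (rule DERIV_unique)
  then have "(Gamma z * Gamma (1 - z)) * (Digamma (1 - z) - Digamma z)
      = of_real pi * (cos (of_real pi * z) * of_real pi) / (sin (of_real pi * z))\<^sup>2"
    by (simp add: algebra_simps)
  then show ?thesis
  proof -
    assume *: "(Gamma z * Gamma (1 - z)) * (Digamma (1 - z) - Digamma z)
      = of_real pi * (cos (of_real pi * z) * of_real pi) / (sin (of_real pi * z))\<^sup>2"
    have "Digamma (1 - z) - Digamma z = sin (of_real pi * z) / of_real pi *
       (of_real pi / sin (of_real pi * z) * (Digamma (1 - z) - Digamma z))"
      using s by simp
    also have "of_real pi / sin (of_real pi * z) * (Digamma (1 - z) - Digamma z)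
      = of_real pi * (cos (of_real pi * z) * of_real pi) / (sin (of_real pi * z))\<^sup>2"
      using * unfolding Gamma_reflection_complex .
    finally show ?thesis using s by (simp add: power2_eq_square)
  qed
qed

lemma trigamma_reflection:
  fixes z :: complex
  assumes "0 < Re z" "Re z < 1"
  shows "Polygamma 1 z + Polygamma 1 (1 - z) = (of_real pi / sin (of_real pi * z))\<^sup>2"
proof -
  define S where "S = {z::complex. 0 < Re z} \<inter> {z. Re z < 1}"
  have S: "open S" "z \<in> S"
    unfolding S_def using assms by (auto intro: open_halfspace_Re_gt open_halfspace_Re_lt)
  have nz: "w \<notin> \<int>" if "w \<in> S" for w
  proof
    assume "w \<in> \<int>"
    then obtain n :: int where "w = of_int n" by (elim Ints_cases)
    with that have "0 < n" "n < 1" by (auto simp: S_def)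
    then show False by simp
  qed
  have z: "z \<notin> \<int>\<^sub>\<le>\<^sub>0" "1 - z \<notin> \<int>\<^sub>\<le>\<^sub>0"
    using assms by (auto elim!: nonpos_Ints_cases simp: complex_eq_iff)
  have s: "sin (of_real pi * z) \<noteq> 0"
  proof
    assume "sin (of_real pi * z) = 0"
    then obtain n :: int where "of_real pi * z = of_real (of_int n * pi)" by (auto simp: sin_eq_0)
    then have "z = of_int n" by simp
    then show False using nz[OF S(2)] by simp
  qed
  have "((\<lambda>z. Digamma (1 - z) - Digamma z) has_field_derivative - Polygamma 1 (1 - z) - Polygamma 1 z) (at z)"
    using z by (auto intro!: derivative_eq_intros)
  then have "((\<lambda>z. of_real pi * cos (of_real pi * z) / sin (of_real pi * z)) has_field_derivative
      - Polygamma 1 (1 - z) - Polygamma 1 z) (at z)"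
    by (rule has_field_derivative_transform_within_open[OF _ S]) (use Digamma_reflection nz in auto)
  moreover have "((\<lambda>z. of_real pi * cos (of_real pi * z) / sin (of_real pi * z)) has_field_derivative
      - (of_real pi)\<^sup>2 * ((sin (of_real pi * z))\<^sup>2 + (cos (of_real pi * z))\<^sup>2) / (sin (of_real pi * z))\<^sup>2) (at z)"
  proof -
    have "((\<lambda>z. of_real pi * cos (of_real pi * z) / sin (of_real pi * z)) has_field_derivative
       (of_real pi * (- sin (of_real pi * z) * of_real pi) * sin (of_real pi * z)
        - of_real pi * cos (of_real pi * z) * (cos (of_real pi * z) * of_real pi)) / (sin (of_real pi * z))\<^sup>2) (at z)"
      using s by (auto intro!: derivative_eq_intros simp: power2_eq_square)
    also have "of_real pi * (- sin (of_real pi * z) * of_real pi) * sin (of_real pi * z)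
        - of_real pi * cos (of_real pi * z) * (cos (of_real pi * z) * of_real pi)
      = - (of_real pi)\<^sup>2 * ((sin (of_real pi * z))\<^sup>2 + (cos (of_real pi * z))\<^sup>2)"
    proof -
      have "p * (- s * p) * s - p * c * (c * p) = - p\<^sup>2 * (s\<^sup>2 + c\<^sup>2)" for p s c :: complex
        by (simp add: power2_eq_square algebra_simps)
      then show ?thesis .
    qed
    finally show ?thesis .
  qed
  ultimately have "- Polygamma 1 (1 - z) - Polygamma 1 z
      = - (of_real pi)\<^sup>2 * ((sin (of_real pi * z))\<^sup>2 + (cos (of_real pi * z))\<^sup>2) / (sin (of_real pi * z))\<^sup>2"
    by (rule DERIV_unique)
  also have "\<dots> = - ((of_real pi / sin (of_real pi * z))\<^sup>2)" by (simp add: power_divide)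
  also have "- Polygamma 1 (1 - z) - Polygamma 1 z = - (Polygamma 1 z + Polygamma 1 (1 - z))" by simp
  finally show ?thesis by (simp only: neg_equal_iff_equal)
qed

text \<open>Since sinh (pi (i + w) / 2) = i cosh (pi w / 2), the reflection formula at 1/2 + i w / 2
  splits \<open>dcth (\<i> + w)\<close> into two trigamma values, one for the poles in the upper and
  one for those in the lower half plane. Their standard series then give the partial fractions
  together with all derivatives.\<close>

lemma higher_deriv_dcth_Polygamma:
  assumes "x > 0"
  shows "(deriv ^^ m) dcth (\<i> + of_real x) =
    ((\<i> / 2) ^ m * Polygamma (Suc m) (1 / 2 + \<i> / 2 * of_real x) + (- \<i> / 2) ^ m * Polygamma (Suc m) (1 / 2 - \<i> / 2 * of_real x)) / 4"
proof -
  \<comment> \<open>In this strip both trigamma arguments 1/2 + i w / 2 and 1/2 - i w / 2 have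
    positive real part.\<close>
  define S where "S = {z::complex. -1 < Im z} \<inter> {z. Im z < 1}"
  have S: "open S" "of_real x \<in> S"
    unfolding S_def by (auto intro: open_halfspace_Im_gt open_halfspace_Im_lt)
  define T where "T = {z::complex. 0 < Re z}"
  have T: "open T" unfolding T_def by (rule open_halfspace_Re_gt)
  have PT: "Polygamma n holomorphic_on T" for n
    by (rule holomorphic_on_Polygamma) (auto simp: T_def elim!: nonpos_Ints_cases)
  have in1: "\<i> / 2 * w + 1 / 2 \<in> T" and in2: "- \<i> / 2 * w + 1 / 2 \<in> T" if "w \<in> S" for w
    using that by (auto simp: S_def T_def)
  have eq: "dcth (\<i> + w) = (1 / 4) * (Polygamma 1 (\<i> / 2 * w + 1 / 2) + Polygamma 1 (- \<i> / 2 * w + 1 / 2))" if "w \<in> S" for w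
  proof -
    have "Polygamma 1 (\<i> / 2 * w + 1 / 2) + Polygamma 1 (1 - (\<i> / 2 * w + 1 / 2))
        = (of_real pi / sin (of_real pi * (\<i> / 2 * w + 1 / 2)))\<^sup>2"
      by (rule trigamma_reflection) (use that in \<open>auto simp: S_def\<close>)
    also have "1 - (\<i> / 2 * w + 1 / 2) = - \<i> / 2 * w + 1 / 2" by simp
    also have "of_real pi * (\<i> / 2 * w + 1 / 2) = of_real (pi / 2) * \<i> * w + of_real (pi / 2)"
      by (simp add: algebra_simps)
    also have "sin (of_real (pi / 2) * \<i> * w + of_real (pi / 2)) = cos (of_real (pi / 2) * \<i> * w)"
      by (simp only: sin_add flip: sin_of_real cos_of_real) (simp flip: sin_of_real cos_of_real)
    finally have P: "Polygamma 1 (\<i> / 2 * w + 1 / 2) + Polygamma 1 (- \<i> / 2 * w + 1 / 2) = (of_real pi / cos (of_real (pi / 2) * \<i> * w))\<^sup>2" .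
    have "sinh (of_real (pi / 2) * (\<i> + w)) = \<i> * cos (of_real (pi / 2) * \<i> * w)"
    proof -
      have "\<i> * (c * (\<i> + w)) = c * \<i> * w - c" for c :: complex
        by (simp add: algebra_simps)
      then have "sinh (of_real (pi / 2) * (\<i> + w)) = - \<i> * sin (of_real (pi / 2) * \<i> * w - of_real (pi / 2))"
        by (simp only: sinh_conv_sin)
      also have "sin (of_real (pi / 2) * \<i> * w - of_real (pi / 2)) = - cos (of_real (pi / 2) * \<i> * w)"
        by (simp only: sin_diff sin_of_real cos_of_real) simp
      finally show ?thesis by simp
    qed
    then show ?thesis
      unfolding P dcth_def by (simp add: power_divide power_mult_distrib)
  qed
  have h1: "(\<lambda>w. Polygamma 1 (\<i> / 2 * w + 1 / 2)) holomorphic_on S" "(\<lambda>w. Polygamma 1 (- \<i> / 2 * w + 1 / 2)) holomorphic_on S"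
    by (rule holomorphic_on_compose_gen[OF _ PT, unfolded o_def]; use in1 in2 in \<open>auto intro!: holomorphic_intros\<close>)+
  have Pm: "(deriv ^^ m) (Polygamma 1) z = Polygamma (Suc m) z" if "z \<in> T" for z :: complex
  proof -
    have "z \<notin> \<int>\<^sub>\<le>\<^sub>0" using that by (auto simp: T_def elim!: nonpos_Ints_cases)
    then show ?thesis using higher_deriv_Polygamma[of z m 1] by simp
  qed
  have "(deriv ^^ m) dcth (\<i> + of_real x) = (deriv ^^ m) (\<lambda>w. dcth (\<i> + w)) (of_real x)"
    by (subst higher_deriv_shift_0, subst (2) higher_deriv_shift_0) (simp add: o_def algebra_simps)
  also have "\<dots> = (deriv ^^ m) (\<lambda>w. (1 / 4) * (Polygamma 1 (\<i> / 2 * w + 1 / 2) + Polygamma 1 (- \<i> / 2 * w + 1 / 2))) (of_real x)"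
    by (rule higher_deriv_cong_ev) (use eq eventually_nhds_in_open[OF S] in \<open>auto elim!: eventually_mono\<close>)
  also have "\<dots> = (1 / 4) * (deriv ^^ m) (\<lambda>w. Polygamma 1 (\<i> / 2 * w + 1 / 2) + Polygamma 1 (- \<i> / 2 * w + 1 / 2)) (of_real x)"
    by (rule higher_deriv_cmult[OF _ S(2,1)]) (intro holomorphic_intros h1)
  also have "(deriv ^^ m) (\<lambda>w. Polygamma 1 (\<i> / 2 * w + 1 / 2) + Polygamma 1 (- \<i> / 2 * w + 1 / 2)) (of_real x)
     = (deriv ^^ m) (\<lambda>w. Polygamma 1 (\<i> / 2 * w + 1 / 2)) (of_real x) + (deriv ^^ m) (\<lambda>w. Polygamma 1 (- \<i> / 2 * w + 1 / 2)) (of_real x)"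
    by (rule higher_deriv_add[OF h1 S])
  also have "(deriv ^^ m) (\<lambda>w. Polygamma 1 (\<i> / 2 * w + 1 / 2)) (of_real x) = (\<i> / 2) ^ m * (deriv ^^ m) (Polygamma 1) (\<i> / 2 * of_real x + 1 / 2)"
    by (rule higher_deriv_compose_linear'[OF PT S(1) T S(2)]) (use in1 in auto)
  also have "(deriv ^^ m) (\<lambda>w. Polygamma 1 (- \<i> / 2 * w + 1 / 2)) (of_real x) = (- \<i> / 2) ^ m * (deriv ^^ m) (Polygamma 1) (- \<i> / 2 * of_real x + 1 / 2)"
    by (rule higher_deriv_compose_linear'[OF PT S(1) T S(2)]) (use in2 in auto)
  finally show ?thesis
    using Pm[OF in1[OF S(2)]] Pm[OF in2[OF S(2)]] by (simp add: add.commute)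
qed

text \<open>On the line i + x, dcth is the derivative of (pi / 2) tanh (pi x / 2), whose poles are the odd
  multiples of i; conjugate poles are paired.\<close>

lemma higher_deriv_dcth_sums:
  assumes x: "x > 0" and k: "k \<ge> 1"
  shows "(\<lambda>j. 2 * fact (2 * k) * Re (1 / (of_real x + \<i> * of_nat (2 * j + 1)) ^ (2 * k + 1)))
    sums Re ((deriv ^^ (2 * k - 1)) dcth (\<i> + of_real x))"
proof -
  define t where "t = (\<lambda>j. 1 / (of_real x + \<i> * of_nat (2 * j + 1)) ^ (2 * k + 1) :: complex)"
  \<comment> \<open>Stated for u = i and u = -i at once. The base factors as (u / 2)(x - u (2j +
    1)), and its power contains (u / 2)^2 = -1/4 beyond the prefactor (u / 2)^(2k-1); this is the
    origin of -4.\<close>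
  have main: "(\<lambda>j. (u / 2) ^ (2 * k - 1) * (inverse ((1 / 2 + u / 2 * of_real x + of_nat j) ^ Suc (2 * k))))
     = (\<lambda>j. -4 * (1 / (of_real x - u * of_nat (2 * j + 1)) ^ (2 * k + 1)))" if u: "u\<^sup>2 = -1" for u :: complex
  proof
    fix j
    have u0: "u \<noteq> 0" using u by auto
    have "1 / 2 + u / 2 * of_real x + of_nat j = (u / 2) * (of_real x - u * of_nat (2 * j + 1))"
    proof -
      have "(u / 2) * (of_real x - u * of_nat (2 * j + 1)) = u / 2 * of_real x - u\<^sup>2 * (of_nat (2 * j + 1) / 2)"
        by (simp add: right_diff_distrib power2_eq_square)
      also have "of_nat (2 * j + 1) / 2 = (of_nat j + 1 / 2 :: complex)" by (simp add: add_divide_distrib)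
      finally show ?thesis using u by simp
    qed
    moreover have "Suc (2 * k) = (2 * k - 1) + 2" using k by simp
    then have "(u / 2) ^ Suc (2 * k) = (u / 2) ^ (2 * k - 1) * (u / 2)\<^sup>2" by (metis power_add)
    moreover have "(u / 2)\<^sup>2 = - 1 / 4" using u by (simp add: power_divide)
    ultimately have "(1 / 2 + u / 2 * of_real x + of_nat j) ^ Suc (2 * k)
        = (u / 2) ^ (2 * k - 1) * (- 1 / 4) * (of_real x - u * of_nat (2 * j + 1)) ^ (2 * k + 1)"
      by (simp only: power_mult_distrib Suc_eq_plus1)
    moreover have "v * inverse (v * (- 1 / 4) * y) = -4 * (1 / y)" if "v \<noteq> 0" for v y :: complex
      using that by (simp add: field_simps)
    ultimately show "(u / 2) ^ (2 * k - 1) * (inverse ((1 / 2 + u / 2 * of_real x + of_nat j) ^ Suc (2 * k)))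
      = -4 * (1 / (of_real x - u * of_nat (2 * j + 1)) ^ (2 * k + 1))"
      using u0 by simp
  qed
  have P: "(\<lambda>j. inverse ((w + of_nat j) ^ Suc (2 * k))) sums (- Polygamma (2 * k) w / fact (2 * k))" if "Re w > 0" for w :: complex
  proof -
    have "w \<noteq> 0" using that by auto
    then show ?thesis using Polygamma_LIMSEQ[of w "2 * k"] k by simp
  qed
  have S: "(\<lambda>j. -4 * (1 / (of_real x - u * of_nat (2 * j + 1)) ^ (2 * k + 1))) sums
      ((u / 2) ^ (2 * k - 1) * (- Polygamma (2 * k) (1 / 2 + u / 2 * of_real x) / fact (2 * k)))"
    if "u\<^sup>2 = -1" "Re u = 0" for u :: complex
    unfolding main[OF that(1), symmetric] by (rule sums_mult, rule P) (use that in auto)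
  have "(\<lambda>j. (- fact (2 * k) / 4) * ((-4 * cnj (t j)) + (-4 * t j))) sums
     ((- fact (2 * k) / 4) * ((\<i> / 2) ^ (2 * k - 1) * (- Polygamma (2 * k) (1 / 2 + \<i> / 2 * of_real x) / fact (2 * k))
      + (- \<i> / 2) ^ (2 * k - 1) * (- Polygamma (2 * k) (1 / 2 + - \<i> / 2 * of_real x) / fact (2 * k))))"
    using S[of \<i>] S[of "-\<i>"] by (intro sums_mult sums_add) (simp_all add: t_def)
  also have "((- fact (2 * k) / 4) * ((\<i> / 2) ^ (2 * k - 1) * (- Polygamma (2 * k) (1 / 2 + \<i> / 2 * of_real x) / fact (2 * k))
      + (- \<i> / 2) ^ (2 * k - 1) * (- Polygamma (2 * k) (1 / 2 + - \<i> / 2 * of_real x) / fact (2 * k))))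
     = ((\<i> / 2) ^ (2 * k - 1) * Polygamma (2 * k) (1 / 2 + \<i> / 2 * of_real x)
      + (- \<i> / 2) ^ (2 * k - 1) * Polygamma (2 * k) (1 / 2 - \<i> / 2 * of_real x)) / 4"
    by (simp add: divide_simps)
  also have "\<dots> = (deriv ^^ (2 * k - 1)) dcth (\<i> + of_real x)"
    using k by (simp add: higher_deriv_dcth_Polygamma[OF x])
  also have "(\<lambda>j. (- fact (2 * k) / 4) * ((-4 * cnj (t j)) + (-4 * t j))) = (\<lambda>j. of_real (2 * fact (2 * k) * Re (t j)))"
    by (rule ext) (simp add: complex_eq_iff)
  finally have *: "(\<lambda>j. complex_of_real (2 * fact (2 * k) * Re (t j))) sums (deriv ^^ (2 * k - 1)) dcth (\<i> + of_real x)" .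
  from sums_Re[OF *] show "(\<lambda>j. 2 * fact (2 * k) * Re (1 / (of_real x + \<i> * of_nat (2 * j + 1)) ^ (2 * k + 1)))
    sums Re ((deriv ^^ (2 * k - 1)) dcth (\<i> + of_real x))" by (simp add: t_def)
qed

section \<open>The integrals as iterated series\<close>

text \<open>The induction is integration by parts. The limit along the naturals suffices, because
  the half line is exhausted by intervals with endpoints n.\<close>

lemma ex_antiderivative_power_exp:
  fixes l :: complex
  assumes "Re l > 0"
  shows "\<exists>F. (\<forall>z. (F has_field_derivative z ^ a * exp (- (l * z))) (at z)) \<and>
     F 0 = - (fact a / l ^ (a + 1)) \<and> (\<lambda>n. F (of_nat n)) \<longlonglongrightarrow> 0"
proof (induction a)
  have l: "l \<noteq> 0" using assms by auto
  have lim: "(\<lambda>n. of_nat n ^ b * exp (- (l * of_nat n))) \<longlonglongrightarrow> 0" for b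
  proof (rule tendsto_norm_zero_cancel)
    have "filterlim (\<lambda>n. Re l * real n) at_top sequentially"
      using assms by (intro filterlim_tendsto_pos_mult_at_top[OF tendsto_const] filterlim_real_sequentially) auto
    then have "(\<lambda>n. (Re l * real n) ^ b / exp (Re l * real n)) \<longlonglongrightarrow> 0"
      by (rule filterlim_compose[OF tendsto_power_div_exp_0])
    then have "(\<lambda>n. 1 / Re l ^ b * ((Re l * real n) ^ b / exp (Re l * real n))) \<longlonglongrightarrow> 1 / Re l ^ b * 0"
      by (intro tendsto_mult tendsto_const)
    also have "(\<lambda>n. 1 / Re l ^ b * ((Re l * real n) ^ b / exp (Re l * real n))) = (\<lambda>n. norm (of_nat n ^ b * exp (- (l * of_nat n))))"
      using assms by (auto simp: norm_mult norm_power norm_divide exp_minus field_simps power_mult_distrib)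
    finally show "(\<lambda>n. norm (of_nat n ^ b * exp (- (l * of_nat n)))) \<longlonglongrightarrow> 0" by simp
  qed
  {
    case 0
    show ?case
    proof (intro exI[of _ "\<lambda>z. - (exp (- (l * z)) / l)"] conjI allI)
      show "(\<lambda>n. - (exp (- (l * of_nat n)) / l)) \<longlonglongrightarrow> 0"
        using tendsto_minus[OF tendsto_divide[OF lim[of 0] tendsto_const[of l]]] l by simp
    qed (use l in \<open>auto intro!: derivative_eq_intros\<close>)
  next
    case (Suc a)
    then obtain F where F: "\<And>z. (F has_field_derivative z ^ a * exp (- (l * z))) (at z)"
      "F 0 = - (fact a / l ^ (a + 1))" "(\<lambda>n. F (of_nat n)) \<longlonglongrightarrow> 0" by blast
    define G where "G = (\<lambda>z. of_nat (Suc a) / l * F z - z ^ Suc a * exp (- (l * z)) / l)"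
    have "(G has_field_derivative z ^ Suc a * exp (- (l * z))) (at z)" for z
      unfolding G_def using l
      by (auto intro!: derivative_eq_intros F simp del: power_Suc of_nat_Suc) (simp add: field_simps)
    moreover have "G 0 = - (fact (Suc a) / l ^ (Suc a + 1))" by (simp add: G_def F)
    moreover have "(\<lambda>n. G (of_nat n)) \<longlonglongrightarrow> of_nat (Suc a) / l * 0 - 0 / l"
      unfolding G_def by (intro tendsto_intros F lim l)
    ultimately show ?case by auto
  }
qed

lemma integrable_power_exp:
  assumes "r > 0"
  shows "(\<lambda>x::real. x ^ a * exp (- (r * x))) integrable_on {0<..}"
proof -
  have "(\<lambda>t. norm (complex_of_real t powr (of_nat (a + 1) - 1) / of_real (exp (r * t)))) integrable_on {0<..}"
    using absolutely_integrable_Gamma_integral[of "of_nat (a + 1)" r] assms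
    by (simp add: absolutely_integrable_on_def)
  then show ?thesis
    by (rule integrable_eq) (auto simp: norm_divide norm_mult norm_power norm_inverse exp_minus divide_inverse powr_nat)
qed

lemma has_integral_power_exp:
  assumes l: "Re l > 0"
  shows "((\<lambda>x. of_real x ^ a * exp (- (l * of_real x))) has_integral fact a / l ^ (a + 1)) {0<..}"
proof -
  obtain F where F: "\<And>z. (F has_field_derivative z ^ a * exp (- (l * z))) (at z)"
      "F 0 = - (fact a / l ^ (a + 1))" "(\<lambda>n. F (of_nat n)) \<longlonglongrightarrow> 0"
    using ex_antiderivative_power_exp[OF l, of a] by blast
  define f where "f = (\<lambda>x. of_real x ^ a * exp (- (l * of_real x)))"
  have "((\<lambda>x. F (of_real x)) has_vector_derivative f x) (at x within S)" for x S
    unfolding f_def by (rule has_vector_derivative_at_within[OF has_vector_derivative_real_field[OF F(1)]])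
  then have "(f has_integral F (of_real (real n)) - F (of_real 0)) {0..real n}" for n
    by (intro fundamental_theorem_of_calculus[where f = "\<lambda>x. F (of_real x)"]) simp_all
  then have "(f has_integral F (of_nat n) - F 0) {0<..<real n}" for n
    by (simp add: has_integral_Icc_iff_Ioo)
  then have "((\<lambda>x. if x \<in> {0<..<real n} then f x else 0) has_integral F (of_nat n) - F 0) {0<..}" for n
    by (subst has_integral_restrict) auto
  moreover have "(\<lambda>x. x ^ a * exp (- (Re l * x))) integrable_on {0<..}"
    by (rule integrable_power_exp[OF l])
  moreover have "\<forall>x\<in>{0<..}. norm (if x \<in> {0<..<real n} then f x else 0) \<le> x ^ a * exp (- (Re l * x))" for n
    by (auto simp: f_def norm_mult norm_power)
  moreover have "\<forall>x\<in>{0<..}. (\<lambda>n. if x \<in> {0<..<real n} then f x else 0) \<longlonglongrightarrow> f x"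
  proof
    fix x :: real assume x: "x \<in> {0<..}"
    have "eventually (\<lambda>n. real n > x) sequentially"
      using filterlim_real_sequentially by (auto simp: filterlim_at_top_dense)
    then have "eventually (\<lambda>n. f x = (if x \<in> {0<..<real n} then f x else 0)) sequentially"
      by eventually_elim (use x in auto)
    then show "(\<lambda>n. if x \<in> {0<..<real n} then f x else 0) \<longlonglongrightarrow> f x"
      by (rule Lim_transform_eventually[OF tendsto_const])
  qed
  moreover have "(\<lambda>n. F (of_nat n) - F 0) \<longlonglongrightarrow> 0 - F 0"
    by (intro tendsto_intros F)
  ultimately have "(f has_integral 0 - F 0) {0<..}"
    by (rule has_integral_dominated_convergence)
  then show ?thesis by (simp add: F f_def)
qed

section \<open>Uniform bounds for the two power series expansions\<close>

lemma exp_over_one_minus_exp_le: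
  assumes "x > (0::real)"
  shows "exp (- x) / (1 - exp (- (2 * x))) \<le> 1 / x"
proof -
  have "exp (-x) / (1 - exp (- (2 * x))) = 1 / (2 * sinh x)"
    using assms by (simp add: sinh_field_def field_simps flip: exp_add)
  also have "\<dots> \<le> 1 / x"
    using real_le_x_sinh[of x] assms sinh_real_pos_iff[of x]
    by (intro divide_left_mono) (auto simp: sinh_field_def exp_minus)
  finally show ?thesis .
qed

text \<open>Uniformity in J makes this a majorant. The factor 1 / x reflects the singularity of q /
  (1 - q^2) at x = 0 and costs one power of x in the integrals.\<close>

lemma norm_odd_geometric_sum_le:
  fixes q :: complex
  assumes "norm q = exp (- x)" "x > 0"
  shows "norm (\<Sum>j<J. q ^ (2 * j + 1)) \<le> 1 / x"
proof -
  define r where "r = exp (- (2 * x))"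
  have r: "0 < r" "r < 1" using assms by (auto simp: r_def)
  have "norm (\<Sum>j<J. q ^ (2 * j + 1)) \<le> (\<Sum>j<J. norm (q ^ (2 * j + 1)))" by (rule norm_sum)
  also have "\<dots> = (\<Sum>j<J. exp (- x) * r ^ j)"
    by (intro sum.cong) (auto simp: norm_power norm_mult assms r_def power_mult mult.commute simp flip: exp_of_nat_mult exp_double)
  also have "\<dots> = exp (- x) * ((1 - r ^ J) / (1 - r))"
    using r by (simp add: sum_gp_strict flip: sum_distrib_left)
  also have "\<dots> \<le> exp (- x) * (1 / (1 - r))"
    using r by (intro mult_left_mono divide_right_mono) auto
  also have "\<dots> \<le> 1 / x" using exp_over_one_minus_exp_le[OF assms(2)] by (simp add: r_def)
  finally show ?thesis .
qed

lemma odd_geometric_sums: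
  fixes q :: complex
  assumes "norm q < 1"
  shows "(\<lambda>j. q ^ (2 * j + 1)) sums (q / (1 - q\<^sup>2))"
proof -
  have "norm (q\<^sup>2) < 1" using assms by (simp add: norm_power power_less_one_iff)
  then have "(\<lambda>j. q * (q\<^sup>2) ^ j) sums (q * (1 / (1 - q\<^sup>2)))"
    by (intro sums_mult geometric_sums)
  moreover have "q * (q\<^sup>2) ^ j = q ^ (2 * j + 1)" for j by (simp add: power_mult)
  ultimately show ?thesis by (simp only: times_divide_eq_right mult_1_right)
qed

text \<open>The explicit remainder keeps the alternating signs in play. Absolute values term by term
  would give order 1 / x^2 near 0; with the further 1 / x from the other series, the case x^2 would
  no longer be integrable.\<close>

lemma alternating_weighted_sum_closed_form:
  fixes p :: complex
  shows "(1 + p)\<^sup>2 * (\<Sum>n<N. (-1) ^ n * of_nat (n + 1) * p ^ (n + 1))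
    = p - (-1) ^ N * (of_nat (N + 1) * p ^ (N + 1) + of_nat N * p ^ (N + 2))"
proof (induction N)
  case (Suc N)
  have "(1 + p)\<^sup>2 * (\<Sum>n<Suc N. (-1) ^ n * of_nat (n + 1) * p ^ (n + 1))
    = p - (-1) ^ N * (of_nat (N + 1) * p ^ (N + 1) + of_nat N * p ^ (N + 2))
      + (1 + p)\<^sup>2 * ((-1) ^ N * of_nat (N + 1) * p ^ (N + 1))"
    using Suc by (simp add: distrib_left)
  then show ?case by (simp add: algebra_simps power2_eq_square)
qed simp

text \<open>Uniformly in N, up to the factor 1/x, the partial sums of the alternating series for
  p / (1 + p)^2 inherit the decay of p; this is what makes dominated convergence possible down to
  the weight where the double series is not absolutely convergent.\<close>

lemma norm_alternating_weighted_sum_le: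
  fixes p :: complex
  assumes p: "norm p = exp (- x)" and x: "x > 0" and Re: "Re (1 + p) \<ge> 1 / 2"
  shows "norm (\<Sum>n<N. (-1) ^ n * of_nat (n + 1) * p ^ (n + 1)) \<le> 8 * exp (- x) * (1 + 1 / x)"
proof -
  let ?S = "\<Sum>n<N. (-1) ^ n * of_nat (n + 1) * p ^ (n + 1)"
  have "(1 / 2) ^ 2 \<le> norm (1 + p) ^ 2"
    using Re abs_Re_le_cmod[of "1 + p"] by (intro power_mono) auto
  then have "(1 / 4) * norm ?S \<le> norm (1 + p) ^ 2 * norm ?S"
    by (intro mult_right_mono) (auto simp: power2_eq_square)
  also have "\<dots> = norm ((1 + p)\<^sup>2 * ?S)" by (simp add: norm_mult norm_power)
  also have "\<dots> = norm (p - (-1) ^ N * (of_nat (N + 1) * p ^ (N + 1) + of_nat N * p ^ (N + 2)))"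
    by (simp only: alternating_weighted_sum_closed_form)
  also have "\<dots> \<le> norm p + norm (of_nat (N + 1) * p ^ (N + 1) + of_nat N * p ^ (N + 2))"
    by (rule norm_triangle_le_diff) (simp add: norm_mult norm_power)
  also have "norm (of_nat (N + 1) * p ^ (N + 1) + of_nat N * p ^ (N + 2))
      \<le> real (N + 1) * norm p ^ (N + 1) + real N * norm p ^ (N + 2)"
    by (rule norm_triangle_le) (simp add: norm_mult norm_power del: of_nat_add of_nat_Suc)
  also have "norm p + (real (N + 1) * norm p ^ (N + 1) + real N * norm p ^ (N + 2))
     \<le> norm p + (real (N + 1) * norm p ^ (N + 1) + real N * norm p ^ (N + 1))"
    using p x by (intro add_left_mono mult_left_mono power_decreasing) auto
  also have "\<dots> = norm p * (1 + norm p ^ N + 2 * (real N * norm p ^ N))"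
    by (simp add: algebra_simps)
  also have "\<dots> \<le> norm p * (1 + 1 + 2 * (1 / x))"
  proof -
    have pN: "norm p ^ N = exp (- (real N * x))" by (simp add: p flip: exp_of_nat_mult)
    have "real N * x \<le> exp (real N * x)" using exp_ge_add_one_self[of "real N * x"] by linarith
    then have "real N * norm p ^ N \<le> 1 / x"
      unfolding pN using x by (simp add: exp_minus field_simps)
    moreover have "norm p ^ N \<le> 1" using p x by (intro power_le_one) auto
    ultimately show ?thesis by (intro mult_left_mono add_mono) auto
  qed
  finally show ?thesis by (simp add: p algebra_simps)
qed

lemma alternating_weighted_sums:
  fixes p :: complex
  assumes "norm p < 1"
  shows "(\<lambda>n. (-1) ^ n * of_nat (n + 1) * p ^ (n + 1)) sums (p / (1 + p)\<^sup>2)"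
proof -
  have "(\<lambda>n. p * (of_nat (Suc n) * (- p) ^ n)) sums (p * (1 / (1 - - p)\<^sup>2))"
    by (intro sums_mult geometric_deriv_sums) (use assms in simp)
  moreover have "p * (of_nat (Suc n) * (- p) ^ n) = (-1) ^ n * of_nat (n + 1) * p ^ (n + 1)" for n
    unfolding power_minus[of p n] by (simp add: mult_ac)
  ultimately show ?thesis by (simp only: diff_minus_eq_add times_divide_eq_right mult_1_right)
qed

text \<open>Keeps 1 + p away from 0: up to pi / 2 the cosine is nonnegative, and beyond that exp
  (-x) is at most 1 / 2.\<close>

lemma Re_one_plus_exp_ge:
  assumes "x > (0::real)"
  shows "Re (1 + exp ((\<i> - 1) * of_real x)) \<ge> 1 / 2"
proof (cases "x \<le> pi / 2")
  case True
  then have "cos x \<ge> 0" using assms by (intro cos_ge_zero) auto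
  then show ?thesis by (simp add: Re_exp)
next
  case False
  then have "x \<ge> 1" using pi_gt3 by linarith
  then have "exp x \<ge> 2" using exp_ge_add_one_self[of x] by linarith
  then have "exp (- x) \<le> 1 / 2" by (simp add: exp_minus field_simps)
  moreover have "exp (- x) * cos x \<ge> exp (- x) * (- 1)" by (intro mult_left_mono) auto
  ultimately show ?thesis by (simp add: Re_exp)
qed

lemma integral_inner_series:
  assumes a: "a \<ge> 1" and n: "n \<ge> 1"
  defines "f \<equiv> (\<lambda>x. of_real x ^ a * (exp ((\<i> - 1) * of_real x) ^ n *
        (exp (- (1 + \<i>) * of_real x) / (1 - (exp (- (1 + \<i>) * of_real x))\<^sup>2))))"
  shows "f integrable_on {0<..}"
    and "(\<lambda>j. fact a / ((1 - \<i>) * (of_nat n + \<i> * of_nat (2 * j + 1))) ^ (a + 1)) sums integral {0<..} f"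
proof -
  define p where "p = (\<lambda>x. exp ((\<i> - 1) * complex_of_real x))"
  define q where "q = (\<lambda>x. exp (- (1 + \<i>) * complex_of_real x))"
  have np: "norm (p x) = exp (- x)" and nq: "norm (q x) = exp (- x)" for x
    by (simp_all add: p_def q_def)
  \<comment> \<open>The exponent n (1 - i) + (2j + 1)(1 + i) is divisible by 1 - i because 1 + i = i
    (1 - i). This is where the power of 1 - i in the final constants comes from.\<close>
  define l where "l = (\<lambda>j. (1 - \<i>) * (of_nat n + \<i> * of_nat (2 * j + 1)))"
  have pq: "p x ^ n * q x ^ (2 * j + 1) = exp (- (l j * of_real x))" for x j
    unfolding p_def q_def l_def exp_of_nat_mult[symmetric] exp_add[symmetric]
    by (rule arg_cong[where f = exp]) (simp add: algebra_simps)
  have int: "((\<lambda>x. \<Sum>j<J. of_real x ^ a * (p x ^ n * q x ^ (2 * j + 1))) has_integral (\<Sum>j<J. fact a / l j ^ (a + 1))) {0<..}" for J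
    unfolding pq by (intro has_integral_sum has_integral_power_exp) (use n in \<open>auto simp: l_def\<close>)
  have h: "(\<lambda>x::real. x ^ (a - 1) * exp (- (1 * x))) integrable_on {0<..}"
    by (rule integrable_power_exp) simp
  have bound: "norm (\<Sum>j<J. of_real x ^ a * (p x ^ n * q x ^ (2 * j + 1))) \<le> x ^ (a - 1) * exp (- (1 * x))"
    if x: "x \<in> {0<..}" for J x
  proof -
    have "(\<Sum>j<J. of_real x ^ a * (p x ^ n * q x ^ (2 * j + 1))) = of_real x ^ a * p x ^ n * (\<Sum>j<J. q x ^ (2 * j + 1))"
      by (simp add: sum_distrib_left mult_ac)
    then have "norm (\<Sum>j<J. of_real x ^ a * (p x ^ n * q x ^ (2 * j + 1))) = x ^ a * exp (- x) ^ n * norm (\<Sum>j<J. q x ^ (2 * j + 1))"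
      using x by (simp only: norm_mult norm_power np) simp
    also have "\<dots> \<le> x ^ a * exp (- x) ^ 1 * (1 / x)"
    proof (intro mult_mono)
      show "exp (- x) ^ n \<le> exp (- x) ^ 1" using x n by (intro power_decreasing) auto
      show "norm (\<Sum>j<J. q x ^ (2 * j + 1)) \<le> 1 / x" using norm_odd_geometric_sum_le[OF nq] x by simp
    qed (use x in auto)
    also have "x ^ a = x ^ (a - 1) * x" using a by (simp flip: power_Suc2)
    finally show ?thesis using x by simp
  qed
  have conv: "(\<lambda>J. \<Sum>j<J. of_real x ^ a * (p x ^ n * q x ^ (2 * j + 1))) \<longlonglongrightarrow> of_real x ^ a * (p x ^ n * (q x / (1 - (q x)\<^sup>2)))"
    if "x \<in> {0<..}" for x
    using sums_mult[OF sums_mult[OF odd_geometric_sums[of "q x"]], of "of_real x ^ a" "p x ^ n"] that nq[of x]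
    by (simp add: sums_def)
  note dc = dominated_convergence[OF has_integral_integrable[OF int] h bound conv]
  show "f integrable_on {0<..}" using dc(1) by (simp only: f_def p_def q_def)
  show "(\<lambda>j. fact a / ((1 - \<i>) * (of_nat n + \<i> * of_nat (2 * j + 1))) ^ (a + 1)) sums integral {0<..} f"
    using dc(2) unfolding sums_def integral_unique[OF int] by (simp only: f_def p_def q_def l_def)
qed

text \<open>The majorant loses two powers of x at the origin, one from q / (1 - q^2) and one from
  the partial sums in p. Hence the condition on \<open>a\<close>, which x^(2k) with k = 1 just
  meets.\<close>

lemma integral_outer_series:
  assumes a: "a \<ge> 2"
  defines "f \<equiv> (\<lambda>n x. of_real x ^ a * (exp ((\<i> - 1) * of_real x) ^ n *
        (exp (- (1 + \<i>) * of_real x) / (1 - (exp (- (1 + \<i>) * of_real x))\<^sup>2))))"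
  defines "g \<equiv> (\<lambda>x. of_real x ^ a * (exp ((\<i> - 1) * of_real x) / (1 + exp ((\<i> - 1) * of_real x))\<^sup>2 *
        (exp (- (1 + \<i>) * of_real x) / (1 - (exp (- (1 + \<i>) * of_real x))\<^sup>2))))"
  shows "g integrable_on {0<..}"
    and "(\<lambda>n. (-1) ^ n * of_nat (n + 1) * integral {0<..} (f (n + 1))) sums integral {0<..} g"
proof -
  define p where "p = (\<lambda>x. exp ((\<i> - 1) * complex_of_real x))"
  define q where "q = (\<lambda>x. exp (- (1 + \<i>) * complex_of_real x))"
  have np: "norm (p x) = exp (- x)" and nq: "norm (q x) = exp (- x)" for x
    by (simp_all add: p_def q_def)
  define Q where "Q = (\<lambda>x. q x / (1 - (q x)\<^sup>2))"
  have f: "f = (\<lambda>n x. of_real x ^ a * (p x ^ n * Q x))" and g: "g = (\<lambda>x. of_real x ^ a * (p x / (1 + p x)\<^sup>2 * Q x))"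
    by (simp_all add: f_def g_def p_def q_def Q_def)
  have Q: "norm (Q x) \<le> 1 / x" if "x > 0" for x
  proof (rule Lim_bounded)
    show "(\<lambda>J. norm (\<Sum>j<J. q x ^ (2 * j + 1))) \<longlonglongrightarrow> norm (Q x)"
      using odd_geometric_sums[of "q x"] nq[of x] that unfolding sums_def Q_def by (intro tendsto_norm) simp
    show "\<forall>J\<ge>0. norm (\<Sum>j<J. q x ^ (2 * j + 1)) \<le> 1 / x"
      using norm_odd_geometric_sum_le[OF nq that] by blast
  qed
  have int: "((\<lambda>x. \<Sum>n<N. ((-1) ^ n * of_nat (n + 1)) * f (n + 1) x) has_integral
      (\<Sum>n<N. ((-1) ^ n * of_nat (n + 1)) * integral {0<..} (f (n + 1)))) {0<..}" for N
  proof (intro has_integral_sum has_integral_mult_right integrable_integral)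
    show "f (n + 1) integrable_on {0<..}" for n
      unfolding f_def by (rule integral_inner_series) (use a in auto)
  qed simp
  have h: "(\<lambda>x::real. 8 * (x ^ (a - 1) * exp (- (1 * x))) + 8 * (x ^ (a - 2) * exp (- (1 * x)))) integrable_on {0<..}"
    by (intro integrable_add integrable_on_mult_right integrable_power_exp) simp_all
  have eq: "(\<Sum>n<N. ((-1) ^ n * of_nat (n + 1)) * f (n + 1) x)
      = of_real x ^ a * ((\<Sum>n<N. (-1) ^ n * of_nat (n + 1) * p x ^ (n + 1)) * Q x)" for N x
    unfolding f sum_distrib_left sum_distrib_right by (intro sum.cong refl) (simp only: mult_ac)
  have bound: "norm (\<Sum>n<N. ((-1) ^ n * of_nat (n + 1)) * f (n + 1) x)
      \<le> 8 * (x ^ (a - 1) * exp (- (1 * x))) + 8 * (x ^ (a - 2) * exp (- (1 * x)))"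
    if x: "x \<in> {0<..}" for N x
  proof -
    have "Re (1 + p x) \<ge> 1 / 2" unfolding p_def by (rule Re_one_plus_exp_ge) (use x in simp)
    then have "norm (\<Sum>n<N. (-1) ^ n * of_nat (n + 1) * p x ^ (n + 1)) \<le> 8 * exp (- x) * (1 + 1 / x)"
      using norm_alternating_weighted_sum_le[OF np] x by simp
    then have "norm (\<Sum>n<N. ((-1) ^ n * of_nat (n + 1)) * f (n + 1) x) \<le> x ^ a * ((8 * exp (- x) * (1 + 1 / x)) * (1 / x))"
      unfolding eq norm_mult norm_power using x Q[of x]
      by (intro mult_mono) auto
    also have "\<dots> = 8 * (x ^ a / x * exp (- x)) + 8 * (x ^ a / x\<^sup>2 * exp (- x))"
      by (simp add: algebra_simps power2_eq_square)
    also have "x ^ a / x = x ^ (a - 1)" using a x by (simp add: power_diff)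
    also have "x ^ a / x\<^sup>2 = x ^ (a - 2)" using a x by (simp add: power_diff)
    finally show ?thesis by simp
  qed
  have conv: "(\<lambda>N. \<Sum>n<N. ((-1) ^ n * of_nat (n + 1)) * f (n + 1) x) \<longlonglongrightarrow> g x" if "x \<in> {0<..}" for x
    using alternating_weighted_sums[of "p x"] np[of x] that unfolding eq g sums_def
    by (intro tendsto_mult tendsto_const) simp
  note dc = dominated_convergence[OF has_integral_integrable[OF int] h bound conv]
  show "g integrable_on {0<..}" by (rule dc(1))
  show "(\<lambda>n. (-1) ^ n * of_nat (n + 1) * integral {0<..} (f (n + 1))) sums integral {0<..} g"
    using dc(2) unfolding sums_def integral_unique[OF int] .
qed

text \<open>As q is the conjugate of p, extending the fraction by (1 + q)(1 - p) makes the
  denominator real: it becomes D^2 D' with D and D' the squared moduli of 1 + p and 1 - p. The real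
  part then concerns only the numerator (1 - E^2) - 2 i E sin x, and D D' = 4 E^2 (cosh^2 x - cos^2
  x) produces sinh^2 x + sin^2 x.\<close>

lemma integrand_eq_Re:
  fixes x \<epsilon> :: real
  assumes x: "x > 0" and \<epsilon>: "\<epsilon> = 1 \<or> \<epsilon> = -1"
  shows "(sinh x + \<epsilon> * sin x) / (((sinh x)\<^sup>2 + (sin x)\<^sup>2) * (cosh x + cos x)) =
    4 * Re ((1 + of_real \<epsilon> * \<i>) * (exp ((\<i> - 1) * of_real x) / (1 + exp ((\<i> - 1) * of_real x))\<^sup>2 *
        (exp (- (1 + \<i>) * of_real x) / (1 - (exp (- (1 + \<i>) * of_real x))\<^sup>2))))"
proof -
  define E c s where "E = exp (- x)" and "c = cos x" and "s = sin x"
  define p q where "p = exp ((\<i> - 1) * complex_of_real x)" and "q = exp (- (1 + \<i>) * complex_of_real x)"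
  have p: "p = Complex (E * c) (E * s)" and q: "q = Complex (E * c) (- (E * s))"
    by (simp_all add: p_def q_def E_def c_def s_def complex_eq_iff Re_exp Im_exp)
  have E: "0 < E" "E < 1" using x by (auto simp: E_def)
  have cs: "c\<^sup>2 + s\<^sup>2 = 1" by (simp add: c_def s_def)
  have "E * exp x = 1" by (simp add: E_def flip: exp_add)
  then have hyp: "2 * E * sinh x = 1 - E\<^sup>2" "2 * E * cosh x = 1 + E\<^sup>2"
    unfolding sinh_field_def cosh_field_def E_def[symmetric]
    by (simp_all add: distrib_left right_diff_distrib power2_eq_square)
  define D where "D = 1 + 2 * E * c + E\<^sup>2"
  define D' where "D' = 1 - 2 * E * c + E\<^sup>2"
  have D: "D = 2 * E * (cosh x + c)" "D' = 2 * E * (cosh x - c)"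
    using hyp by (simp_all add: D_def D'_def algebra_simps)
  have abs_c: "\<bar>c\<bar> \<le> 1" by (simp add: c_def)
  have "(cosh x)\<^sup>2 > 1\<^sup>2" using x by (simp add: cosh_square_eq)
  then have "cosh x > 1" by (rule power2_less_imp_less) simp
  then have pos: "cosh x + c > 0" "cosh x - c > 0" using abs_c by linarith+
  have Dpos: "D > 0" "D' > 0" using D pos E by auto
  have pq: "p * q = of_real (E\<^sup>2)"
    using cs by (simp add: p q complex_eq_iff power2_eq_square algebra_simps) (metis distrib_left mult.right_neutral)
  have D1: "(1 + p) * (1 + q) = of_real D"
    using pq by (simp add: D_def distrib_left distrib_right p q complex_eq_iff)
  have D2: "(1 - p) * (1 - q) = of_real D'"
    using pq by (simp add: D'_def algebra_simps p q complex_eq_iff)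
  have nz: "1 + p \<noteq> 0" "1 + q \<noteq> 0" "1 - p \<noteq> 0" "1 - q \<noteq> 0" using D1 D2 Dpos by auto
  have "p / (1 + p)\<^sup>2 * (q / (1 - q\<^sup>2)) = (p * q) * ((1 + q) * (1 - p)) / (((1 + p) * (1 + q))\<^sup>2 * ((1 - p) * (1 - q)))"
  proof -
    have "1 - q\<^sup>2 = (1 - q) * (1 + q)" by (simp add: algebra_simps power2_eq_square)
    then show ?thesis using nz by (simp add: divide_simps) (simp add: power2_eq_square)
  qed
  also have "\<dots> = of_real (E\<^sup>2 / (D\<^sup>2 * D')) * ((1 + q) * (1 - p))"
    unfolding pq D1 D2 by simp
  finally have G: "p / (1 + p)\<^sup>2 * (q / (1 - q\<^sup>2)) = of_real (E\<^sup>2 / (D\<^sup>2 * D')) * ((1 + q) * (1 - p))" .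
  have qp: "(1 + q) * (1 - p) = Complex (1 - E\<^sup>2) (- 2 * (E * s))"
  proof -
    have "(1 + q) * (1 - p) = 1 - p * q + (q - p)" by (simp add: algebra_simps)
    then show ?thesis unfolding pq by (simp add: p q complex_eq_iff)
  qed
  have "Re ((1 + of_real \<epsilon> * \<i>) * (p / (1 + p)\<^sup>2 * (q / (1 - q\<^sup>2)))) = E\<^sup>2 / (D\<^sup>2 * D') * (1 - E\<^sup>2 + 2 * \<epsilon> * (E * s))"
  proof -
    have *: "Re ((1 + of_real \<epsilon> * \<i>) * (of_real r * Complex u v)) = r * (u - \<epsilon> * v)" for r u v
      by (simp add: algebra_simps)
    show ?thesis unfolding G qp * by (simp add: mult_ac)
  qed
  also have "1 - E\<^sup>2 + 2 * \<epsilon> * (E * s) = 2 * E * (sinh x + \<epsilon> * s)"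
    unfolding hyp(1)[symmetric] by (simp add: algebra_simps)
  also have "D\<^sup>2 * D' = (2 * E * (cosh x + c)) * (4 * E\<^sup>2 * ((sinh x)\<^sup>2 + s\<^sup>2))"
  proof -
    have "(cosh x + c) * (cosh x - c) = (sinh x)\<^sup>2 + s\<^sup>2"
      using cs by (simp add: algebra_simps power2_eq_square[symmetric] cosh_square_eq)
    moreover have "(2 * E * u) * (2 * E * v) = 4 * E\<^sup>2 * (u * v)" for u v
      by (simp add: power2_eq_square)
    ultimately have DD: "D * D' = 4 * E\<^sup>2 * ((sinh x)\<^sup>2 + s\<^sup>2)"
      by (simp only: D)
    have "D\<^sup>2 * D' = D * (D * D')" by (simp add: power2_eq_square)
    then show ?thesis unfolding DD by (simp only: D(1))
  qed
  also have "4 * (E\<^sup>2 / ((2 * E * (cosh x + c)) * (4 * E\<^sup>2 * ((sinh x)\<^sup>2 + s\<^sup>2))) * (2 * E * (sinh x + \<epsilon> * s)))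
      = (sinh x + \<epsilon> * s) / (((sinh x)\<^sup>2 + s\<^sup>2) * (cosh x + c))"
  proof -
    have "4 * (E\<^sup>2 / ((2 * E * u) * (4 * E\<^sup>2 * v)) * (2 * E * w)) = w / (v * u)" for u v w
      using E by (simp add: divide_simps)
    then show ?thesis .
  qed
  finally show ?thesis unfolding p_def q_def s_def c_def by simp
qed

text \<open>All terms of the double series share the factor \<open>\<rho>\<close>. Its reality is
  essential, since the partial fractions give only the real part of the derivative of
  \<open>dcth\<close>. The 4 of the integrand is used up by 1 / 2 from the conjugate poles and 1 / 2
  from folding n and -n.\<close>

lemma has_integral_U_sq:
  fixes \<epsilon> \<rho> :: real
  assumes k: "k \<ge> 1" and \<epsilon>: "\<epsilon> = 1 \<or> \<epsilon> = -1"
    and \<rho>: "(1 + of_real \<epsilon> * \<i>) / (1 - \<i>) ^ (2 * k + 1) = of_real \<rho>"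
  shows "((\<lambda>x. x ^ (2 * k) * (sinh x + \<epsilon> * sin x) / (((sinh x)\<^sup>2 + (sin x)\<^sup>2) * (cosh x + cos x)))
    has_integral (\<rho> * Re ((deriv ^^ (2 * k - 1)) U_sq \<i>))) {0<..}"
proof -
  define w where "w = 1 + of_real \<epsilon> * \<i>"
  define f where "f = (\<lambda>n x. of_real x ^ (2 * k) * (exp ((\<i> - 1) * of_real x) ^ n *
        (exp (- (1 + \<i>) * of_real x) / (1 - (exp (- (1 + \<i>) * of_real x))\<^sup>2))))"
  define G where "G = (\<lambda>x. exp ((\<i> - 1) * of_real x) / (1 + exp ((\<i> - 1) * of_real x))\<^sup>2 *
        (exp (- (1 + \<i>) * of_real x) / (1 - (exp (- (1 + \<i>) * of_real x))\<^sup>2)))"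
  define g where "g = (\<lambda>x. of_real x ^ (2 * k) * G x)"
  define \<phi> where "\<phi> = (\<lambda>n::nat. (deriv ^^ (2 * k - 1)) dcth (\<i> + of_nat n))"
  have inner: "Re (w * integral {0<..} (f n)) = \<rho> / 2 * Re (\<phi> n)" if n: "n \<ge> 1" for n
  proof -
    define t where "t = (\<lambda>j. 1 / (of_nat n + \<i> * of_nat (2 * j + 1)) ^ (2 * k + 1) :: complex)"
    have "(\<lambda>j. fact (2 * k) / ((1 - \<i>) * (of_nat n + \<i> * of_nat (2 * j + 1))) ^ (2 * k + 1)) sums integral {0<..} (f n)"
      unfolding f_def by (rule integral_inner_series(2)) (use k n in auto)
    then have "(\<lambda>j. w * (fact (2 * k) / ((1 - \<i>) * (of_nat n + \<i> * of_nat (2 * j + 1))) ^ (2 * k + 1))) sums (w * integral {0<..} (f n))"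
      by (rule sums_mult)
    also have "(\<lambda>j. w * (fact (2 * k) / ((1 - \<i>) * (of_nat n + \<i> * of_nat (2 * j + 1))) ^ (2 * k + 1)))
       = (\<lambda>j. of_real (\<rho> * fact (2 * k)) * t j)"
    proof
      fix j
      have "w * (fact (2 * k) / ((1 - \<i>) * (of_nat n + \<i> * of_nat (2 * j + 1))) ^ (2 * k + 1)) = (w / (1 - \<i>) ^ (2 * k + 1)) * fact (2 * k) * t j"
        by (simp only: power_mult_distrib t_def) simp
      also have "w / (1 - \<i>) ^ (2 * k + 1) = of_real \<rho>" unfolding w_def by (rule \<rho>)
      finally show "w * (fact (2 * k) / ((1 - \<i>) * (of_nat n + \<i> * of_nat (2 * j + 1))) ^ (2 * k + 1)) = of_real (\<rho> * fact (2 * k)) * t j"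
        by simp
    qed
    finally have "(\<lambda>j. Re (of_real (\<rho> * fact (2 * k)) * t j)) sums Re (w * integral {0<..} (f n))"
      by (rule sums_Re)
    then have 1: "(\<lambda>j. \<rho> * fact (2 * k) * Re (t j)) sums Re (w * integral {0<..} (f n))"
      by (simp only: Re_complex_of_real Im_complex_of_real times_complex.simps mult_zero_left diff_zero)
    have "(\<lambda>j. 2 * fact (2 * k) * Re (t j)) sums Re (\<phi> n)"
      using higher_deriv_dcth_sums[of "real n" k] n k by (simp add: t_def \<phi>_def)
    then have "(\<lambda>j. \<rho> / 2 * (2 * fact (2 * k) * Re (t j))) sums (\<rho> / 2 * Re (\<phi> n))"
      by (rule sums_mult)
    then have "(\<lambda>j. \<rho> * fact (2 * k) * Re (t j)) sums (\<rho> / 2 * Re (\<phi> n))"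
      by (simp add: mult.assoc)
    with 1 show ?thesis by (rule sums_unique2)
  qed
  have int: "g integrable_on {0<..}"
    unfolding g_def G_def by (rule integral_outer_series(1)) (use k in auto)
  have "(\<lambda>n. (-1) ^ n * of_nat (n + 1) * integral {0<..} (f (n + 1))) sums integral {0<..} g"
    unfolding f_def g_def G_def by (rule integral_outer_series(2)) (use k in auto)
  then have "(\<lambda>n. Re (w * ((-1) ^ n * of_nat (n + 1) * integral {0<..} (f (n + 1))))) sums Re (w * integral {0<..} g)"
    by (intro sums_Re sums_mult)
  also have "(\<lambda>n. Re (w * ((-1) ^ n * of_nat (n + 1) * integral {0<..} (f (n + 1)))))
    = (\<lambda>n. \<rho> / 2 * Re ((-1) ^ n * of_nat (n + 1) * \<phi> (n + 1)))"
  proof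
    fix n
    have r: "(-1) ^ n * of_nat (n + 1) = complex_of_real ((-1) ^ n * real (n + 1))" by simp
    have 1: "Re (w * (complex_of_real c * z)) = c * Re (w * z)" for c z by (simp add: algebra_simps)
    have 2: "Re (complex_of_real c * z) = c * Re z" for c z by simp
    have 3: "Re (w * integral {0<..} (f (n + 1))) = \<rho> / 2 * Re (\<phi> (n + 1))"
      by (rule inner) simp
    show "Re (w * ((-1) ^ n * of_nat (n + 1) * integral {0<..} (f (n + 1)))) = \<rho> / 2 * Re ((-1) ^ n * of_nat (n + 1) * \<phi> (n + 1))"
      unfolding r 1 2 3 by (simp only: mult_ac)
  qed
  finally have 1: "(\<lambda>n. \<rho> / 2 * Re ((-1) ^ n * of_nat (n + 1) * \<phi> (n + 1))) sums Re (w * integral {0<..} g)" .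
  have "(\<lambda>n. (-1) ^ n * of_nat (n + 1) * \<phi> (n + 1)) sums ((deriv ^^ (2 * k - 1)) U_sq \<i> / 2)"
    unfolding \<phi>_def by (rule higher_deriv_U_sq_sums) (use k in simp)
  then have "(\<lambda>n. \<rho> / 2 * Re ((-1) ^ n * of_nat (n + 1) * \<phi> (n + 1))) sums (\<rho> / 2 * Re ((deriv ^^ (2 * k - 1)) U_sq \<i> / 2))"
    by (intro sums_mult sums_Re)
  with 1 have "Re (w * integral {0<..} g) = \<rho> / 2 * Re ((deriv ^^ (2 * k - 1)) U_sq \<i> / 2)"
    by (rule sums_unique2)
  then have val: "4 * Re (w * integral {0<..} g) = \<rho> * Re ((deriv ^^ (2 * k - 1)) U_sq \<i>)" by simp
  have "((\<lambda>x. w * g x) has_integral w * integral {0<..} g) {0<..}"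
    by (intro has_integral_mult_right integrable_integral int)
  from has_integral_linear[OF this bounded_linear_Re]
  have "((\<lambda>x. Re (w * g x)) has_integral Re (w * integral {0<..} g)) {0<..}"
    by (simp only: o_def)
  then have "((\<lambda>x. 4 * Re (w * g x)) has_integral 4 * Re (w * integral {0<..} g)) {0<..}"
    by (rule has_integral_mult_right)
  then show ?thesis unfolding val
  proof (rule has_integral_eq[rotated])
    fix x :: real assume x: "x \<in> {0<..}"
    have "Re (w * (complex_of_real c * z)) = c * Re (w * z)" for c z by (simp add: algebra_simps)
    then have "4 * Re (w * g x) = x ^ (2 * k) * (4 * Re (w * G x))"
      unfolding g_def of_real_power[symmetric] by simp
    also have "4 * Re (w * G x) = (sinh x + \<epsilon> * sin x) / (((sinh x)\<^sup>2 + (sin x)\<^sup>2) * (cosh x + cos x))"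
      unfolding w_def G_def using integrand_eq_Re[OF _ \<epsilon>, of x] x by simp
    finally show "4 * Re (w * g x) = x ^ (2 * k) * (sinh x + \<epsilon> * sin x) / (((sinh x)\<^sup>2 + (sin x)\<^sup>2) * (cosh x + cos x))"
      by simp
  qed
qed

section \<open>Rational coefficients and the two families of integrals\<close>

lemma Re_higher_deriv_U_sq:
  assumes "k \<ge> 1"
  shows "\<exists>c1\<in>\<rat>. \<exists>c2\<in>\<rat>. Re ((deriv ^^ (2 * k - 1)) U_sq \<i>) =
    c1 * (Gamma (1 / 4 :: real) ^ (4 * k) / pi ^ k) + c2 * (Gamma (1 / 4 :: real) ^ (4 * k + 4) / pi ^ (k + 2))"
proof -
  obtain p q :: rat where "(deriv ^^ (2 * k - 1)) U_sq \<i> = of_rat p * e_sq ^ k + of_rat q * e_sq ^ (k + 1) / of_real pi"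
    using higher_deriv_U_sq[OF assms] by blast
  moreover have "of_rat r = complex_of_real (of_rat r)" for r
    by (cases r) (simp add: of_rat_rat)
  ultimately have "(deriv ^^ (2 * k - 1)) U_sq \<i> = of_real (of_rat p * (Gamma (1 / 4) ^ 4 / (32 * pi)) ^ k
      + of_rat q * (Gamma (1 / 4) ^ 4 / (32 * pi)) ^ (k + 1) / pi)"
    unfolding e_sq_eq_Gamma by simp
  then have "Re ((deriv ^^ (2 * k - 1)) U_sq \<i>) = of_rat p * (Gamma (1 / 4) ^ 4 / (32 * pi)) ^ k
      + of_rat q * (Gamma (1 / 4) ^ 4 / (32 * pi)) ^ (k + 1) / pi"
    by (simp only: Re_complex_of_real)
  also have "of_rat p * (Gamma (1 / 4) ^ 4 / (32 * pi)) ^ k = of_rat p / 32 ^ k * (Gamma (1 / 4 :: real) ^ (4 * k) / pi ^ k)"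
    by (simp add: power_divide power_mult_distrib power_mult)
  also have "of_rat q * (Gamma (1 / 4) ^ 4 / (32 * pi)) ^ (k + 1) / pi = of_rat q / 32 ^ (k + 1) * (Gamma (1 / 4 :: real) ^ (4 * k + 4) / pi ^ (k + 2))"
    by (simp add: power_divide power_mult_distrib power_mult power_add power2_eq_square) (simp only: mult_ac)
  finally show ?thesis
    by (intro bexI[of _ "of_rat p / 32 ^ k"] bexI[of _ "of_rat q / 32 ^ (k + 1)"]) simp_all
qed

lemma berndt_type_integral:
  fixes \<epsilon> \<rho> :: real
  assumes "k \<ge> 1" "\<epsilon> = 1 \<or> \<epsilon> = -1" "\<rho> \<in> \<rat>"
    "(1 + of_real \<epsilon> * \<i>) / (1 - \<i>) ^ (2 * k + 1) = of_real \<rho>"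
  shows "\<exists>c1\<in>\<rat>. \<exists>c2\<in>\<rat>.
    ((\<lambda>x. x ^ (2 * k) * (sinh x + \<epsilon> * sin x) / (((sinh x)\<^sup>2 + (sin x)\<^sup>2) * (cosh x + cos x)))
    has_integral (c1 * (Gamma (1 / 4 :: real) ^ (4 * k) / pi ^ k) + c2 * (Gamma (1 / 4 :: real) ^ (4 * k + 4) / pi ^ (k + 2)))) {0<..}"
proof -
  obtain c1 c2 where c: "c1 \<in> \<rat>" "c2 \<in> \<rat>" "Re ((deriv ^^ (2 * k - 1)) U_sq \<i>) =
    c1 * (Gamma (1 / 4 :: real) ^ (4 * k) / pi ^ k) + c2 * (Gamma (1 / 4 :: real) ^ (4 * k + 4) / pi ^ (k + 2))"
    using Re_higher_deriv_U_sq[OF assms(1)] by blast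
  show ?thesis
    using has_integral_U_sq[OF assms(1,2,4)] c assms(3) unfolding c(3)
    by (intro bexI[of _ "\<rho> * c1"] bexI[of _ "\<rho> * c2"]) (simp_all add: distrib_left mult.assoc)
qed

theorem theorem5p1:
  fixes m :: nat
  assumes "m \<ge> 1"
  shows "\<exists>c1\<in>\<rat>. \<exists>c2\<in>\<rat>. \<exists>d1\<in>\<rat>. \<exists>d2\<in>\<rat>.
    ((\<lambda>x::real. x ^ (4 * m) * (sinh x - sin x) /
        (((sinh x)\<^sup>2 + (sin x)\<^sup>2) * (cosh x + cos x)))
      has_integral
      (c1 * (Gamma (1/4 :: real) ^ (8 * m) / pi ^ (2 * m)) +
       c2 * (Gamma (1/4 :: real) ^ (8 * m + 4) / pi ^ (2 * m + 2)))) {0<..} \<and>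
    ((\<lambda>x::real. x ^ (4 * m - 2) * (sinh x + sin x) /
        (((sinh x)\<^sup>2 + (sin x)\<^sup>2) * (cosh x + cos x)))
      has_integral
      (d1 * (Gamma (1/4 :: real) ^ (8 * m - 4) / pi ^ (2 * m - 1)) +
       d2 * (Gamma (1/4 :: real) ^ (8 * m) / pi ^ (2 * m + 1)))) {0<..}"
proof -
  \<comment> \<open>The fourth power of 1 - i is real. For k = 2m and \<open>\<epsilon>\<close> = -1
    the numerator 1 - i cancels the one surplus factor, so \<open>\<rho>\<close> is 1 /
    (-4)^m.\<close>
  have "(1 - \<i>) ^ 4 = - 4" by (simp add: power4_eq_xxxx algebra_simps)
  then have pow: "(1 - \<i>) ^ (4 * m) = of_real ((- 4) ^ m)" by (simp add: power_mult)
  have "(1 - \<i>) \<noteq> 0" by (simp add: complex_eq_iff)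
  have "(1 + of_real (- 1) * \<i>) / (1 - \<i>) ^ (2 * (2 * m) + 1) = of_real (1 / (- 4) ^ m)"
    using pow \<open>(1 - \<i>) \<noteq> 0\<close> by simp
  from berndt_type_integral[OF _ _ _ this] assms
  obtain c1 c2 where c: "c1 \<in> \<rat>" "c2 \<in> \<rat>"
    "((\<lambda>x. x ^ (2 * (2 * m)) * (sinh x + (- 1) * sin x) / (((sinh x)\<^sup>2 + (sin x)\<^sup>2) * (cosh x + cos x)))
    has_integral (c1 * (Gamma (1 / 4 :: real) ^ (4 * (2 * m)) / pi ^ (2 * m)) + c2 * (Gamma (1 / 4 :: real) ^ (4 * (2 * m) + 4) / pi ^ (2 * m + 2)))) {0<..}"
    by auto
  \<comment> \<open>For k = 2m - 1 the exponent 2k + 1 is 4m - 1, one short of a multiple of 4.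
    Extending by 1 - i repairs this, and (1 + i)(1 - i) = 2 gives \<open>\<rho>\<close> = 2 /
    (-4)^m.\<close>
  have "4 * m = Suc (2 * (2 * m - 1) + 1)" using assms by simp
  then have "(1 - \<i>) ^ (4 * m) = (1 - \<i>) ^ (2 * (2 * m - 1) + 1) * (1 - \<i>)"
    by (simp only: power_Suc2)
  then have "(1 + of_real 1 * \<i>) / (1 - \<i>) ^ (2 * (2 * m - 1) + 1) = ((1 + \<i>) * (1 - \<i>)) / (1 - \<i>) ^ (4 * m)"
    using \<open>(1 - \<i>) \<noteq> 0\<close> by simp
  also have "\<dots> = of_real (2 / (- 4) ^ m)" unfolding pow by (simp add: algebra_simps)
  finally have "(1 + of_real 1 * \<i>) / (1 - \<i>) ^ (2 * (2 * m - 1) + 1) = of_real (2 / (- 4) ^ m)" .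
  moreover have "2 * m - 1 \<ge> 1" using assms by linarith
  moreover have "2 / (- 4) ^ m \<in> (\<rat> :: real set)" by simp
  ultimately
  obtain d1 d2 where d: "d1 \<in> \<rat>" "d2 \<in> \<rat>"
    "((\<lambda>x. x ^ (2 * (2 * m - 1)) * (sinh x + 1 * sin x) / (((sinh x)\<^sup>2 + (sin x)\<^sup>2) * (cosh x + cos x)))
    has_integral (d1 * (Gamma (1 / 4 :: real) ^ (4 * (2 * m - 1)) / pi ^ (2 * m - 1)) + d2 * (Gamma (1 / 4 :: real) ^ (4 * (2 * m - 1) + 4) / pi ^ (2 * m - 1 + 2)))) {0<..}"
    using berndt_type_integral[of "2 * m - 1" 1 "2 / (- 4) ^ m"] by blast
  have e: "2 * (2 * m) = 4 * m" "4 * (2 * m) = 8 * m" "2 * (2 * m - 1) = 4 * m - 2" "4 * (2 * m - 1) = 8 * m - 4"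
    "8 * m - 4 + 4 = 8 * m" "2 * m - 1 + 2 = 2 * m + 1"
    using assms by auto
  have s: "sinh x + (- 1) * sin x = sinh x - sin x" "sinh x + 1 * sin x = sinh x + sin x" for x :: real
    by simp_all
  show ?thesis
    using c(1,2) d(1,2) c(3)[unfolded e s] d(3)[unfolded e s] by blast
qed

end
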